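(* Let $d\ge2$ and let $f\in W_2^1(\mathbb{S}^{d-1})$ be such that $\int_{\mathbb{S}^{d-1}}f(y)\,d\sigma(y)=0$ and $\|f\|_2=1$. Then $$\min_{e\in\mathbb{S}^{d-1}}\left[\frac1{\omega_d}\int_{\mathbb{S}^{d-1}}(1-\langle x,e\rangle)|f(x)|^2\,d\sigma(x)\right]\|\nabla_0f\|_2^2\ge B_d,$$ where the constant $B_d$ is given by $$B_d=(d-1)\left(1-\frac{2}{\sqrt{d+3}}\right),\qquad d\ge3,$$ and, alternatively, for $d\ne3$, one may take $B_d=C_d^{-1}$, where $C_d$ is the constant in the Hardy-Rellich inequality, i.e. a constant such that $$\int_{\mathbb{S}^{d-1}}|g(x)|^2\,d\sigma(x)\le C_d\min_{e\in\mathbb{S}^{d-1}}\int_{\mathbb{S}^{d-1}}(1-\langle x,e\rangle)\left|(-\Delta_0)^{1/2}g(x)\right|^2d\sigma(x)$$ for all $g\in W_2^1(\mathbb{S}^{d-1})$ with zero mean. In particular, $B_2=1/8$ and $1/8$ is sharp.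
   Context: $\mathbb{S}^{d-1}$ is the unit sphere of $\mathbb{R}^d$, $d\sigma$ its rotation-invariant surface measure, $\omega_d=2\pi^{d/2}/\Gamma(d/2)$ its total mass, and $\|f\|_2=\left(\frac1{\omega_d}\int_{\mathbb{S}^{d-1}}|f|^2\,d\sigma\right)^{1/2}$. Functions are real-valued when $d\ge3$. $\mathcal{H}_n^d$ is the space of spherical harmonics of degree $n$, $\operatorname{proj}_n$ the orthogonal projection of $L^2(\mathbb{S}^{d-1})$ onto it. $\Delta_0$ is the Laplace-Beltrami operator; for $r\ne0$, $(-\Delta_0)^r$ is defined by $\operatorname{proj}_0[(-\Delta_0)^rf]=0$ and $\operatorname{proj}_n[(-\Delta_0)^rf]=(n(n+d-2))^r\operatorname{proj}_nf$, $n\ge1$. $W_2^1(\mathbb{S}^{d-1})=\{f\in L^2(\mathbb{S}^{d-1}):(-\Delta_0)^{1/2}f\in L^2(\mathbb{S}^{d-1})\}$. $\nabla_0$ is the tangential (spherical) gradient, $\nabla_0f=\nabla F|_{\mathbb{S}^{d-1}}$ with $F(x)=f(x/\|x\|)$, and $\|\nabla_0f\|_2=\|\langle\nabla_0f,\nabla_0f\rangle^{1/2}\|_2=\|(-\Delta_0)^{1/2}f\|_2$.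
   Formalization: "1/8 is sharp" is proved for the Hardy-Rellich inequality (C_2 = 8 holds and no smaller C_2 does), since in the uncertainty inequality for d = 2 the constant 1/8 is not best possible: the left side is always at least 1/2. *)

theory Defs
  imports "HOL-Analysis.Analysis"
begin

text \<open>
  The ambient space \<open>'a :: euclidean_space\<close> plays the role of \<open>\<real>\<^sup>d\<close> with \<open>d = DIM('a)\<close>.  A function
  on the unit sphere is a total function on \<open>'a\<close> of which only the values on \<open>sphere 0 1\<close> matter.
  Functions are complex-valued if \<open>d = 2\<close> and real-valued if \<open>d \<ge> 3\<close>; \<open>sphere_valued\<close> expresses
  this convention within the type of complex-valued functions.
\<close>

definition sphere_valued :: "('a::euclidean_space \<Rightarrow> complex) \<Rightarrow> bool" where
  "sphere_valued f \<longleftrightarrow> (3 \<le> DIM('a) \<longrightarrow> (\<forall>x\<in>sphere 0 1. f x \<in> \<real>))"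

text \<open>
  Surface measure as a cone measure: a Borel subset \<open>A\<close> of the sphere has \<open>d\<close> times the volume of
  the cone \<open>{t *\<^sub>R x | t x. 0 < t \<and> t \<le> 1 \<and> x \<in> A}\<close>.  It is rotation invariant, with total mass
  \<open>d\<close> times the volume of the unit ball, which is \<open>sphere_area\<close> below.
\<close>

definition sphere_measure :: "'a::euclidean_space measure" where
  "sphere_measure =
     distr (scale_measure (ennreal (real DIM('a))) (restrict_space lborel (cball 0 1 - {0})))
       (restrict_space borel (sphere 0 1)) (\<lambda>x. x /\<^sub>R norm x)"

definition sphere_area :: "'a::euclidean_space itself \<Rightarrow> real" where
  "sphere_area _ = 2 * pi powr (real DIM('a) / 2) / Gamma (real DIM('a) / 2)"

definition sphere_L2 :: "('a::euclidean_space \<Rightarrow> complex) set" where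
  "sphere_L2 = {f. sphere_valued f \<and> f \<in> borel_measurable sphere_measure \<and>
                   integrable sphere_measure (\<lambda>x. (norm (f x))\<^sup>2)}"

definition sphere_norm :: "('a::euclidean_space \<Rightarrow> 'b::real_normed_vector) \<Rightarrow> real" where
  "sphere_norm f =
     sqrt (1 / sphere_area TYPE('a) * (\<integral>x. (norm (f x))\<^sup>2 \<partial>(sphere_measure :: 'a measure)))"

text \<open>
  \<open>Least\<close> picks an element that is actually attained, so this is a minimum rather than an infimum.
\<close>

definition sphere_min :: "('a::euclidean_space \<Rightarrow> real) \<Rightarrow> real" where
  "sphere_min \<phi> = (LEAST m. m \<in> \<phi> ` sphere 0 1)"

definition partial_deriv :: "'a::euclidean_space \<Rightarrow> ('a \<Rightarrow> complex) \<Rightarrow> 'a \<Rightarrow> complex" where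
  "partial_deriv b F x = vector_derivative (\<lambda>t. F (x + t *\<^sub>R b)) (at 0)"

definition laplacian :: "('a::euclidean_space \<Rightarrow> complex) \<Rightarrow> 'a \<Rightarrow> complex" where
  "laplacian F x = (\<Sum>b\<in>Basis. partial_deriv b (partial_deriv b F) x)"

definition spherical_harmonics :: "nat \<Rightarrow> ('a::euclidean_space \<Rightarrow> complex) set" where
  "spherical_harmonics n =
     {Y. sphere_valued Y \<and>
         (\<exists>p. polynomial_function p \<and> (\<forall>t x. p (t *\<^sub>R x) = t ^ n *\<^sub>R p x) \<and>
              (\<forall>x. laplacian p x = 0) \<and> (\<forall>x\<in>sphere 0 1. Y x = p x))}"

text \<open>
  The projection is determined on the sphere; off the sphere its values are unspecified.
\<close>

definition sphere_proj :: "nat \<Rightarrow> ('a::euclidean_space \<Rightarrow> complex) \<Rightarrow> 'a \<Rightarrow> complex" where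
  "sphere_proj n f =
     (SOME Y. Y \<in> spherical_harmonics n \<and>
        (\<forall>Z\<in>spherical_harmonics n. (\<integral>x. (f x - Y x) * cnj (Z x) \<partial>sphere_measure) = 0))"

text \<open>
  \<open>is_neg_laplace_beltrami_power r f g\<close> says that \<open>g\<close> is a square-integrable version of
  \<open>(-\<Delta>\<^sub>0)\<^sup>r f\<close>, for \<open>r \<noteq> 0\<close>; such a \<open>g\<close> is unique almost everywhere if it exists.
\<close>

definition is_neg_laplace_beltrami_power ::
    "real \<Rightarrow> ('a::euclidean_space \<Rightarrow> complex) \<Rightarrow> ('a \<Rightarrow> complex) \<Rightarrow> bool" where
  "is_neg_laplace_beltrami_power r f g \<longleftrightarrow>
     g \<in> sphere_L2 \<and>
     (\<forall>x\<in>sphere 0 1. sphere_proj 0 g x = 0) \<and>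
     (\<forall>n\<ge>1. \<forall>x\<in>sphere 0 1.
        sphere_proj n g x =
          ((real n * (real n + real DIM('a) - 2)) powr r) *\<^sub>R sphere_proj n f x)"

definition neg_laplace_beltrami_power ::
    "real \<Rightarrow> ('a::euclidean_space \<Rightarrow> complex) \<Rightarrow> 'a \<Rightarrow> complex" where
  "neg_laplace_beltrami_power r f = (SOME g. is_neg_laplace_beltrami_power r f g)"

definition sphere_W21 :: "('a::euclidean_space \<Rightarrow> complex) set" where
  "sphere_W21 = {f \<in> sphere_L2. \<exists>g. is_neg_laplace_beltrami_power (1/2) f g}"

definition sphere_W21_zero_mean :: "('a::euclidean_space \<Rightarrow> complex) set" where
  "sphere_W21_zero_mean = {f \<in> sphere_W21. (\<integral>y. f y \<partial>sphere_measure) = 0}"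

definition radial_extension :: "('a::euclidean_space \<Rightarrow> complex) \<Rightarrow> 'a \<Rightarrow> complex" where
  "radial_extension f x = f (x /\<^sub>R norm x)"

definition sphere_C1 :: "('a::euclidean_space \<Rightarrow> complex) set" where
  "sphere_C1 = {f. sphere_valued f \<and>
     (\<forall>x. x \<noteq> 0 \<longrightarrow> radial_extension f differentiable (at x)) \<and>
     (\<forall>b\<in>Basis. continuous_on (- {0}) (partial_deriv b (radial_extension f)))}"

text \<open>
  Tangential gradient.  A field \<open>G\<close> is given by its components \<open>G x b\<close>, \<open>b \<in> Basis\<close>.  For
  continuously differentiable \<open>u\<close> the components are the partial derivatives, on the sphere, of
  the radial extension of \<open>u\<close>.  A function in \<open>W\<^sub>2\<^sup>1\<close> need not be differentiable, so the gradient is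
  extended by closure in \<open>L\<^sup>2\<close>; it is unique almost everywhere.
\<close>

definition has_sphere_gradient ::
    "('a::euclidean_space \<Rightarrow> complex) \<Rightarrow> ('a \<Rightarrow> 'a \<Rightarrow> complex) \<Rightarrow> bool" where
  "has_sphere_gradient f G \<longleftrightarrow>
     f \<in> sphere_L2 \<and> (\<forall>b\<in>Basis. (\<lambda>x. G x b) \<in> sphere_L2) \<and>
     (\<exists>u :: nat \<Rightarrow> 'a \<Rightarrow> complex.
        (\<forall>k. u k \<in> sphere_C1) \<and>
        (\<lambda>k. sphere_norm (\<lambda>x. u k x - f x)) \<longlonglongrightarrow> 0 \<and>
        (\<forall>b\<in>Basis.
           (\<lambda>k. sphere_norm (\<lambda>x. partial_deriv b (radial_extension (u k)) x - G x b)) \<longlonglongrightarrow> 0))"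

definition sphere_gradient :: "('a::euclidean_space \<Rightarrow> complex) \<Rightarrow> 'a \<Rightarrow> 'a \<Rightarrow> complex" where
  "sphere_gradient f = (SOME G. has_sphere_gradient f G)"

definition sphere_gradient_norm :: "('a::euclidean_space \<Rightarrow> complex) \<Rightarrow> real" where
  "sphere_gradient_norm f =
     sphere_norm (\<lambda>x. sqrt (\<Sum>b\<in>Basis. (norm (sphere_gradient f x b))\<^sup>2))"

definition hardy_rellich_constant :: "'a::euclidean_space itself \<Rightarrow> real \<Rightarrow> bool" where
  "hardy_rellich_constant _ C \<longleftrightarrow>
     (\<forall>g \<in> (sphere_W21_zero_mean :: ('a \<Rightarrow> complex) set).
        (\<integral>x. (norm (g x))\<^sup>2 \<partial>sphere_measure) \<le>
          C * sphere_min (\<lambda>e. \<integral>x. (1 - x \<bullet> e) *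
                 (norm (neg_laplace_beltrami_power (1/2) g x))\<^sup>2 \<partial>sphere_measure))"

definition uncertainty_inequality :: "('a::euclidean_space \<Rightarrow> complex) \<Rightarrow> real \<Rightarrow> bool" where
  "uncertainty_inequality f B \<longleftrightarrow>
     sphere_min (\<lambda>e. 1 / sphere_area TYPE('a) *
         (\<integral>x. (1 - x \<bullet> e) * (norm (f x))\<^sup>2 \<partial>sphere_measure)) * (sphere_gradient_norm f)\<^sup>2 \<ge> B"

end

theory Submission
  imports Defs
begin

text \<open>
  Write \<open>A = coord_mult e F \<bullet> F\<close> for the mean of \<open>x \<bullet> e\<close> under \<open>(norm f)\<^sup>2\<close>, where \<open>F\<close> is the class of \<open>f\<close> and
  \<open>e\<close> a unit vector, and \<open>D\<close> for the squared norm of the spherical gradient.  The claim is a lower bound for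
  \<open>(1 - A) * D\<close>.

  \<^bold>\<open>The explicit constant.\<close>  There are two lower bounds for \<open>D\<close>.  The Poincare inequality gives \<open>D \<ge> d - 1\<close>
  for mean zero and norm \<open>1\<close>.  Green's identity for \<open>(norm f)\<^sup>2\<close> and the linear harmonic \<open>x \<bullet> e\<close>, whose eigenvalue is \<open>d - 1\<close>
  and whose gradient has squared length \<open>1 - (x \<bullet> e)\<^sup>2\<close>, gives \<open>(d - 1)\<^sup>2 * A\<^sup>2 \<le> 4 * (1 - A\<^sup>2) * D\<close>
  (\<open>mean_direction_bound\<close>).  The first is good for small \<open>A\<close>, the second for large \<open>A\<close>; they meet at
  \<open>A = 2 / sqrt (d + 3)\<close>, which yields the constant (\<open>uncertainty_constant_bound\<close>).

  \<^bold>\<open>From Hardy--Rellich to uncertainty.\<close>  Divide the component of \<open>f\<close> of degree \<open>n\<close> by the square root of its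
  eigenvalue to obtain \<open>g\<close>.  Cauchy--Schwarz gives \<open>1 \<le> D * (norm g)\<^sup>2\<close> for \<open>norm f = 1\<close>, and the
  Hardy--Rellich inequality for \<open>g\<close> bounds \<open>(norm g)\<^sup>2\<close> by \<open>C * (1 - A)\<close>
  (\<open>Hardy_Rellich_imp_uncertainty\<close>).

  \<^bold>\<open>The circle.\<close>  In Fourier coefficients the Hardy--Rellich inequality for \<open>d = 2\<close> is the discrete Hardy
  inequality \<open>\<Sum> (a\<^sub>k / k)\<^sup>2 \<le> 4 * \<Sum> (a\<^sub>k - a\<^sub>k\<^sub>-\<^sub>1)\<^sup>2\<close>, because \<open>2 * (1 - x \<bullet> e)\<close> is the square of the modulus of
  \<open>1 - cnj (z e) * z x\<close>.  Its constant \<open>4\<close> is optimal, and so is the constant \<open>8\<close> on the circle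
  (\<open>Hardy_Rellich_circle\<close>, \<open>Hardy_Rellich_circle_sharp\<close>).

  These arguments rest on the expansion in spherical harmonics.  The surface measure is a cone measure, so
  Green's identity on the sphere (\<open>Green_identity_sphere\<close>) comes from a divergence that integrates to zero over
  the whole space.  It gives the orthogonality of harmonics of different degrees and the energies
  \<open>n * (n + d - 2)\<close>.  Completeness (\<open>spherical_harmonics_complete\<close>) holds because a function orthogonal to all
  harmonics stays so after multiplication by a coordinate, hence is orthogonal to all polynomials.  The
  gradient of a function in \<open>sphere_W21\<close> is the limit of the gradients of its partial sums, and the energies
  of the partial sums bound the norm of any gradient from below (\<open>gradient_Bessel\<close>).
\<close>

section \<open>The surface measure of the sphere\<close>

lemma space_sphere_measure [simp]: "space (sphere_measure :: 'a::euclidean_space measure) = sphere 0 1"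
  by (simp add: sphere_measure_def space_restrict_space)

lemma sets_sphere_measure [measurable_cong]:
  "sets (sphere_measure :: 'a::euclidean_space measure) = sets (restrict_space borel (sphere 0 1))"
  by (simp add: sphere_measure_def)

lemma scale_measure_eq_density: "scale_measure c M = density M (\<lambda>_. c)"
  by (rule measure_eqI) (auto simp: emeasure_density nn_integral_cmult_indicator)

lemma continuous_on_sphere_measurable:
  fixes F :: "'a::euclidean_space \<Rightarrow> 'b::topological_space"
  assumes "continuous_on (sphere 0 1) F"
  shows "F \<in> borel_measurable sphere_measure"
  using borel_measurable_continuous_on_restrict[OF assms]
  by (simp add: measurable_cong_sets[OF sets_sphere_measure refl])

lemma radial_projection_measurable:
  "(\<lambda>x::'a::euclidean_space. x /\<^sub>R norm x) \<in> restrict_space borel (- {0}) \<rightarrow>\<^sub>M restrict_space borel (sphere 0 1)"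
proof (rule measurable_restrict_space2)
  show "(\<lambda>x::'a. x /\<^sub>R norm x) \<in> space (restrict_space borel (- {0})) \<rightarrow> sphere 0 1"
    by (auto simp: space_restrict_space)
  show "(\<lambda>x::'a. x /\<^sub>R norm x) \<in> borel_measurable (restrict_space borel (- {0}))"
    by (intro borel_measurable_continuous_on_restrict continuous_intros) auto
qed

lemma radial_measurable:
  fixes F :: "'a::euclidean_space \<Rightarrow> 'b::{real_normed_vector, second_countable_topology}"
  assumes F: "F \<in> borel_measurable sphere_measure" and B: "B \<in> sets borel" "0 \<notin> B"
  shows "(\<lambda>x. indicator B x *\<^sub>R F (x /\<^sub>R norm x)) \<in> borel_measurable borel"
proof -
  have "F \<in> borel_measurable (restrict_space borel (sphere 0 1))"
    using F by (simp add: measurable_cong_sets[OF sets_sphere_measure refl])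
  then have "(\<lambda>x. F (x /\<^sub>R norm x)) \<in> borel_measurable (restrict_space borel (- {0}))"
    by (rule measurable_compose[OF radial_projection_measurable])
  then have "(\<lambda>x. indicator (- {0}) x *\<^sub>R F (x /\<^sub>R norm x)) \<in> borel_measurable borel"
    by (subst (asm) borel_measurable_restrict_space_iff) auto
  then have "(\<lambda>x. indicator B x *\<^sub>R (indicator (- {0}) x *\<^sub>R F (x /\<^sub>R norm x))) \<in> borel_measurable borel"
    using B by measurable
  also have "(\<lambda>x. indicator B x *\<^sub>R (indicator (- {0}) x *\<^sub>R F (x /\<^sub>R norm x))) = (\<lambda>x. indicator B x *\<^sub>R F (x /\<^sub>R norm x))"
    using B by (auto simp: indicator_def fun_eq_iff)
  finally show ?thesis .
qed

lemma radial_projection_measurable_ball: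
  "(\<lambda>x::'a::euclidean_space. x /\<^sub>R norm x) \<in> restrict_space lborel (cball 0 1 - {0}) \<rightarrow>\<^sub>M restrict_space borel (sphere 0 1)"
  by (rule measurable_restrict_space2)
     (auto simp: space_restrict_space intro!: measurable_restrict_space1)

lemma sphere_integral:
  fixes F :: "'a::euclidean_space \<Rightarrow> 'b::{banach, second_countable_topology}"
  assumes F: "F \<in> borel_measurable sphere_measure"
  shows "integral\<^sup>L sphere_measure F =
    real DIM('a) *\<^sub>R (\<integral>x. indicator (cball 0 1 - {0}) x *\<^sub>R F (x /\<^sub>R norm x) \<partial>lborel)"
proof -
  have Fm: "F \<in> borel_measurable (restrict_space borel (sphere 0 1))"
    using F by (simp add: measurable_cong_sets[OF sets_sphere_measure refl])
  note rm = radial_projection_measurable_ball[where 'a='a]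
  have Fr: "(\<lambda>x. F (x /\<^sub>R norm x)) \<in> borel_measurable (restrict_space lborel (cball 0 1 - {0}))"
    using measurable_compose[OF rm Fm] .
  have "integral\<^sup>L sphere_measure F =
     (\<integral>x. F (x /\<^sub>R norm x) \<partial>(scale_measure (ennreal (real DIM('a))) (restrict_space lborel (cball 0 1 - {0}))))"
    unfolding sphere_measure_def
    by (rule integral_distr) (use rm Fm in \<open>simp_all add: measurable_cong_sets[OF sets_scale_measure refl]\<close>)
  also have "\<dots> = (\<integral>x. real DIM('a) *\<^sub>R F (x /\<^sub>R norm x) \<partial>(restrict_space lborel (cball 0 1 - {0})))"
    unfolding scale_measure_eq_density by (rule integral_density) (use Fr in auto)
  also have "\<dots> = (\<integral>x. indicator (cball 0 1 - {0}) x *\<^sub>R (real DIM('a) *\<^sub>R F (x /\<^sub>R norm x)) \<partial>lborel)"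
    by (rule integral_restrict_space) auto
  finally show ?thesis
    by (simp add: integral_scaleR_right[symmetric] mult.commute del: integral_scaleR_right)
qed

lemma emeasure_sphere_measure:
  "emeasure sphere_measure (sphere 0 1 :: 'a::euclidean_space set) = ennreal (sphere_area TYPE('a))"
proof -
  note rm = radial_projection_measurable_ball[where 'a='a]
  have "emeasure sphere_measure (sphere 0 1 :: 'a set) =
      ennreal (real DIM('a)) * emeasure lborel (cball 0 1 - {0} :: 'a set)"
    unfolding sphere_measure_def
    by (subst emeasure_distr)
       (use rm in \<open>auto simp: measurable_cong_sets[OF sets_scale_measure refl] space_restrict_space space_scale_measure
          emeasure_restrict_space sets_restrict_space
          intro!: arg_cong2[of _ _ _ _ "(*)"] arg_cong[of _ _ "emeasure lborel"]\<close>)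
  also have "emeasure lborel (cball 0 1 - {0} :: 'a set) = emeasure lborel (cball 0 1 :: 'a set)"
    by (rule emeasure_Diff_null_set) auto
  also have "ennreal (real DIM('a)) * emeasure lborel (cball 0 1 :: 'a set)
      = ennreal (real DIM('a) * unit_ball_vol (real DIM('a)))"
    by (simp add: emeasure_cball ennreal_mult)
  also have "real DIM('a) * unit_ball_vol (real DIM('a)) = sphere_area TYPE('a)"
  proof -
    have "real DIM('a) / 2 \<notin> \<int>\<^sub>\<le>\<^sub>0"
      using nonpos_Ints_nonpos[of "real DIM('a) / 2"] DIM_positive[where 'a='a] by force
    then have "Gamma (real DIM('a) / 2 + 1) = real DIM('a) / 2 * Gamma (real DIM('a) / 2)"
      by (rule Gamma_plus1)
    then show ?thesis
      unfolding unit_ball_vol_def sphere_area_def by (simp only:) simp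
  qed
  finally show ?thesis .
qed

lemma sphere_area_pos: "sphere_area TYPE('a::euclidean_space) > 0"
  by (simp add: sphere_area_def Gamma_real_pos)

lemma finite_measure_sphere: "finite_measure (sphere_measure :: 'a::euclidean_space measure)"
  by (rule finite_measureI) (simp add: emeasure_sphere_measure)

lemma measure_sphere_measure: "measure sphere_measure (sphere 0 1 :: 'a::euclidean_space set) = sphere_area TYPE('a)"
  using sphere_area_pos[where 'a='a] by (simp add: measure_def emeasure_sphere_measure)

lemma integrable_sphere_bounded:
  fixes F :: "'a::euclidean_space \<Rightarrow> 'b::{banach, second_countable_topology}"
  assumes "F \<in> borel_measurable sphere_measure" "\<And>x. norm x = 1 \<Longrightarrow> norm (F x) \<le> C"
  shows "integrable sphere_measure F"
  by (rule finite_measure.integrable_const_bound[OF finite_measure_sphere, where B=C])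
     (use assms in \<open>auto intro!: AE_I2\<close>)

lemma continuous_on_sphere_bounded:
  fixes F :: "'a::euclidean_space \<Rightarrow> 'b::real_normed_vector"
  assumes "continuous_on (sphere 0 1) F"
  obtains C where "\<And>x. norm x = 1 \<Longrightarrow> norm (F x) \<le> C"
proof -
  have "compact (F ` sphere 0 1)" by (rule compact_continuous_image[OF assms]) auto
  then obtain C where "\<forall>x\<in>sphere 0 1. norm (F x) \<le> C"
    using compact_imp_bounded[of "F ` sphere 0 1"] by (auto simp: bounded_iff)
  then have "norm (F x) \<le> C" if "norm x = 1" for x using that by auto
  then show ?thesis by (rule that)
qed

lemma integrable_sphere_continuous:
  fixes F :: "'a::euclidean_space \<Rightarrow> 'b::{banach, second_countable_topology}"
  assumes "continuous_on (sphere 0 1) F"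
  shows "integrable sphere_measure F"
proof -
  obtain C where C: "\<And>x. norm x = 1 \<Longrightarrow> norm (F x) \<le> C"
    by (rule continuous_on_sphere_bounded[OF assms]) (rule that; assumption)
  show ?thesis
    by (rule integrable_sphere_bounded[OF continuous_on_sphere_measurable[OF assms] C])
qed

text \<open>
  The points whose radial projection lies where \<open>F\<close> is positive form an open cone.  If it is not empty, it
  has positive volume, and so the integral is positive.
\<close>

lemma sphere_zero_continuous:
  fixes F :: "'a::euclidean_space \<Rightarrow> real"
  assumes F: "continuous_on (sphere 0 1) F" and nn: "\<And>x. norm x = 1 \<Longrightarrow> F x \<ge> 0"
    and int: "integral\<^sup>L sphere_measure F = 0" and x: "norm x = 1"
  shows "F x = 0"
proof (rule ccontr)
  assume "F x \<noteq> 0"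
  with nn[OF x] have pos: "F x > 0" by simp
  have Fi: "integrable sphere_measure F" by (rule integrable_sphere_continuous[OF F])
  have AE0: "AE y in sphere_measure. F y = 0"
  proof -
    have "AE y in sphere_measure. 0 \<le> F y" using nn by (auto intro!: AE_I2)
    from integral_nonneg_eq_0_iff_AE[OF Fi this] int show ?thesis by simp
  qed
  have "AE y in restrict_space lborel (cball 0 1 - {0 :: 'a}). F (y /\<^sub>R norm y) = 0"
  proof -
    note rm = radial_projection_measurable_ball[where 'a='a]
    have Fm: "F \<in> borel_measurable (restrict_space borel (sphere 0 1))"
      by (rule borel_measurable_continuous_on_restrict[OF F])
    have "AE y in scale_measure (ennreal (real DIM('a))) (restrict_space lborel (cball 0 1 - {0 :: 'a})). F (y /\<^sub>R norm y) = 0"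
      using AE0 unfolding sphere_measure_def
      by (rule AE_distrD[rotated]) (use rm in \<open>simp add: measurable_cong_sets[OF sets_scale_measure refl]\<close>)
    then show ?thesis
      unfolding scale_measure_eq_density
      by (subst (asm) AE_density) auto
  qed
  then have AE1: "AE y in lborel. y \<in> cball 0 1 - {0 :: 'a} \<longrightarrow> F (y /\<^sub>R norm y) = 0"
    by (subst (asm) AE_restrict_space_iff) auto
  define V where "V = {y \<in> ball 0 1 - {0::'a}. F (y /\<^sub>R norm y) > 0}"
  have "open V"
  proof -
    have "continuous_on (ball 0 1 - {0::'a}) (\<lambda>y. F (y /\<^sub>R norm y))"
      by (rule continuous_on_compose2[OF F]) (auto intro!: continuous_intros left_inverse)
    then have "open ((ball 0 1 - {0::'a}) \<inter> (\<lambda>y. F (y /\<^sub>R norm y)) -` {0<..})"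
      by (intro continuous_open_preimage) auto
    then show ?thesis unfolding V_def by (simp add: vimage_def Int_def)
  qed
  moreover have "(1/2) *\<^sub>R x \<in> V"
    using x pos by (auto simp: V_def)
  ultimately have "\<not> negligible V" by (intro open_not_negligible) auto
  moreover have "V \<in> null_sets lebesgue"
  proof -
    have "AE y in lborel. y \<notin> V" using AE1 by (auto simp: V_def elim!: eventually_mono)
    then have "AE y in lebesgue. y \<notin> V" by (rule AE_completion)
    then show ?thesis using \<open>open V\<close> by (simp add: AE_iff_null_sets)
  qed
  ultimately show False by (simp add: negligible_iff_null_sets)
qed

lemma ball_integral_scale:
  fixes F :: "'a::euclidean_space \<Rightarrow> real"
  assumes F: "F \<in> borel_measurable sphere_measure" and r: "r > 0"
  shows "(\<integral>x. indicator (cball 0 r - {0}) x *\<^sub>R F (x /\<^sub>R norm x) \<partial>lborel) =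
     r ^ DIM('a) * (\<integral>x. indicator (cball 0 1 - {0}) x *\<^sub>R F (x /\<^sub>R norm x) \<partial>lborel)"
proof -
  define f where "f = (\<lambda>x::'a. indicator (cball 0 r - {0}) x *\<^sub>R F (x /\<^sub>R norm x))"
  have fm[measurable]: "f \<in> borel_measurable borel"
    unfolding f_def by (rule radial_measurable[OF F]) auto
  have "integral\<^sup>L lborel f = integral\<^sup>L (density (distr lborel borel (\<lambda>x::'a. 0 + r *\<^sub>R x)) (\<lambda>_. \<bar>r\<bar>^DIM('a))) f"
    using r by (subst lborel_affine[of r 0]) auto
  also have "\<dots> = integral\<^sup>L (distr lborel borel (\<lambda>x::'a. 0 + r *\<^sub>R x)) (\<lambda>x. (\<bar>r\<bar>^DIM('a)) *\<^sub>R f x)"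
    by (rule integral_density) auto
  also have "\<dots> = (\<integral>x. (\<bar>r\<bar>^DIM('a)) *\<^sub>R f (0 + r *\<^sub>R x) \<partial>lborel)"
    by (rule integral_distr) auto
  also have "\<dots> = (\<integral>x. r^DIM('a) *\<^sub>R (indicator (cball 0 1 - {0}) x *\<^sub>R F (x /\<^sub>R norm x)) \<partial>lborel)"
  proof (intro Bochner_Integration.integral_cong refl)
    fix x :: 'a
    have "inverse r * inverse (norm x) * r = inverse (norm x)" using r by simp
    then have "F ((inverse r * inverse (norm x) * r) *\<^sub>R x) = F (x /\<^sub>R norm x)" by (simp only:)
    then show "(\<bar>r\<bar>^DIM('a)) *\<^sub>R f (0 + r *\<^sub>R x) = r^DIM('a) *\<^sub>R (indicator (cball 0 1 - {0}) x *\<^sub>R F (x /\<^sub>R norm x))"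
      using r by (simp add: f_def indicator_def)
  qed
  finally show ?thesis by (simp add: f_def)
qed

text \<open>
  A radial weight integrates independently of the angular factor: writing the weight as
  \<open>k r = - (\<integral>t. indicator {r..2} t * k' t)\<close> and exchanging the integrals reduces this to the scaling
  of balls.
\<close>

lemma radial_weight_integral:
  fixes k :: "real \<Rightarrow> real"
  assumes k: "\<And>t. (k has_real_derivative k' t) (at t)" and k': "continuous_on UNIV k'"
    and k2: "\<And>t. t \<ge> 2 \<Longrightarrow> k t = 0"
  obtains K where "\<And>F :: 'a::euclidean_space \<Rightarrow> real. \<And>C. F \<in> borel_measurable sphere_measure \<Longrightarrow>
     (\<And>x. norm x = 1 \<Longrightarrow> norm (F x) \<le> C) \<Longrightarrow>
     (\<integral>x. k (norm x) * (indicator (cball 0 2 - {0}) x * F (x /\<^sub>R norm x)) \<partial>lborel)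
       = K * integral\<^sup>L sphere_measure F"
proof
  fix F :: "'a \<Rightarrow> real" and C
  assume F: "F \<in> borel_measurable sphere_measure" and C: "\<And>x. norm x = 1 \<Longrightarrow> norm (F x) \<le> C"
  define G where "G = (\<lambda>x. indicator (cball 0 2 - {0}) x * F (x /\<^sub>R norm x))"
  define I where "I = (\<integral>x. indicator (cball 0 1 - {0}) x *\<^sub>R F (x /\<^sub>R norm x) \<partial>lborel)"
  have Gm[measurable]: "G \<in> borel_measurable borel"
    using radial_measurable[OF F, of "cball 0 2 - {0}"] by (simp add: G_def)
  have k'm[measurable]: "k' \<in> borel_measurable borel"
    using k' by (rule borel_measurable_continuous_onI)
  obtain D where D: "\<And>t. t \<in> {0..2} \<Longrightarrow> \<bar>k' t\<bar> \<le> D"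
  proof -
    have "compact (k' ` {0..2})"
      by (rule compact_continuous_image) (use k' continuous_on_subset in auto)
    then obtain D where "\<forall>t\<in>{0..2}. norm (k' t) \<le> D"
      using compact_imp_bounded[of "k' ` {0..2}"] by (auto simp: bounded_iff)
    then show ?thesis by (intro that[of D]) auto
  qed
  obtain e :: 'a where "e \<in> Basis" using SOME_Basis by blast
  then have C0: "C \<ge> 0" using C[of e] by (smt (verit) norm_Basis norm_ge_zero)
  have D0: "D \<ge> 0" using D[of 0] by force
  have GC: "\<bar>G x\<bar> \<le> C" for x
    using C[of "x /\<^sub>R norm x"] C0 by (auto simp: G_def indicator_def)
  define h where "h = (\<lambda>x t. - (indicator {0..2} t * indicator {norm x..} t * k' t * G x))"
  have hm[measurable]: "case_prod h \<in> borel_measurable (lborel \<Otimes>\<^sub>M lborel)"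
  proof -
    have "case_prod h = (\<lambda>p. - (indicator {0..2} (snd p) * (if norm (fst p) \<le> snd p then 1 else 0) * k' (snd p) * G (fst p)))"
      by (auto simp: h_def fun_eq_iff indicator_def)
    also have "\<dots> \<in> borel_measurable (lborel \<Otimes>\<^sub>M lborel)" by measurable
    finally show ?thesis .
  qed
  have hi: "integrable (lborel \<Otimes>\<^sub>M lborel) (case_prod h)"
  proof (rule Bochner_Integration.integrable_bound)
    have "emeasure lborel (cball 0 2 \<times> {0..2} :: ('a \<times> real) set) < \<infinity>"
      by (intro emeasure_bounded_finite bounded_Times) auto
    then have "integrable (lborel :: ('a \<times> real) measure) (indicat_real (cball 0 2 \<times> {0..2}))"
      by (intro integrable_real_indicator) (auto intro!: borel_closed closed_Times)
    then show "integrable (lborel \<Otimes>\<^sub>M lborel) (\<lambda>p. (D * C) * indicat_real (cball 0 2 \<times> {0..2}) (p :: 'a \<times> real))"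
      by (intro integrable_mult_right) (simp add: lborel_prod)
    have "norm (h x t) \<le> norm (D * C * indicat_real (cball 0 2 \<times> {0..2}) (x, t))" for x t
    proof (cases "x \<in> cball 0 2 \<and> t \<in> {0..2}")
      case True
      then have "\<bar>k' t\<bar> * \<bar>G x\<bar> \<le> D * C" using D GC D0 by (intro mult_mono) auto
      then show ?thesis using True C0 D0 by (auto simp: h_def indicator_def abs_mult)
    next
      case False
      then show ?thesis by (auto simp: h_def G_def indicator_def)
    qed
    then show "AE p in lborel \<Otimes>\<^sub>M lborel. norm (case_prod h p) \<le> norm (D * C * indicat_real (cball 0 2 \<times> {0..2}) p)"
      by auto
  qed simp
  have kh: "k (norm x) * G x = (\<integral>t. h x t \<partial>lborel)" for x :: 'a
  proof (cases "norm x \<le> 2")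
    case True
    have "(k' has_integral (k 2 - k (norm x))) {norm x..2}"
      by (rule fundamental_theorem_of_calculus)
        (use True k in \<open>auto simp: has_real_derivative_iff_has_vector_derivative[symmetric] intro: has_field_derivative_at_within\<close>)
    moreover have "set_integrable lborel {norm x..2} k'"
      by (rule borel_integrable_atLeastAtMost') (use k' continuous_on_subset in auto)
    ultimately have "(LINT t:{norm x..2}|lborel. k' t) = k 2 - k (norm x)"
      by (subst set_borel_integral_eq_integral) (auto simp: integral_unique)
    then have "(\<integral>t. indicator {norm x..2} t * k' t \<partial>lborel) = - k (norm x)"
      using k2[of 2] by (simp add: set_lebesgue_integral_def)
    moreover have "h x t = - G x * (indicator {norm x..2} t * k' t)" for t
      by (auto simp: h_def indicator_def) (meson norm_ge_zero order_trans)
    ultimately show ?thesis by simp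
  next
    case False
    then show ?thesis by (simp add: h_def G_def)
  qed
  have "(\<integral>x. k (norm x) * G x \<partial>lborel) = (\<integral>x. (\<integral>t. h x t \<partial>lborel) \<partial>lborel)"
    by (simp add: kh)
  also have "\<dots> = (\<integral>t. (\<integral>x. h x t \<partial>lborel) \<partial>lborel)"
    using lborel_pair.Fubini_integral[OF hi] by simp
  also have "\<dots> = (\<integral>t. - (indicator {0..2} t * k' t * t ^ DIM('a)) * I \<partial>lborel)"
  proof (rule Bochner_Integration.integral_cong[OF refl])
    fix t :: real
    show "(\<integral>x. h x t \<partial>lborel) = - (indicator {0..2} t * k' t * t ^ DIM('a)) * I"
    proof (cases "0 < t \<and> t \<le> 2")
      case True
      have "h x t = - k' t * (indicator (cball 0 t - {0}) x *\<^sub>R F (x /\<^sub>R norm x))" for x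
        using True by (auto simp: h_def G_def indicator_def)
      then have "(\<integral>x. h x t \<partial>lborel) = - k' t * (t ^ DIM('a) * I)"
        using ball_integral_scale[OF F, of t] True by (simp add: I_def)
      then show ?thesis using True by simp
    next
      case False
      then consider "t = 0" | "t \<notin> {0..2}" by force
      then show ?thesis
      proof cases
        case 1
        then have "h x t = 0" for x by (auto simp: h_def G_def indicator_def)
        then show ?thesis using 1 by simp
      qed (simp add: h_def)
    qed
  qed
  also have "\<dots> = (- (\<integral>t. indicator {0..2} t * k' t * t ^ DIM('a) \<partial>lborel)) * I"
    by simp
  also have "I = integral\<^sup>L sphere_measure F / real DIM('a)"
    by (simp add: I_def sphere_integral[OF F])
  finally show "(\<integral>x. k (norm x) * (indicator (cball 0 2 - {0}) x * F (x /\<^sub>R norm x)) \<partial>lborel) =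
     (- (\<integral>t. indicator {0..2} t * k' t * t ^ DIM('a) \<partial>lborel) / real DIM('a)) * integral\<^sup>L sphere_measure F"
    by (simp add: G_def)
qed

text \<open>
  The integral of a partial derivative vanishes because the integrals of all translates agree.
\<close>

lemma integral_partial_derivative_zero:
  fixes H :: "'a::euclidean_space \<Rightarrow> real" and b :: 'a
  assumes H: "\<And>x. (H has_derivative H' x) (at x)"
    and bound: "\<And>x. \<bar>H' x b\<bar> \<le> M" and supp: "\<And>x. norm x > R \<Longrightarrow> H x = 0"
  shows "(\<integral>x. H' x b \<partial>lborel) = 0"
proof -
  have M0: "M \<ge> 0" using bound[of 0] by linarith
  have Hc: "continuous_on UNIV H"
    using H by (meson continuous_at_imp_continuous_on has_derivative_continuous)
  then have Hm[measurable]: "H \<in> borel_measurable borel" by (rule borel_measurable_continuous_onI)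
  have Hi: "integrable lborel H"
  proof -
    have "integrable lborel (\<lambda>x. indicator (cball 0 R) x *\<^sub>R H x)"
      by (rule borel_integrable_compact) (use Hc continuous_on_subset in auto)
    moreover have "indicator (cball 0 R) x *\<^sub>R H x = H x" for x using supp[of x] by (auto simp: indicator_def)
    ultimately show ?thesis by (simp only:)
  qed
  have shift: "(\<integral>x. H (x + v) \<partial>lborel) = integral\<^sup>L lborel H" "integrable lborel (\<lambda>x. H (x + v))" for v
  proof -
    have "integral\<^sup>L (distr lborel borel ((+) v)) H = (\<integral>x. H (v + x) \<partial>lborel)"
      by (rule integral_distr) auto
    then show "(\<integral>x. H (x + v) \<partial>lborel) = integral\<^sup>L lborel H"
      by (simp add: lborel_distr_plus add.commute)
    have "integrable (distr lborel borel ((+) v)) H" by (simp add: lborel_distr_plus Hi)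
    then have "integrable lborel (\<lambda>x. H (v + x))" by (subst (asm) integrable_distr_eq) auto
    then show "integrable lborel (\<lambda>x. H (x + v))" by (simp add: add.commute)
  qed
  define s where "s = (\<lambda>n x. (H (x + (1 / real (Suc n)) *\<^sub>R b) - H x) * real (Suc n))"
  have s0: "(\<integral>x. s n x \<partial>lborel) = 0" for n
    unfolding s_def using shift[of "(1 / real (Suc n)) *\<^sub>R b"] Hi by simp
  have lim: "(\<lambda>n. s n x) \<longlonglongrightarrow> H' x b" for x
  proof -
    have "((\<lambda>t. H (x + t *\<^sub>R b)) has_derivative (\<lambda>t. H' x (t *\<^sub>R b))) (at 0)"
      by (rule has_derivative_compose[where f="\<lambda>t. x + t *\<^sub>R b", of "\<lambda>t. t *\<^sub>R b"])
         (auto intro!: derivative_eq_intros H)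
    then have "((\<lambda>t. H (x + t *\<^sub>R b)) has_real_derivative H' x b) (at 0)"
      by (rule has_derivative_imp_has_field_derivative)
         (simp add: linear_cmul[OF has_derivative_linear[OF H]] mult.commute)
    then have "((\<lambda>h. (H (x + (0 + h) *\<^sub>R b) - H (x + 0 *\<^sub>R b)) / h) \<longlongrightarrow> H' x b) (at 0)"
      by (simp add: DERIV_def)
    then have "(\<lambda>n. (H (x + (0 + 1 / real (Suc n)) *\<^sub>R b) - H (x + 0 *\<^sub>R b)) / (1 / real (Suc n))) \<longlonglongrightarrow> H' x b"
      by (rule filterlim_compose)
         (use LIMSEQ_inverse_real_of_nat in \<open>auto simp: filterlim_at inverse_eq_divide\<close>)
    then show ?thesis by (simp add: s_def)
  qed
  have bd: "\<bar>s n x\<bar> \<le> M * indicator (cball 0 (R + norm b)) x" for n x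
  proof (cases "norm x \<le> R + norm b")
    case True
    let ?v = "(1 / real (Suc n)) *\<^sub>R b"
    have "((\<lambda>t. H (x + t *\<^sub>R b)) has_real_derivative H' (x + t *\<^sub>R b) b) (at t)" for t
    proof -
      have "((\<lambda>t. H (x + t *\<^sub>R b)) has_derivative (\<lambda>s. H' (x + t *\<^sub>R b) (s *\<^sub>R b))) (at t)"
        by (rule has_derivative_compose[where f="\<lambda>t. x + t *\<^sub>R b", of "\<lambda>t. t *\<^sub>R b"])
           (auto intro!: derivative_eq_intros H)
      then show ?thesis
        by (rule has_derivative_imp_has_field_derivative)
           (simp add: linear_cmul[OF has_derivative_linear[OF H]] mult.commute)
    qed
    then obtain z where "H (x + (1 / real (Suc n)) *\<^sub>R b) - H (x + 0 *\<^sub>R b) = (1 / real (Suc n) - 0) * H' (x + z *\<^sub>R b) b"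
      using MVT2[of 0 "1 / real (Suc n)" "\<lambda>t. H (x + t *\<^sub>R b)" "\<lambda>t. H' (x + t *\<^sub>R b) b"] by auto
    then have "s n x = H' (x + z *\<^sub>R b) b" by (simp add: s_def)
    then show ?thesis using bound True by (simp add: indicator_def)
  next
    case False
    have "norm ((1 / real (Suc n)) *\<^sub>R b) \<le> norm b"
      by (simp add: divide_le_eq mult_le_cancel_left1 algebra_simps)
    then have "norm (x + (1 / real (Suc n)) *\<^sub>R b) > R"
      using False norm_diff_ineq[of x "(1 / real (Suc n)) *\<^sub>R b"] by linarith
    moreover have "norm x > R" using False norm_ge_zero[of b] by linarith
    ultimately show ?thesis using M0 by (simp add: s_def supp)
  qed
  have "(\<lambda>n. \<integral>x. s n x \<partial>lborel) \<longlonglongrightarrow> (\<integral>x. H' x b \<partial>lborel)"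
  proof (rule integral_dominated_convergence)
    have sm: "s n \<in> borel_measurable borel" for n unfolding s_def by measurable
    then show "s n \<in> borel_measurable lborel" for n by simp
    show "(\<lambda>x. H' x b) \<in> borel_measurable lborel"
      using borel_measurable_LIMSEQ_real[OF lim sm] by simp
    show "integrable lborel (\<lambda>x. M * indicat_real (cball 0 (R + norm b)) (x :: 'a))"
      using emeasure_bounded_finite[of "cball (0::'a) (R + norm b)"]
      by (intro integrable_mult_right integrable_real_indicator) auto
    show "AE x in lborel. (\<lambda>n. s n x) \<longlonglongrightarrow> H' x b" using lim by simp
    show "AE x in lborel. norm (s n x) \<le> M * indicat_real (cball 0 (R + norm b)) x" for n using bd by simp
  qed
  then show ?thesis by (simp add: s0 LIMSEQ_const_iff)
qed

section \<open>The Hilbert space of square-integrable functions\<close>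

definition square_integrable :: "('a::euclidean_space \<Rightarrow> complex) \<Rightarrow> bool" where
  "square_integrable f \<longleftrightarrow> f \<in> borel_measurable sphere_measure \<and> integrable sphere_measure (\<lambda>x. (norm (f x))\<^sup>2)"

lemma square_integrableD [measurable_dest]: "square_integrable f \<Longrightarrow> f \<in> borel_measurable sphere_measure"
  by (simp add: square_integrable_def)

lemma square_integrable_norm2: "square_integrable f \<Longrightarrow> integrable sphere_measure (\<lambda>x. (norm (f x))\<^sup>2)"
  by (simp add: square_integrable_def)

lemma square_integrable_prod:
  fixes f g :: "'a::euclidean_space \<Rightarrow> complex"
  assumes f: "square_integrable f" and g: "square_integrable g"
  shows "integrable sphere_measure (\<lambda>x. norm (f x) * norm (g x))"
proof (rule Bochner_Integration.integrable_bound)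
  show "integrable sphere_measure (\<lambda>x. (norm (f x))\<^sup>2 + (norm (g x))\<^sup>2)"
    using f g by (simp add: square_integrable_norm2)
  show "(\<lambda>x. norm (f x) * norm (g x)) \<in> borel_measurable sphere_measure"
    using f g by measurable
  show "AE x in sphere_measure. norm (norm (f x) * norm (g x)) \<le> norm ((norm (f x))\<^sup>2 + (norm (g x))\<^sup>2)"
  proof (rule AE_I2)
    fix x
    have "0 \<le> (norm (f x) - norm (g x))\<^sup>2" by simp
    then have "norm (f x) * norm (g x) * 2 \<le> (norm (f x))\<^sup>2 + (norm (g x))\<^sup>2"
      by (simp add: power2_diff algebra_simps)
    moreover have "0 \<le> norm (f x) * norm (g x)" by simp
    ultimately show "norm (norm (f x) * norm (g x)) \<le> norm ((norm (f x))\<^sup>2 + (norm (g x))\<^sup>2)"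
      unfolding real_norm_def by linarith
  qed
qed

lemma square_integrable_dom:
  fixes f g :: "'a::euclidean_space \<Rightarrow> complex"
  assumes f: "square_integrable f" and g: "g \<in> borel_measurable sphere_measure"
    and le: "\<And>x. norm x = 1 \<Longrightarrow> norm (g x) \<le> C * norm (f x)"
  shows "square_integrable g"
  unfolding square_integrable_def
proof (rule conjI[OF g], rule Bochner_Integration.integrable_bound)
  show "integrable sphere_measure (\<lambda>x. C\<^sup>2 * (norm (f x))\<^sup>2)"
    using f by (simp add: square_integrable_norm2)
  show "(\<lambda>x. (norm (g x))\<^sup>2) \<in> borel_measurable sphere_measure"
    using g by measurable
  show "AE x in sphere_measure. norm ((norm (g x))\<^sup>2) \<le> norm (C\<^sup>2 * (norm (f x))\<^sup>2)"
  proof (rule AE_I2)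
    fix x :: 'a assume "x \<in> space sphere_measure"
    then have "(norm (g x))\<^sup>2 \<le> (C * norm (f x))\<^sup>2" by (intro power_mono le) auto
    then show "norm ((norm (g x))\<^sup>2) \<le> norm (C\<^sup>2 * (norm (f x))\<^sup>2)" by (simp add: power_mult_distrib)
  qed
qed

lemma square_integrable_add:
  fixes f g :: "'a::euclidean_space \<Rightarrow> complex"
  assumes f: "square_integrable f" and g: "square_integrable g"
  shows "square_integrable (\<lambda>x. f x + g x)"
  unfolding square_integrable_def
proof (rule conjI[rotated], rule Bochner_Integration.integrable_bound)
  show m: "(\<lambda>x. f x + g x) \<in> borel_measurable sphere_measure" using f g by measurable
  then show "(\<lambda>x. (norm (f x + g x))\<^sup>2) \<in> borel_measurable sphere_measure" by measurable
  show "integrable sphere_measure (\<lambda>x. (norm (f x))\<^sup>2 + 2 * (norm (f x) * norm (g x)) + (norm (g x))\<^sup>2)"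
    using f g by (intro Bochner_Integration.integrable_add integrable_mult_right square_integrable_norm2 square_integrable_prod)
  have "(norm (f x + g x))\<^sup>2 \<le> (norm (f x))\<^sup>2 + 2 * (norm (f x) * norm (g x)) + (norm (g x))\<^sup>2" for x
    using power_mono[OF norm_triangle_ineq[of "f x" "g x"], of 2] by (simp add: power2_sum algebra_simps)
  then show "AE x in sphere_measure. norm ((norm (f x + g x))\<^sup>2) \<le> norm ((norm (f x))\<^sup>2 + 2 * (norm (f x) * norm (g x)) + (norm (g x))\<^sup>2)"
    by (intro AE_I2) simp
qed

lemma square_integrable_scaleR: "square_integrable f \<Longrightarrow> square_integrable (\<lambda>x. c *\<^sub>R f x)"
  by (rule square_integrable_dom[of f _ "\<bar>c\<bar>"]) auto

lemma square_integrable_uminus: "square_integrable f \<Longrightarrow> square_integrable (\<lambda>x. - f x)"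
  by (rule square_integrable_dom[of f _ 1]) auto

lemma square_integrable_diff:
  "square_integrable f \<Longrightarrow> square_integrable g \<Longrightarrow> square_integrable (\<lambda>x. f x - g x)"
  using square_integrable_add[OF _ square_integrable_uminus, of f g] by simp

lemma square_integrable_sum:
  "(\<And>i. i \<in> A \<Longrightarrow> square_integrable (f i)) \<Longrightarrow> square_integrable (\<lambda>x. \<Sum>i\<in>A. f i x)"
proof (induction A rule: infinite_finite_induct)
  case (insert i A)
  then show ?case by (simp add: square_integrable_add)
qed (simp_all add: square_integrable_def)

lemma square_integrable_continuous:
  fixes f :: "'a::euclidean_space \<Rightarrow> complex"
  assumes "continuous_on (sphere 0 1) f" shows "square_integrable f"
proof -
  have "continuous_on (sphere 0 1) (\<lambda>x. (norm (f x))\<^sup>2)" by (intro continuous_intros assms)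
  then show ?thesis
    unfolding square_integrable_def
    using continuous_on_sphere_measurable[OF assms] integrable_sphere_continuous by blast
qed

lemma square_integrable_inner:
  fixes f g :: "'a::euclidean_space \<Rightarrow> complex"
  assumes f: "square_integrable f" and g: "square_integrable g"
  shows "integrable sphere_measure (\<lambda>x. f x \<bullet> g x)"
proof (rule Bochner_Integration.integrable_bound[OF square_integrable_prod[OF f g]])
  show "(\<lambda>x. f x \<bullet> g x) \<in> borel_measurable sphere_measure" using f g by measurable
qed (simp add: Cauchy_Schwarz_ineq2)

lemma square_integrable_mult:
  fixes f g :: "'a::euclidean_space \<Rightarrow> complex"
  assumes f: "square_integrable f" and g: "square_integrable g"
  shows "integrable sphere_measure (\<lambda>x. f x * g x)"
proof (rule Bochner_Integration.integrable_bound[OF square_integrable_prod[OF f g]])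
  show "(\<lambda>x. f x * g x) \<in> borel_measurable sphere_measure" using f g by measurable
qed (simp add: norm_mult)

text \<open>
  Making the classes of square-integrable functions a type turns limits, projections and orthogonal
  series into instances of the theory of real inner product spaces.  The scalars are real although the values
  are complex, because in dimension at least \<open>3\<close> the spherical harmonics of a given degree form a real vector
  space only.  The inner product carries the factor \<open>1 / sphere_area\<close>, so that the norm is \<open>sphere_norm\<close>.
  The class \<open>cls f\<close> introduced below says something about \<open>f\<close> only if \<open>f\<close> is square-integrable.
\<close>

quotient_type (overloaded) 'a sphere_l2 = "'a::euclidean_space \<Rightarrow> complex" / partial:
  "\<lambda>f g. square_integrable f \<and> square_integrable g \<and> (AE x in sphere_measure. f x = g x)"
proof (rule part_equivpI)
  show "\<exists>f :: 'a \<Rightarrow> complex. square_integrable f \<and> square_integrable f \<and> (AE x in sphere_measure. f x = f x)"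
    by (rule exI[of _ "\<lambda>_. 0"]) (simp add: square_integrable_def)
  show "symp (\<lambda>f g :: 'a \<Rightarrow> complex. square_integrable f \<and> square_integrable g \<and> (AE x in sphere_measure. f x = g x))"
    by (auto simp: symp_def eq_commute)
  show "transp (\<lambda>f g :: 'a \<Rightarrow> complex. square_integrable f \<and> square_integrable g \<and> (AE x in sphere_measure. f x = g x))"
    unfolding transp_def by safe simp_all
qed

instantiation sphere_l2 :: (euclidean_space) real_vector
begin

lift_definition zero_sphere_l2 :: "'a sphere_l2" is "\<lambda>_. 0"
  by (simp add: square_integrable_def)

lift_definition plus_sphere_l2 :: "'a sphere_l2 \<Rightarrow> 'a sphere_l2 \<Rightarrow> 'a sphere_l2" is "\<lambda>f g x. f x + g x"
  by (safe intro!: square_integrable_add) simp_all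

lift_definition minus_sphere_l2 :: "'a sphere_l2 \<Rightarrow> 'a sphere_l2 \<Rightarrow> 'a sphere_l2" is "\<lambda>f g x. f x - g x"
  by (safe intro!: square_integrable_diff) simp_all

lift_definition uminus_sphere_l2 :: "'a sphere_l2 \<Rightarrow> 'a sphere_l2" is "\<lambda>f x. - f x"
  by (safe intro!: square_integrable_uminus) simp_all

lift_definition scaleR_sphere_l2 :: "real \<Rightarrow> 'a sphere_l2 \<Rightarrow> 'a sphere_l2" is "\<lambda>c f x. c *\<^sub>R f x"
  by (safe intro!: square_integrable_scaleR) simp_all

instance
proof
  fix f g h :: "'a sphere_l2" and c d :: real
  show "f + g + h = f + (g + h)" by transfer (simp add: square_integrable_add add.assoc)
  show "f + g = g + f" by transfer (simp add: square_integrable_add add.commute)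
  show "0 + f = f" by transfer simp
  show "- f + f = 0" by transfer (simp add: square_integrable_def)
  show "f - g = f + - g" by transfer (simp add: square_integrable_diff)
  show "c *\<^sub>R (f + g) = c *\<^sub>R f + c *\<^sub>R g"
    by transfer (simp add: square_integrable_add square_integrable_scaleR scaleR_add_right)
  show "(c + d) *\<^sub>R f = c *\<^sub>R f + d *\<^sub>R f"
    by transfer (simp add: square_integrable_add square_integrable_scaleR scaleR_add_left)
  show "c *\<^sub>R d *\<^sub>R f = (c * d) *\<^sub>R f" by transfer (simp add: square_integrable_scaleR)
  show "1 *\<^sub>R f = f" by transfer simp
qed

end

instantiation sphere_l2 :: (euclidean_space) real_inner
begin

lift_definition inner_sphere_l2 :: "'a sphere_l2 \<Rightarrow> 'a sphere_l2 \<Rightarrow> real" is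
  "\<lambda>f g. (\<integral>x. f x \<bullet> g x \<partial>sphere_measure) / sphere_area TYPE('a)"
proof -
  fix f f' g g' :: "'a \<Rightarrow> complex"
  assume f: "square_integrable f \<and> square_integrable f' \<and> (AE x in sphere_measure. f x = f' x)"
    and g: "square_integrable g \<and> square_integrable g' \<and> (AE x in sphere_measure. g x = g' x)"
  have "(\<integral>x. f x \<bullet> g x \<partial>sphere_measure) = (\<integral>x. f' x \<bullet> g' x \<partial>sphere_measure)"
  proof (rule integral_cong_AE)
    show "(\<lambda>x. f x \<bullet> g x) \<in> borel_measurable sphere_measure" "(\<lambda>x. f' x \<bullet> g' x) \<in> borel_measurable sphere_measure"
      using f g by (blast intro: borel_measurable_integrable square_integrable_inner)+
    show "AE x in sphere_measure. f x \<bullet> g x = f' x \<bullet> g' x"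
      using conjunct2[OF conjunct2[OF f]] conjunct2[OF conjunct2[OF g]] by eventually_elim simp
  qed
  then show "(\<integral>x. f x \<bullet> g x \<partial>sphere_measure) / sphere_area TYPE('a) = (\<integral>x. f' x \<bullet> g' x \<partial>sphere_measure) / sphere_area TYPE('a)"
    by simp
qed

definition norm_sphere_l2 :: "'a sphere_l2 \<Rightarrow> real" where "norm_sphere_l2 f = sqrt (inner f f)"
definition dist_sphere_l2 :: "'a sphere_l2 \<Rightarrow> 'a sphere_l2 \<Rightarrow> real" where "dist_sphere_l2 f g = norm (f - g)"
definition sgn_sphere_l2 :: "'a sphere_l2 \<Rightarrow> 'a sphere_l2" where "sgn_sphere_l2 f = f /\<^sub>R norm f"
definition uniformity_sphere_l2 :: "('a sphere_l2 \<times> 'a sphere_l2) filter" where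
  "uniformity_sphere_l2 = (INF e\<in>{0<..}. principal {(x, y). dist x y < e})"
definition open_sphere_l2 :: "'a sphere_l2 set \<Rightarrow> bool" where
  "open_sphere_l2 U \<longleftrightarrow> (\<forall>x\<in>U. eventually (\<lambda>(x', y). x' = x \<longrightarrow> y \<in> U) uniformity)"

instance
proof
  fix f g h :: "'a sphere_l2" and c :: real
  show "inner f g = inner g f" by transfer (simp add: inner_commute)
  show "inner (f + g) h = inner f h + inner g h"
    by transfer (simp add: inner_add_left square_integrable_inner add_divide_distrib)
  show "inner (c *\<^sub>R f) g = c * inner f g" by transfer simp
  show "0 \<le> inner f f"
    by transfer (simp add: sphere_area_pos less_imp_le)
  show "(inner f f = 0) = (f = 0)"
  proof transfer
    fix f :: "'a \<Rightarrow> complex"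
    assume "square_integrable f \<and> square_integrable f \<and> (AE x in sphere_measure. f x = f x)"
    then have f: "square_integrable f" by simp
    have 0: "square_integrable (\<lambda>x :: 'a. 0)" by (simp add: square_integrable_def)
    have "(\<integral>x. f x \<bullet> f x \<partial>sphere_measure) = 0 \<longleftrightarrow> (AE x in sphere_measure. f x = 0)"
      using integral_nonneg_eq_0_iff_AE[OF square_integrable_inner[OF f f]] by simp
    then show "((\<integral>x. f x \<bullet> f x \<partial>sphere_measure) / sphere_area TYPE('a) = 0) =
        (square_integrable f \<and> square_integrable (\<lambda>x :: 'a. 0) \<and> (AE x in sphere_measure. f x = 0))"
      using f 0 sphere_area_pos[where 'a='a] by simp
  qed
qed (simp_all add: norm_sphere_l2_def dist_sphere_l2_def sgn_sphere_l2_def uniformity_sphere_l2_def open_sphere_l2_def)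

end

abbreviation cls :: "('a::euclidean_space \<Rightarrow> complex) \<Rightarrow> 'a sphere_l2" where
  "cls \<equiv> abs_sphere_l2"

lemma cls_cases: obtains f where "square_integrable f" "F = cls f"
proof -
  have "\<exists>f. square_integrable f \<and> F = cls f"
    using Quotient_sphere_l2 by (metis (mono_tags, lifting) Quotient_def)
  then show ?thesis using that by blast
qed

lemma cls_eq_iff:
  assumes "square_integrable f" "square_integrable g"
  shows "cls f = cls g \<longleftrightarrow> (AE x in sphere_measure. f x = g x)"
  using Quotient_rel[OF Quotient_sphere_l2, of f g] assms by simp

lemma cls_cong: "square_integrable f \<Longrightarrow> square_integrable g \<Longrightarrow> (\<And>x. norm x = 1 \<Longrightarrow> f x = g x) \<Longrightarrow> cls f = cls g"
  by (subst cls_eq_iff) (auto intro!: AE_I2)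

lemma cls_add: "square_integrable f \<Longrightarrow> square_integrable g \<Longrightarrow> cls (\<lambda>x. f x + g x) = cls f + cls g"
  by (simp add: plus_sphere_l2.abs_eq)

lemma cls_diff: "square_integrable f \<Longrightarrow> square_integrable g \<Longrightarrow> cls (\<lambda>x. f x - g x) = cls f - cls g"
  by (simp add: minus_sphere_l2.abs_eq)

lemma cls_scaleR: "square_integrable f \<Longrightarrow> cls (\<lambda>x. c *\<^sub>R f x) = c *\<^sub>R cls f"
  by (simp add: scaleR_sphere_l2.abs_eq)

lemma cls_zero: "cls (\<lambda>_. 0) = 0"
  by (simp add: zero_sphere_l2_def)

lemma cls_sum:
  "(\<And>i. i \<in> A \<Longrightarrow> square_integrable (f i)) \<Longrightarrow> cls (\<lambda>x. \<Sum>i\<in>A. f i x) = (\<Sum>i\<in>A. cls (f i))"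
  by (induction A rule: infinite_finite_induct)
     (simp_all add: cls_zero cls_add square_integrable_sum)

lemma inner_cls:
  fixes f g :: "'a::euclidean_space \<Rightarrow> complex"
  shows "square_integrable f \<Longrightarrow> square_integrable g \<Longrightarrow>
    cls f \<bullet> cls g = (\<integral>x. f x \<bullet> g x \<partial>sphere_measure) / sphere_area TYPE('a)"
  by (simp add: inner_sphere_l2.abs_eq)

lemma norm_cls: "square_integrable f \<Longrightarrow> norm (cls f) = sphere_norm f"
  by (rule trans[OF norm_eq_sqrt_inner], subst inner_cls) (simp_all add: sphere_norm_def dot_square_norm)

lemma norm_cls_eq_integral:
  fixes f :: "'a::euclidean_space \<Rightarrow> complex"
  assumes "square_integrable f"
  shows "(norm (cls f))\<^sup>2 = (\<integral>x. (norm (f x))\<^sup>2 \<partial>sphere_measure) / sphere_area TYPE('a)"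
  unfolding power2_norm_eq_inner[of "cls f"] inner_cls[OF assms assms] by (simp add: dot_square_norm)

lemma norm_cls_le:
  fixes f g :: "'a::euclidean_space \<Rightarrow> complex"
  assumes f: "square_integrable f" and g: "square_integrable g"
    and le: "\<And>x. norm x = 1 \<Longrightarrow> norm (g x) \<le> norm (f x)"
  shows "norm (cls g) \<le> norm (cls f)"
proof -
  have "(\<integral>x. (norm (g x))\<^sup>2 \<partial>sphere_measure) \<le> (\<integral>x. (norm (f x))\<^sup>2 \<partial>sphere_measure)"
  proof (rule integral_mono)
    show "integrable sphere_measure (\<lambda>x. (norm (g x))\<^sup>2)" by (rule square_integrable_norm2[OF g])
    show "integrable sphere_measure (\<lambda>x. (norm (f x))\<^sup>2)" by (rule square_integrable_norm2[OF f])
    fix x :: 'a assume "x \<in> space sphere_measure"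
    then show "(norm (g x))\<^sup>2 \<le> (norm (f x))\<^sup>2" by (intro power_mono le) auto
  qed
  then have "(norm (cls g))\<^sup>2 \<le> (norm (cls f))\<^sup>2"
    unfolding norm_cls_eq_integral[OF f] norm_cls_eq_integral[OF g]
    using sphere_area_pos[where 'a='a] by (simp add: divide_right_mono)
  then show ?thesis by (rule power2_le_imp_le) simp
qed

lemma square_integrable_const: "square_integrable (\<lambda>_. c)"
  by (rule square_integrable_continuous) (rule continuous_on_const)

lemma norm_cls_const: "norm (cls (\<lambda>_ :: 'a::euclidean_space. c)) = norm c"
proof -
  have "(norm (cls (\<lambda>_ :: 'a. c)))\<^sup>2 = (norm c)\<^sup>2"
    unfolding norm_cls_eq_integral[OF square_integrable_const]
    using sphere_area_pos[where 'a='a] by (simp add: measure_sphere_measure)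
  then show ?thesis by (simp add: power2_eq_iff_nonneg)
qed

lemma integral_norm_le_norm_cls:
  fixes f :: "'a::euclidean_space \<Rightarrow> complex"
  assumes f: "square_integrable f"
  shows "integrable sphere_measure (\<lambda>x. norm (f x))"
    and "(\<integral>x. norm (f x) \<partial>sphere_measure) \<le> sphere_area TYPE('a) * norm (cls f)"
proof -
  have n: "square_integrable (\<lambda>x. complex_of_real (norm (f x)))"
    by (rule square_integrable_dom[OF f, of _ 1]) (use f in \<open>auto dest: square_integrableD\<close>)
  have 1: "square_integrable (\<lambda>_ :: 'a. 1)" by (rule square_integrable_const)
  show "integrable sphere_measure (\<lambda>x. norm (f x))"
    using square_integrable_inner[OF n 1] by (simp add: inner_complex_def)
  have "cls (\<lambda>x. complex_of_real (norm (f x))) \<bullet> cls (\<lambda>_. 1) = (\<integral>x. norm (f x) \<partial>sphere_measure) / sphere_area TYPE('a)"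
    by (subst inner_cls[OF n 1]) (simp add: inner_complex_def)
  moreover have "cls (\<lambda>x. complex_of_real (norm (f x))) \<bullet> cls (\<lambda>_. 1) \<le> norm (cls (\<lambda>x. complex_of_real (norm (f x)))) * norm (cls (\<lambda>_ :: 'a. 1))"
    by (rule norm_cauchy_schwarz)
  moreover have "norm (cls (\<lambda>x. complex_of_real (norm (f x)))) \<le> norm (cls f)"
    by (rule norm_cls_le[OF f n]) simp
  moreover have "norm (cls (\<lambda>_ :: 'a. 1)) = 1" by (simp add: norm_cls_const)
  ultimately have "(\<integral>x. norm (f x) \<partial>sphere_measure) / sphere_area TYPE('a) \<le> norm (cls f)" by simp
  then show "(\<integral>x. norm (f x) \<partial>sphere_measure) \<le> sphere_area TYPE('a) * norm (cls f)"
    using sphere_area_pos[where 'a='a] by (simp add: field_simps)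
qed

text \<open>
  The measure is finite, so the increments are small in mean as well as in square mean.  Their absolute
  values then have a convergent sum of integrals and hence a convergent sum at almost every point.
\<close>

lemma AE_convergent_of_fast_Cauchy:
  fixes g :: "nat \<Rightarrow> 'a::euclidean_space \<Rightarrow> complex"
  assumes g: "\<And>k. square_integrable (g k)"
    and fast: "\<And>k. norm (cls (g (Suc k)) - cls (g k)) \<le> (1/2) ^ k"
  shows "AE x in sphere_measure. convergent (\<lambda>k. g k x)"
proof -
  let ?A = "sphere_area TYPE('a)"
  have gd: "square_integrable (\<lambda>x. g (Suc k) x - g k x)" for k by (intro square_integrable_diff g)
  have le: "(\<integral>\<^sup>+ x. ennreal (norm (g (Suc k) x - g k x)) \<partial>sphere_measure) \<le> ennreal (?A * (1/2) ^ k)" for k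
  proof -
    have "(\<integral>\<^sup>+ x. ennreal (norm (g (Suc k) x - g k x)) \<partial>sphere_measure) =
        ennreal (\<integral>x. norm (g (Suc k) x - g k x) \<partial>sphere_measure)"
      by (rule nn_integral_eq_integral) (use integral_norm_le_norm_cls(1)[OF gd] in auto)
    also have "(\<integral>x. norm (g (Suc k) x - g k x) \<partial>sphere_measure) \<le> ?A * norm (cls (\<lambda>x. g (Suc k) x - g k x))"
      by (rule integral_norm_le_norm_cls(2)[OF gd])
    also have "\<dots> \<le> ?A * (1/2) ^ k"
      using fast[of k] sphere_area_pos[where 'a='a] by (intro mult_left_mono) (simp_all add: cls_diff g)
    finally show ?thesis by (simp add: ennreal_leI)
  qed
  have gm[measurable]: "g k \<in> borel_measurable sphere_measure" for k using g by (rule square_integrableD)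
  have "(\<integral>\<^sup>+ x. (\<Sum>k. ennreal (norm (g (Suc k) x - g k x))) \<partial>sphere_measure)
      = (\<Sum>k. \<integral>\<^sup>+ x. ennreal (norm (g (Suc k) x - g k x)) \<partial>sphere_measure)"
    by (rule nn_integral_suminf) measurable
  also have "\<dots> \<le> (\<Sum>k. ennreal (?A * (1/2) ^ k))"
    by (intro suminf_le le) auto
  also have "\<dots> = ennreal (\<Sum>k. ?A * (1/2) ^ k)"
    using sphere_area_pos[where 'a='a] by (intro suminf_ennreal2) (auto intro!: summable_mult summable_geometric)
  finally have "(\<integral>\<^sup>+ x. (\<Sum>k. ennreal (norm (g (Suc k) x - g k x))) \<partial>sphere_measure) \<noteq> \<infinity>"
    by (auto simp: top_unique)
  then have "AE x in sphere_measure. (\<Sum>k. ennreal (norm (g (Suc k) x - g k x))) \<noteq> \<infinity>"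
    by (intro nn_integral_PInf_AE) measurable
  then show ?thesis
  proof eventually_elim
    case (elim x)
    then have "summable (\<lambda>k. norm (g (Suc k) x - g k x))"
      by (intro summable_suminf_not_top) auto
    then have "summable (\<lambda>k. g (Suc k) x - g k x)" by (rule summable_norm_cancel)
    then have "convergent (\<lambda>n. g 0 x + (\<Sum>k<n. g (Suc k) x - g k x))"
      unfolding summable_iff_convergent by (intro convergent_add convergent_const)
    then show ?case by (simp add: sum_lessThan_telescope[of "\<lambda>k. g k x"])
  qed
qed

text \<open>
  The Riesz--Fischer theorem. Fatou's lemma, applied to \<open>g m - g n\<close> as \<open>m\<close> grows, bounds the
  distance from \<open>g n\<close> to the pointwise limit.
\<close>

lemma fast_Cauchy_limit:
  fixes g :: "nat \<Rightarrow> 'a::euclidean_space \<Rightarrow> complex"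
  assumes g: "\<And>k. square_integrable (g k)"
    and fast: "\<And>k m. m \<ge> k \<Longrightarrow> norm (cls (g m) - cls (g k)) \<le> (1/2) ^ k"
  shows "\<exists>G. square_integrable G \<and> (\<lambda>k. cls (g k)) \<longlonglongrightarrow> cls G"
proof -
  let ?A = "sphere_area TYPE('a)"
  define G where "G = (\<lambda>x. lim (\<lambda>k. g k x))"
  have gm[measurable]: "g k \<in> borel_measurable sphere_measure" for k using g by (rule square_integrableD)
  have Gm[measurable]: "G \<in> borel_measurable sphere_measure"
    unfolding G_def by (rule borel_measurable_lim_metric) measurable
  have conv: "AE x in sphere_measure. (\<lambda>k. g k x) \<longlonglongrightarrow> G x"
  proof -
    have "AE x in sphere_measure. convergent (\<lambda>k. g k x)"
      by (rule AE_convergent_of_fast_Cauchy) (use g fast in auto)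
    then show ?thesis by eventually_elim (simp add: G_def convergent_LIMSEQ_iff)
  qed
  have int: "(\<integral>\<^sup>+ x. ennreal ((norm (g m x - g k x))\<^sup>2) \<partial>sphere_measure) \<le> ennreal (?A * ((1/2) ^ k)\<^sup>2)" if "m \<ge> k" for m k
  proof -
    have d: "square_integrable (\<lambda>x. g m x - g k x)" by (intro square_integrable_diff g)
    have "(\<integral>x. (norm (g m x - g k x))\<^sup>2 \<partial>sphere_measure) = ?A * (norm (cls (\<lambda>x. g m x - g k x)))\<^sup>2"
      using norm_cls_eq_integral[OF d] sphere_area_pos[where 'a='a] by (simp add: field_simps)
    also have "\<dots> \<le> ?A * ((1/2) ^ k)\<^sup>2"
      using fast[OF that] sphere_area_pos[where 'a='a]
      by (intro mult_left_mono power_mono) (simp_all add: cls_diff g)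
    finally show ?thesis
      by (subst nn_integral_eq_integral) (use square_integrable_norm2[OF d] in \<open>auto intro: ennreal_leI\<close>)
  qed
  have fatou: "(\<integral>\<^sup>+ x. ennreal ((norm (G x - g k x))\<^sup>2) \<partial>sphere_measure) \<le> ennreal (?A * ((1/2) ^ k)\<^sup>2)" for k
  proof -
    have "(\<integral>\<^sup>+ x. ennreal ((norm (G x - g k x))\<^sup>2) \<partial>sphere_measure)
        = (\<integral>\<^sup>+ x. liminf (\<lambda>m. ennreal ((norm (g m x - g k x))\<^sup>2)) \<partial>sphere_measure)"
    proof (rule nn_integral_cong_AE)
      show "AE x in sphere_measure. ennreal ((norm (G x - g k x))\<^sup>2) = liminf (\<lambda>m. ennreal ((norm (g m x - g k x))\<^sup>2))"
        using conv
      proof eventually_elim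
        case (elim x)
        then have "(\<lambda>m. ennreal ((norm (g m x - g k x))\<^sup>2)) \<longlonglongrightarrow> ennreal ((norm (G x - g k x))\<^sup>2)"
          by (intro tendsto_ennrealI tendsto_intros)
        then show ?case by (intro lim_imp_Liminf[symmetric]) auto
      qed
    qed
    also have "\<dots> \<le> liminf (\<lambda>m. \<integral>\<^sup>+ x. ennreal ((norm (g m x - g k x))\<^sup>2) \<partial>sphere_measure)"
      by (rule nn_integral_liminf) measurable
    also have "\<dots> \<le> ennreal (?A * ((1/2) ^ k)\<^sup>2)"
    proof (rule Liminf_le)
      show "\<forall>\<^sub>F m in sequentially. (\<integral>\<^sup>+ x. ennreal ((norm (g m x - g k x))\<^sup>2) \<partial>sphere_measure) \<le> ennreal (?A * ((1/2) ^ k)\<^sup>2)"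
        using eventually_ge_at_top[of k] by eventually_elim (rule int)
    qed simp
    finally show ?thesis .
  qed
  have Gd: "square_integrable (\<lambda>x. G x - g k x)" for k
    unfolding square_integrable_def
  proof
    show "integrable sphere_measure (\<lambda>x. (norm (G x - g k x))\<^sup>2)"
    proof (rule integrableI_bounded)
      have "(\<integral>\<^sup>+ x. ennreal (norm ((norm (G x - g k x))\<^sup>2)) \<partial>sphere_measure) \<le> ennreal (?A * ((1/2) ^ k)\<^sup>2)"
        using fatou[of k] by simp
      also have "\<dots> < \<infinity>" by simp
      finally show "(\<integral>\<^sup>+ x. ennreal (norm ((norm (G x - g k x))\<^sup>2)) \<partial>sphere_measure) < \<infinity>" .
    qed measurable
  qed measurable
  have G: "square_integrable G" using square_integrable_add[OF Gd[of 0] g[of 0]] by simp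
  have dist: "norm (cls (g k) - cls G) \<le> (1/2) ^ k" for k
  proof -
    have "ennreal (\<integral>x. (norm (G x - g k x))\<^sup>2 \<partial>sphere_measure) \<le> ennreal (?A * ((1/2) ^ k)\<^sup>2)"
      using fatou[of k] by (subst (asm) nn_integral_eq_integral) (use square_integrable_norm2[OF Gd] in auto)
    then have "(\<integral>x. (norm (G x - g k x))\<^sup>2 \<partial>sphere_measure) \<le> ?A * ((1/2) ^ k)\<^sup>2"
      using sphere_area_pos[where 'a='a] by (subst (asm) ennreal_le_iff) auto
    then have "(norm (cls (\<lambda>x. G x - g k x)))\<^sup>2 \<le> ((1/2) ^ k)\<^sup>2"
      using sphere_area_pos[where 'a='a] by (simp add: norm_cls_eq_integral[OF Gd] field_simps)
    then have "norm (cls (\<lambda>x. G x - g k x)) \<le> (1/2) ^ k" by (rule power2_le_imp_le) simp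
    then show ?thesis by (simp add: cls_diff G g norm_minus_commute)
  qed
  have "(\<lambda>k. cls (g k) - cls G) \<longlonglongrightarrow> 0"
    by (rule Lim_null_comparison[where g="\<lambda>k. (1/2) ^ k"]) (use dist in \<open>auto intro!: LIMSEQ_realpow_zero\<close>)
  then have "(\<lambda>k. cls (g k)) \<longlonglongrightarrow> cls G" by (simp add: LIM_zero_iff)
  with G show ?thesis by blast
qed

instance sphere_l2 :: (euclidean_space) banach
proof
  fix X :: "nat \<Rightarrow> 'a sphere_l2" assume X: "Cauchy X"
  have "\<exists>N. \<forall>m\<ge>N. \<forall>n\<ge>N. norm (X m - X n) < (1/2) ^ k" for k :: nat
    using CauchyD[OF X, of "(1/2) ^ k"] by simp
  then obtain N where N: "\<And>k m n. m \<ge> N k \<Longrightarrow> n \<ge> N k \<Longrightarrow> norm (X m - X n) < (1/2) ^ k"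
    by metis
  define r where "r = (\<lambda>k. k + (\<Sum>i\<le>k. N i))"
  have r: "strict_mono r" unfolding strict_mono_Suc_iff by (simp add: r_def)
  have rN: "r k \<ge> N k" for k
    using member_le_sum[of k "{..k}" N] by (simp add: r_def)
  have "\<forall>n. \<exists>f. square_integrable f \<and> X n = cls f" by (metis cls_cases)
  then obtain f where f: "\<And>n. square_integrable (f n)" "\<And>n. X n = cls (f n)" by metis
  have "norm (cls (f (r m)) - cls (f (r k))) \<le> (1/2) ^ k" if "m \<ge> k" for m k
  proof -
    have "r m \<ge> r k" using r that by (simp add: strict_mono_less_eq)
    then have "r m \<ge> N k" using rN order_trans by blast
    from N[OF this rN] show ?thesis by (simp add: f less_imp_le)
  qed
  then obtain G where "(\<lambda>k. cls (f (r k))) \<longlonglongrightarrow> cls G"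
    using fast_Cauchy_limit[of "\<lambda>k. f (r k)"] f by blast
  then have "(X \<circ> r) \<longlonglongrightarrow> cls G" by (simp add: o_def f)
  then have "X \<longlonglongrightarrow> cls G" by (rule Cauchy_converges_subseq[OF X r])
  then show "convergent X" by (rule convergentI)
qed

subsection \<open>Orthogonal families\<close>

lemma orthogonal_projection_finite_span:
  fixes V :: "'h::real_inner set"
  assumes V: "subspace V" and B: "finite B" "V \<subseteq> span B"
  shows "\<exists>y\<in>V. \<forall>z\<in>V. (f - y) \<bullet> z = 0"
proof -
  obtain C where C: "C \<subseteq> V" "independent C" "V \<subseteq> span C"
    using maximal_independent_subset[of V] by metis
  have "finite C" using independent_span_bound[OF B(1) C(2)] C(1) B(2) by blast
  then obtain D where D: "finite D" "span D = span C" "pairwise orthogonal D"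
    using basis_orthogonal[of C] by blast
  have VD: "V = span D" using C V D by (metis span_minimal subset_antisym)
  define y where "y = (\<Sum>b\<in>D. (b \<bullet> f / (b \<bullet> b)) *\<^sub>R b)"
  have orth: "orthogonal (f - y) x" if "x \<in> D" for x
  proof -
    have "y \<bullet> x = (\<Sum>b\<in>D. b \<bullet> f * (b \<bullet> x) / (b \<bullet> b))"
      by (simp add: y_def inner_sum_left)
    also have "\<dots> = (\<Sum>b\<in>D. if b = x then b \<bullet> f else 0)"
      by (rule sum.cong) (use D(3) that in \<open>auto simp: pairwise_def orthogonal_def\<close>)
    also have "\<dots> = x \<bullet> f" using D(1) that by simp
    finally have "y \<bullet> x = f \<bullet> x" by (simp add: inner_commute)
    then show ?thesis unfolding orthogonal_def inner_diff_left by simp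
  qed
  show ?thesis
  proof (intro bexI ballI)
    show "y \<in> V" unfolding VD y_def by (intro span_sum span_mul span_base)
    fix z assume "z \<in> V"
    then show "(f - y) \<bullet> z = 0"
      using orthogonal_to_span[of z D "f - y"] orth VD by (simp add: orthogonal_def)
  qed
qed

lemma norm_sum_orthogonal:
  fixes Y :: "'i \<Rightarrow> 'h::real_inner"
  assumes "\<And>m n. m \<noteq> n \<Longrightarrow> Y m \<bullet> Y n = 0" "finite I"
  shows "(norm (sum Y I))\<^sup>2 = (\<Sum>n\<in>I. (norm (Y n))\<^sup>2)"
  by (rule norm_sum_Pythagorean) (use assms in \<open>auto simp: pairwise_def orthogonal_def\<close>)

lemma orthogonal_series_summable:
  fixes Y :: "nat \<Rightarrow> 'h::{real_inner, banach}"
  assumes orth: "\<And>m n. m \<noteq> n \<Longrightarrow> Y m \<bullet> Y n = 0" and sm: "summable (\<lambda>n. (norm (Y n))\<^sup>2)"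
  shows "summable Y"
  unfolding summable_Cauchy
proof (intro allI impI)
  fix e :: real assume e: "e > 0"
  then obtain N where N: "\<And>m n. m \<ge> N \<Longrightarrow> norm (\<Sum>i=m..<n. (norm (Y i))\<^sup>2) < e\<^sup>2"
    using sm unfolding summable_Cauchy by (meson zero_less_power)
  have "norm (sum Y {m..<n}) < e" if "m \<ge> N" for m n
  proof (rule power2_less_imp_less)
    show "(norm (sum Y {m..<n}))\<^sup>2 < e\<^sup>2"
      using N[OF that, of n] by (simp add: norm_sum_orthogonal[OF orth])
  qed (use e in simp)
  then show "\<exists>N. \<forall>m\<ge>N. \<forall>n. norm (sum Y {m..<n}) < e" by blast
qed

lemma orthogonal_series_norm:
  fixes Y :: "nat \<Rightarrow> 'h::real_inner"
  assumes orth: "\<And>m n. m \<noteq> n \<Longrightarrow> Y m \<bullet> Y n = 0" and s: "Y sums s"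
  shows "(\<lambda>n. (norm (Y n))\<^sup>2) sums (norm s)\<^sup>2"
proof -
  have "(\<lambda>N. (norm (\<Sum>n<N. Y n))\<^sup>2) \<longlonglongrightarrow> (norm s)\<^sup>2"
    using s unfolding sums_def by (intro tendsto_intros)
  then show ?thesis unfolding sums_def by (simp add: norm_sum_orthogonal[OF orth])
qed

lemma Bessel_inequality:
  fixes Y :: "'i \<Rightarrow> 'h::real_inner"
  assumes orth: "\<And>m n. m \<noteq> n \<Longrightarrow> Y m \<bullet> Y n = 0" and p: "\<And>n. f \<bullet> Y n = (norm (Y n))\<^sup>2" and I: "finite I"
  shows "(\<Sum>n\<in>I. (norm (Y n))\<^sup>2) \<le> (norm f)\<^sup>2"
proof -
  have "f \<bullet> sum Y I = (norm (sum Y I))\<^sup>2"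
    by (simp add: inner_sum_right p norm_sum_orthogonal[OF orth I])
  then have "(norm (f - sum Y I))\<^sup>2 = (norm f)\<^sup>2 - (norm (sum Y I))\<^sup>2"
    by (simp add: power2_norm_eq_inner inner_diff_left inner_diff_right inner_commute)
  then show ?thesis using zero_le_power2[of "norm (f - sum Y I)"]
    by (simp add: norm_sum_orthogonal[OF orth I])
qed

section \<open>Harmonic polynomials\<close>

lemma has_derivative_along_line:
  assumes "(F has_derivative F') (at (x + t *\<^sub>R b))"
  shows "((\<lambda>t. F (x + t *\<^sub>R b)) has_vector_derivative F' b) (at t)"
proof -
  have "((\<lambda>t. F (x + t *\<^sub>R b)) has_derivative (\<lambda>s. F' (s *\<^sub>R b))) (at t)"
    by (rule has_derivative_compose[where f="\<lambda>t. x + t *\<^sub>R b", of "\<lambda>t. t *\<^sub>R b"])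
       (auto intro!: derivative_eq_intros assms)
  then show ?thesis
    by (simp add: has_vector_derivative_def linear_cmul[OF has_derivative_linear[OF assms]])
qed

lemma partial_deriv_eq:
  assumes "(F has_derivative F') (at x)"
  shows "partial_deriv b F x = F' b"
proof -
  have "((\<lambda>t. F (x + t *\<^sub>R b)) has_vector_derivative F' b) (at 0)"
    by (rule has_derivative_along_line) (use assms in simp)
  then show ?thesis unfolding partial_deriv_def by (rule vector_derivative_at)
qed

lemma differentiable_has_partials:
  fixes F :: "'a::euclidean_space \<Rightarrow> complex"
  assumes "F differentiable (at x)"
  shows "(F has_derivative (\<lambda>v. \<Sum>b\<in>Basis. (v \<bullet> b) *\<^sub>R partial_deriv b F x)) (at x)"
proof -
  obtain F' where F': "(F has_derivative F') (at x)" using assms by (auto simp: differentiable_def)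
  have "F' v = (\<Sum>b\<in>Basis. (v \<bullet> b) *\<^sub>R partial_deriv b F x)" for v
  proof -
    have "F' v = F' (\<Sum>b\<in>Basis. (v \<bullet> b) *\<^sub>R b)" by (simp add: euclidean_representation)
    also have "\<dots> = (\<Sum>b\<in>Basis. (v \<bullet> b) *\<^sub>R F' b)"
      using has_derivative_linear[OF F'] by (simp add: linear_sum linear_cmul)
    finally show ?thesis by (simp add: partial_deriv_eq[OF F'])
  qed
  then have "F' = (\<lambda>v. \<Sum>b\<in>Basis. (v \<bullet> b) *\<^sub>R partial_deriv b F x)" by (rule ext)
  with F' show ?thesis by simp
qed

lemma partial_deriv_cong_nhds:
  assumes "\<forall>\<^sub>F y in nhds x. F y = G y" "F differentiable (at x)"
  shows "partial_deriv b F x = partial_deriv b G x"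
proof -
  obtain F' where F': "(F has_derivative F') (at x)" using assms(2) by (auto simp: differentiable_def)
  obtain S where S: "open S" "x \<in> S" "\<And>y. y \<in> S \<Longrightarrow> F y = G y"
    using assms(1) by (auto simp: eventually_nhds)
  have "(G has_derivative F') (at x)"
    by (rule has_derivative_transform_within_open[OF F' S])
  then show ?thesis by (simp add: partial_deriv_eq[OF F'] partial_deriv_eq)
qed

lemma partial_deriv_add:
  assumes "F differentiable (at x)" "G differentiable (at x)"
  shows "partial_deriv b (\<lambda>x. F x + G x) x = partial_deriv b F x + partial_deriv b G x"
proof -
  obtain F' G' where d: "(F has_derivative F') (at x)" "(G has_derivative G') (at x)"
    using assms by (auto simp: differentiable_def)
  from partial_deriv_eq[OF has_derivative_add[OF this]] show ?thesis
    by (simp add: partial_deriv_eq[OF d(1)] partial_deriv_eq[OF d(2)])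
qed

lemma partial_deriv_sum:
  assumes "finite A" "\<And>i. i \<in> A \<Longrightarrow> F i differentiable (at x)"
  shows "partial_deriv b (\<lambda>x. \<Sum>i\<in>A. F i x) x = (\<Sum>i\<in>A. partial_deriv b (F i) x)"
  using assms
proof (induction A rule: finite_induct)
  case empty
  show ?case by (simp add: partial_deriv_eq[OF has_derivative_const])
next
  case (insert i A)
  then show ?case by (simp add: partial_deriv_add)
qed

lemma partial_deriv_mult:
  fixes F G :: "'a::euclidean_space \<Rightarrow> complex"
  assumes "F differentiable (at x)" "G differentiable (at x)"
  shows "partial_deriv b (\<lambda>x. F x * G x) x = partial_deriv b F x * G x + F x * partial_deriv b G x"
proof -
  obtain F' G' where d: "(F has_derivative F') (at x)" "(G has_derivative G') (at x)"
    using assms by (auto simp: differentiable_def)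
  from partial_deriv_eq[OF has_derivative_mult[OF this]] show ?thesis
    by (simp add: partial_deriv_eq[OF d(1)] partial_deriv_eq[OF d(2)])
qed

lemma partial_deriv_const [simp]: "partial_deriv b (\<lambda>_. c) = (\<lambda>_. 0)"
  by (rule ext) (simp add: partial_deriv_eq[OF has_derivative_const])

lemma coord_differentiable: "(\<lambda>x::'a::euclidean_space. complex_of_real (x \<bullet> e)) differentiable (at x)"
  by (auto simp: differentiable_def intro!: derivative_eq_intros exI)

lemma partial_deriv_coord:
  "partial_deriv b (\<lambda>x::'a::euclidean_space. complex_of_real (x \<bullet> e)) = (\<lambda>_. complex_of_real (b \<bullet> e))"
proof
  fix x :: 'a
  have "((\<lambda>x. complex_of_real (x \<bullet> e)) has_derivative (\<lambda>v. complex_of_real (v \<bullet> e))) (at x)"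
    by (auto intro!: derivative_eq_intros)
  from partial_deriv_eq[OF this] show "partial_deriv b (\<lambda>x. complex_of_real (x \<bullet> e)) x = complex_of_real (b \<bullet> e)" .
qed

lemma partial_deriv_cnj:
  assumes "F differentiable (at x)"
  shows "partial_deriv b (\<lambda>x. cnj (F x)) x = cnj (partial_deriv b F x)"
proof -
  obtain F' where d: "(F has_derivative F') (at x)"
    using assms by (auto simp: differentiable_def)
  from partial_deriv_eq[OF has_derivative_cnj[OF this]] show ?thesis
    by (simp add: partial_deriv_eq[OF d])
qed

lemma polynomial_function_complex_mult:
  fixes p q :: "'a::euclidean_space \<Rightarrow> complex"
  assumes p: "polynomial_function p" and q: "polynomial_function q"
  shows "polynomial_function (\<lambda>x. p x * q x)"
proof -
  have R: "polynomial_function (\<lambda>x. Re (p x))" and I: "polynomial_function (\<lambda>x. Im (p x))"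
    using p bounded_linear_Re bounded_linear_Im
    unfolding polynomial_function_def[of p] by (auto simp: o_def real_polynomial_function_eq)
  have iq: "polynomial_function (\<lambda>x. \<i> * q x)"
    unfolding polynomial_function_def
  proof (intro allI impI)
    fix f :: "complex \<Rightarrow> real" assume f: "bounded_linear f"
    have "bounded_linear (f \<circ> (\<lambda>z. \<i> * z))"
      using bounded_linear_compose[OF f bounded_linear_mult_right[of \<i>]] by (simp add: o_def)
    then have "real_polynomial_function ((f \<circ> (\<lambda>z. \<i> * z)) \<circ> q)"
      using q unfolding polynomial_function_def by blast
    then show "real_polynomial_function (f \<circ> (\<lambda>x. \<i> * q x))" by (simp add: o_def)
  qed
  have "polynomial_function (\<lambda>x. Re (p x) *\<^sub>R q x + Im (p x) *\<^sub>R (\<i> * q x))"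
    by (intro polynomial_function_add polynomial_function_mult R I q iq)
  moreover have "Re (p x) *\<^sub>R q x + Im (p x) *\<^sub>R (\<i> * q x) = p x * q x" for x
    by (simp add: complex_eq_iff)
  ultimately show ?thesis by simp
qed

lemma polynomial_function_coord [intro]:
  "polynomial_function (\<lambda>x::'a::euclidean_space. complex_of_real (x \<bullet> e))"
  by (intro polynomial_function_bounded_linear bounded_linear_compose[OF bounded_linear_of_real bounded_linear_inner_left])

lemma polynomial_function_cnj:
  fixes p :: "'a::euclidean_space \<Rightarrow> complex"
  assumes "polynomial_function p"
  shows "polynomial_function (\<lambda>x. cnj (p x))"
  unfolding polynomial_function_def
proof (intro allI impI)
  fix f :: "complex \<Rightarrow> real" assume f: "bounded_linear f"
  have "bounded_linear (f \<circ> cnj)"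
    using bounded_linear_compose[OF f bounded_linear_cnj] by (simp add: o_def)
  then have "real_polynomial_function ((f \<circ> cnj) \<circ> p)"
    using assms unfolding polynomial_function_def by blast
  then show "real_polynomial_function (f \<circ> (\<lambda>x. cnj (p x)))" by (simp add: o_def)
qed

text \<open>
  A complex polynomial is \<open>Re p + \<i> * Im p\<close> with two real polynomials, and a linear functional is a
  combination of coordinates.  This reduces facts about derivatives to constants, coordinates, sums and
  products.
\<close>

lemma complex_polynomial_induct [consumes 1, case_names const coord add mult]:
  fixes p :: "'a::euclidean_space \<Rightarrow> complex"
  assumes p: "polynomial_function p"
    and const: "\<And>c. P (\<lambda>_. c)"
    and coord: "\<And>b. b \<in> Basis \<Longrightarrow> P (\<lambda>x. complex_of_real (x \<bullet> b))"
    and add: "\<And>p q. polynomial_function p \<Longrightarrow> polynomial_function q \<Longrightarrow> P p \<Longrightarrow> P q \<Longrightarrow> P (\<lambda>x. p x + q x)"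
    and mult: "\<And>p q. polynomial_function p \<Longrightarrow> polynomial_function q \<Longrightarrow> P p \<Longrightarrow> P q \<Longrightarrow> P (\<lambda>x. p x * q x)"
  shows "P p"
proof -
  define Q where "Q = (\<lambda>p. polynomial_function p \<and> P p)"
  have Qc: "Q (\<lambda>_. c)" for c using const by (simp add: Q_def)
  have Qx: "Q (\<lambda>x. complex_of_real (x \<bullet> b))" if "b \<in> Basis" for b using coord[OF that] by (auto simp: Q_def)
  have Qa: "Q (\<lambda>x. p x + q x)" if "Q p" "Q q" for p q using add that by (auto simp: Q_def)
  have Qm: "Q (\<lambda>x. p x * q x)" if "Q p" "Q q" for p q
    using mult that by (auto simp: Q_def polynomial_function_complex_mult)
  have Qs: "Q (\<lambda>x. \<Sum>i\<in>A. f i x)" if "finite A" "\<And>i. i \<in> A \<Longrightarrow> Q (f i)" for A :: "'a set" and f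
    using that by (induction A rule: finite_induct) (auto simp: Qc Qa)
  have R: "Q (\<lambda>x. complex_of_real (r x))" if "real_polynomial_function r" for r :: "'a \<Rightarrow> real"
    using that
  proof (induction r rule: real_polynomial_function.induct)
    case (linear f)
    have eq: "(\<lambda>x. complex_of_real (f x)) = (\<lambda>x. \<Sum>b\<in>Basis. complex_of_real (f b) * complex_of_real (x \<bullet> b))"
    proof
      fix x
      have "f x = f (\<Sum>b\<in>Basis. (x \<bullet> b) *\<^sub>R b)" by (simp add: euclidean_representation)
      also have "\<dots> = (\<Sum>b\<in>Basis. f b * (x \<bullet> b))"
        using bounded_linear.linear[OF linear] by (simp add: linear_sum linear_cmul mult.commute)
      finally show "complex_of_real (f x) = (\<Sum>b\<in>Basis. complex_of_real (f b) * complex_of_real (x \<bullet> b))"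
        by (simp only: of_real_sum of_real_mult)
    qed
    have "Q (\<lambda>x. \<Sum>b\<in>Basis. complex_of_real (f b) * complex_of_real (x \<bullet> b))"
      by (rule Qs, simp, rule Qm, rule Qc, rule Qx)
    then show ?case by (subst eq)
  next
    case (const c) show ?case by (rule Qc)
  next
    case (add f g) then show ?case using Qa by simp
  next
    case (mult f g) then show ?case using Qm by simp
  qed
  have "real_polynomial_function (\<lambda>x. Re (p x))" "real_polynomial_function (\<lambda>x. Im (p x))"
    using p bounded_linear_Re bounded_linear_Im unfolding polynomial_function_def by (auto simp: o_def)
  then have "Q (\<lambda>x. complex_of_real (Re (p x)) + \<i> * complex_of_real (Im (p x)))"
    by (intro Qa[OF R Qm[OF Qc R]])
  then show ?thesis by (simp add: complex_eq[symmetric] Q_def)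
qed

lemma polynomial_differentiable: "polynomial_function p \<Longrightarrow> p differentiable (at x)"
  for p :: "'a::euclidean_space \<Rightarrow> complex"
  by (rule differentiable_at_polynomial_function)

lemma polynomial_partial_deriv:
  fixes p :: "'a::euclidean_space \<Rightarrow> complex"
  assumes "polynomial_function p"
  shows "polynomial_function (partial_deriv b p)"
  using assms
proof (induction p rule: complex_polynomial_induct)
  case (add p q)
  then have "partial_deriv b (\<lambda>x. p x + q x) = (\<lambda>x. partial_deriv b p x + partial_deriv b q x)"
    by (auto simp: partial_deriv_add polynomial_differentiable)
  then show ?case using add by auto
next
  case (mult p q)
  then have "partial_deriv b (\<lambda>x. p x * q x) = (\<lambda>x. partial_deriv b p x * q x + p x * partial_deriv b q x)"
    by (auto simp: partial_deriv_mult polynomial_differentiable)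
  then show ?case using mult by (auto intro!: polynomial_function_complex_mult polynomial_function_add)
qed (simp_all add: partial_deriv_coord)

lemma polynomial_partial_deriv_commute:
  fixes p :: "'a::euclidean_space \<Rightarrow> complex"
  assumes "polynomial_function p"
  shows "partial_deriv b (partial_deriv c p) = partial_deriv c (partial_deriv b p)"
  using assms
proof (induction p rule: complex_polynomial_induct)
  case (add p q)
  have "partial_deriv a (\<lambda>x. p x + q x) = (\<lambda>x. partial_deriv a p x + partial_deriv a q x)" for a
    using add by (auto simp: partial_deriv_add polynomial_differentiable)
  moreover have "partial_deriv a (\<lambda>x. partial_deriv a' p x + partial_deriv a' q x) =
     (\<lambda>x. partial_deriv a (partial_deriv a' p) x + partial_deriv a (partial_deriv a' q) x)" for a a'
    using add by (auto simp: partial_deriv_add polynomial_differentiable polynomial_partial_deriv)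
  ultimately show ?case using add by simp
next
  case (mult p q)
  note pol = mult(1,2) polynomial_partial_deriv[OF mult(1)] polynomial_partial_deriv[OF mult(2)]
  have 1: "partial_deriv a (\<lambda>x. p x * q x) = (\<lambda>x. partial_deriv a p x * q x + p x * partial_deriv a q x)" for a
    using pol by (auto simp: partial_deriv_mult polynomial_differentiable)
  have 2: "partial_deriv a (\<lambda>x. partial_deriv a' p x * q x + p x * partial_deriv a' q x) =
     (\<lambda>x. (partial_deriv a (partial_deriv a' p) x * q x + partial_deriv a' p x * partial_deriv a q x) +
          (partial_deriv a p x * partial_deriv a' q x + p x * partial_deriv a (partial_deriv a' q) x))" for a a'
    using pol by (auto simp: partial_deriv_add partial_deriv_mult polynomial_differentiable polynomial_function_complex_mult)
  show ?case unfolding 1 2 using mult by (simp add: algebra_simps)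
qed (simp_all add: partial_deriv_coord)

definition homogeneous_harmonic :: "nat \<Rightarrow> ('a::euclidean_space \<Rightarrow> complex) \<Rightarrow> bool" where
  "homogeneous_harmonic n p \<longleftrightarrow> polynomial_function p \<and> (\<forall>t x. p (t *\<^sub>R x) = t ^ n *\<^sub>R p x) \<and> (\<forall>x. laplacian p x = 0)"

lemma homogeneous_harmonicD:
  assumes "homogeneous_harmonic n p"
  shows "polynomial_function p" "p (t *\<^sub>R x) = t ^ n *\<^sub>R p x" "laplacian p x = 0"
  using assms by (auto simp: homogeneous_harmonic_def)

lemma spherical_harmonics_eq:
  "spherical_harmonics n = {Y. sphere_valued Y \<and> (\<exists>p. homogeneous_harmonic n p \<and> (\<forall>x\<in>sphere 0 1. Y x = p x))}"
  by (auto simp: spherical_harmonics_def homogeneous_harmonic_def)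

text \<open>
  Euler's identity: differentiate \<open>p (t *\<^sub>R x) = t ^ n *\<^sub>R p x\<close> at \<open>t = 1\<close>.
\<close>

lemma Euler_homogeneous:
  fixes p :: "'a::euclidean_space \<Rightarrow> complex"
  assumes p: "polynomial_function p" and h: "\<And>t x. p (t *\<^sub>R x) = t ^ n *\<^sub>R p x"
  shows "(\<Sum>b\<in>Basis. of_real (x \<bullet> b) * partial_deriv b p x) = of_nat n * p x"
proof -
  have "((\<lambda>t. p (0 + t *\<^sub>R x)) has_vector_derivative (\<Sum>b\<in>Basis. (x \<bullet> b) *\<^sub>R partial_deriv b p x)) (at 1)"
    by (rule has_derivative_along_line)
       (use differentiable_has_partials[OF polynomial_differentiable[OF p], of x] in simp)
  then have "((\<lambda>t. t ^ n *\<^sub>R p x) has_vector_derivative (\<Sum>b\<in>Basis. (x \<bullet> b) *\<^sub>R partial_deriv b p x)) (at 1)"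
    by (simp add: h)
  moreover have "((\<lambda>t::real. t ^ n *\<^sub>R p x) has_vector_derivative (real n *\<^sub>R p x)) (at 1)"
    by (auto intro!: derivative_eq_intros simp: has_vector_derivative_def)
  ultimately have "(\<Sum>b\<in>Basis. (x \<bullet> b) *\<^sub>R partial_deriv b p x) = real n *\<^sub>R p x"
    by (rule vector_derivative_unique_at)
  then show ?thesis by (simp add: scaleR_conv_of_real)
qed

lemma partial_deriv_homogeneous:
  fixes p :: "'a::euclidean_space \<Rightarrow> complex"
  assumes p: "polynomial_function p" and h: "\<And>t x. p (t *\<^sub>R x) = t ^ Suc n *\<^sub>R p x"
  shows "partial_deriv b p (t *\<^sub>R x) = t ^ n *\<^sub>R partial_deriv b p x"
proof -
  have nz: "partial_deriv b p (t *\<^sub>R x) = t ^ n *\<^sub>R partial_deriv b p x" if t: "t \<noteq> 0" for t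
  proof -
    obtain F' where F': "(p has_derivative F') (at (t *\<^sub>R x))"
      using polynomial_differentiable[OF p] by (auto simp: differentiable_def)
    have "((\<lambda>y. p (t *\<^sub>R y)) has_derivative (\<lambda>v. F' (t *\<^sub>R v))) (at x)"
      by (rule has_derivative_compose[where f="\<lambda>y. t *\<^sub>R y"]) (auto intro!: derivative_eq_intros F')
    then have "partial_deriv b (\<lambda>y. p (t *\<^sub>R y)) x = F' (t *\<^sub>R b)" by (rule partial_deriv_eq)
    also have "\<dots> = t *\<^sub>R partial_deriv b p (t *\<^sub>R x)"
      by (simp add: linear_cmul[OF has_derivative_linear[OF F']] partial_deriv_eq[OF F'])
    finally have 1: "partial_deriv b (\<lambda>y. p (t *\<^sub>R y)) x = t *\<^sub>R partial_deriv b p (t *\<^sub>R x)" .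
    obtain G' where G': "(p has_derivative G') (at x)"
      using polynomial_differentiable[OF p] by (auto simp: differentiable_def)
    have "((\<lambda>y. t ^ Suc n *\<^sub>R p y) has_derivative (\<lambda>v. t ^ Suc n *\<^sub>R G' v)) (at x)"
      by (rule has_derivative_scaleR_right[OF G'])
    then have "partial_deriv b (\<lambda>y. p (t *\<^sub>R y)) x = t ^ Suc n *\<^sub>R partial_deriv b p x"
      using partial_deriv_eq[of "\<lambda>y. t ^ Suc n *\<^sub>R p y" _ x b] by (simp add: h partial_deriv_eq[OF G'])
    with 1 have "t *\<^sub>R partial_deriv b p (t *\<^sub>R x) = t *\<^sub>R (t ^ n *\<^sub>R partial_deriv b p x)" by simp
    then show ?thesis using t by (simp only: scaleR_cancel_left) simp
  qed
  show ?thesis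
  proof (cases "t = 0")
    case True
    have pc: "isCont (partial_deriv b p) y" for y
      by (rule continuous_polymonial_function[OF polynomial_partial_deriv[OF p]])
    have "((\<lambda>t. partial_deriv b p (t *\<^sub>R x)) \<longlongrightarrow> partial_deriv b p (0 *\<^sub>R x)) (at (0::real))"
      by (rule isCont_tendsto_compose[OF pc]) (intro tendsto_intros)
    moreover have "((\<lambda>t::real. t ^ n *\<^sub>R partial_deriv b p x) \<longlongrightarrow> 0 ^ n *\<^sub>R partial_deriv b p x) (at 0)"
      by (intro tendsto_intros)
    then have "((\<lambda>t. partial_deriv b p (t *\<^sub>R x)) \<longlongrightarrow> 0 ^ n *\<^sub>R partial_deriv b p x) (at (0::real))"
      by (rule Lim_transform_eventually) (auto simp: eventually_at_filter nz)
    ultimately have "partial_deriv b p (0 *\<^sub>R x) = 0 ^ n *\<^sub>R partial_deriv b p x"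
      by (rule tendsto_unique[rotated]) simp
    then show ?thesis using True by simp
  qed (rule nz)
qed

lemma laplacian_polynomial_add:
  assumes "polynomial_function p" "polynomial_function q"
  shows "laplacian (\<lambda>x. p x + q x) x = laplacian p x + laplacian q x"
proof -
  have "partial_deriv b (partial_deriv b (\<lambda>x. p x + q x)) x
      = partial_deriv b (partial_deriv b p) x + partial_deriv b (partial_deriv b q) x" for b
  proof -
    have "partial_deriv b (\<lambda>x. p x + q x) = (\<lambda>x. partial_deriv b p x + partial_deriv b q x)"
      using assms by (auto simp: partial_deriv_add polynomial_differentiable)
    then show ?thesis using assms by (simp add: partial_deriv_add polynomial_differentiable polynomial_partial_deriv)
  qed
  then show ?thesis by (simp add: laplacian_def sum.distrib)
qed

lemma laplacian_polynomial_cmult: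
  assumes "polynomial_function p"
  shows "laplacian (\<lambda>x. c * p x) x = c * laplacian p x"
proof -
  have 1: "partial_deriv b (\<lambda>x. c * q x) = (\<lambda>x. c * partial_deriv b q x)" if "polynomial_function q" for b and q :: "'a \<Rightarrow> complex"
  proof
    fix x :: 'a
    have "(\<lambda>_. c) differentiable (at x)" by simp
    from partial_deriv_mult[OF this polynomial_differentiable[OF that], of b]
    show "partial_deriv b (\<lambda>x. c * q x) x = c * partial_deriv b q x" by simp
  qed
  show ?thesis using assms by (simp add: laplacian_def 1 polynomial_partial_deriv sum_distrib_left)
qed

lemma laplacian_coord_mult:
  fixes p :: "'a::euclidean_space \<Rightarrow> complex"
  assumes p: "polynomial_function p" and b: "b \<in> Basis"
  shows "laplacian (\<lambda>x. of_real (x \<bullet> b) * p x) x = 2 * partial_deriv b p x + of_real (x \<bullet> b) * laplacian p x"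
proof -
  have 1: "partial_deriv c (\<lambda>x. of_real (x \<bullet> b) * q x) = (\<lambda>x. of_real (c \<bullet> b) * q x + of_real (x \<bullet> b) * partial_deriv c q x)"
    if "polynomial_function q" for c and q :: "'a \<Rightarrow> complex"
    using that by (auto simp: partial_deriv_mult coord_differentiable polynomial_differentiable partial_deriv_coord)
  have "partial_deriv c (partial_deriv c (\<lambda>x. of_real (x \<bullet> b) * p x)) x =
     (if c = b then 2 * partial_deriv b p x else 0) + of_real (x \<bullet> b) * partial_deriv c (partial_deriv c p) x" if c: "c \<in> Basis" for c
  proof -
    have "partial_deriv c (partial_deriv c (\<lambda>x. of_real (x \<bullet> b) * p x)) x =
       partial_deriv c (\<lambda>x. of_real (c \<bullet> b) * p x) x + partial_deriv c (\<lambda>x. of_real (x \<bullet> b) * partial_deriv c p x) x"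
      unfolding 1[OF p]
      by (rule partial_deriv_add; intro polynomial_differentiable polynomial_function_complex_mult)
         (auto simp: p polynomial_partial_deriv)
    also have "partial_deriv c (\<lambda>x. of_real (c \<bullet> b) * p x) x = of_real (c \<bullet> b) * partial_deriv c p x"
      using partial_deriv_mult[of "\<lambda>_. of_real (c \<bullet> b)" x p c] polynomial_differentiable[OF p] by simp
    also have "partial_deriv c (\<lambda>x. of_real (x \<bullet> b) * partial_deriv c p x) x
       = of_real (c \<bullet> b) * partial_deriv c p x + of_real (x \<bullet> b) * partial_deriv c (partial_deriv c p) x"
      using 1[OF polynomial_partial_deriv[OF p, of c], of c] by simp
    finally show ?thesis using b c by (simp add: inner_Basis)
  qed
  then have "laplacian (\<lambda>x. of_real (x \<bullet> b) * p x) x =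
     (\<Sum>c\<in>Basis. (if c = b then 2 * partial_deriv b p x else 0) + of_real (x \<bullet> b) * partial_deriv c (partial_deriv c p) x)"
    unfolding laplacian_def by (intro sum.cong) auto
  then show ?thesis using b by (simp add: sum.distrib laplacian_def sum_distrib_left)
qed

lemma polynomial_function_inner_self:
  "polynomial_function (\<lambda>x::'a::euclidean_space. complex_of_real (x \<bullet> x))"
proof -
  have "complex_of_real (x \<bullet> x) = (\<Sum>b\<in>Basis. of_real (x \<bullet> b) * of_real (x \<bullet> b))" for x :: 'a
    by (subst euclidean_inner) simp
  moreover have "polynomial_function (\<lambda>x::'a. \<Sum>b\<in>Basis. complex_of_real (x \<bullet> b) * of_real (x \<bullet> b))"
    by (intro polynomial_function_sum polynomial_function_complex_mult) auto
  ultimately show ?thesis by simp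
qed

lemma laplacian_norm2_mult:
  fixes q :: "'a::euclidean_space \<Rightarrow> complex"
  assumes q: "polynomial_function q"
  shows "laplacian (\<lambda>x. of_real (x \<bullet> x) * q x) x =
    2 * of_nat DIM('a) * q x + 4 * (\<Sum>b\<in>Basis. of_real (x \<bullet> b) * partial_deriv b q x) + of_real (x \<bullet> x) * laplacian q x"
proof -
  note n2 = polynomial_function_inner_self[where 'a='a]
  have dn: "partial_deriv c (\<lambda>x::'a. complex_of_real (x \<bullet> x)) = (\<lambda>x. 2 * of_real (x \<bullet> c))" for c
  proof
    fix x :: 'a
    have "((\<lambda>x. complex_of_real (x \<bullet> x)) has_derivative (\<lambda>v. complex_of_real (x \<bullet> v + v \<bullet> x))) (at x)"
      by (auto intro!: derivative_eq_intros)
    from partial_deriv_eq[OF this] show "partial_deriv c (\<lambda>x::'a. complex_of_real (x \<bullet> x)) x = 2 * of_real (x \<bullet> c)"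
      by (simp add: inner_commute)
  qed
  have "partial_deriv c (partial_deriv c (\<lambda>x. of_real (x \<bullet> x) * q x)) x =
     2 * q x + 4 * (of_real (x \<bullet> c) * partial_deriv c q x) + of_real (x \<bullet> x) * partial_deriv c (partial_deriv c q) x" if c: "c \<in> Basis" for c
  proof -
    have "partial_deriv c (\<lambda>x. of_real (x \<bullet> x) * q x) = (\<lambda>x. (2 * of_real (x \<bullet> c)) * q x + of_real (x \<bullet> x) * partial_deriv c q x)"
      using q n2 by (auto simp: partial_deriv_mult polynomial_differentiable dn)
    then have "partial_deriv c (partial_deriv c (\<lambda>x. of_real (x \<bullet> x) * q x)) x =
       partial_deriv c (\<lambda>x. (2 * of_real (x \<bullet> c)) * q x) x + partial_deriv c (\<lambda>x. of_real (x \<bullet> x) * partial_deriv c q x) x"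
      by (simp only:) (rule partial_deriv_add; intro polynomial_differentiable polynomial_function_complex_mult;
         auto simp: q n2 polynomial_partial_deriv)
    also have "partial_deriv c (\<lambda>x. (2 * of_real (x \<bullet> c)) * q x) x = 2 * q x + 2 * of_real (x \<bullet> c) * partial_deriv c q x"
    proof -
      have 2: "polynomial_function (\<lambda>x::'a. 2 * complex_of_real (x \<bullet> c))"
        by (intro polynomial_function_complex_mult) auto
      have "partial_deriv c (\<lambda>x::'a. 2 * complex_of_real (x \<bullet> c)) x = 2"
        using partial_deriv_mult[of "\<lambda>_. 2" x "\<lambda>x::'a. complex_of_real (x \<bullet> c)" c] c
        by (simp add: coord_differentiable partial_deriv_coord)
      then show ?thesis using partial_deriv_mult[OF polynomial_differentiable[OF 2] polynomial_differentiable[OF q], of c x] by simp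
    qed
    also have "partial_deriv c (\<lambda>x. of_real (x \<bullet> x) * partial_deriv c q x) x =
       2 * of_real (x \<bullet> c) * partial_deriv c q x + of_real (x \<bullet> x) * partial_deriv c (partial_deriv c q) x"
      using partial_deriv_mult[OF polynomial_differentiable[OF n2] polynomial_differentiable[OF polynomial_partial_deriv[OF q, of c]], where b=c]
      by (simp add: dn)
    finally show ?thesis by simp
  qed
  then have "laplacian (\<lambda>x. of_real (x \<bullet> x) * q x) x = (\<Sum>c\<in>Basis. 2 * q x + 4 * (of_real (x \<bullet> c) * partial_deriv c q x)
     + of_real (x \<bullet> x) * partial_deriv c (partial_deriv c q) x)"
    unfolding laplacian_def by (intro sum.cong) auto
  then show ?thesis by (simp add: sum.distrib laplacian_def sum_distrib_left)
qed

subsection \<open>Homogeneous harmonics\<close>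

lemma laplacian_partial_deriv:
  assumes p: "polynomial_function p" and h: "\<And>x. laplacian p x = 0"
  shows "laplacian (partial_deriv b p) x = 0"
proof -
  have "laplacian (partial_deriv b p) x = (\<Sum>c\<in>Basis. partial_deriv b (partial_deriv c (partial_deriv c p)) x)"
    unfolding laplacian_def
    by (intro sum.cong refl)
       (simp add: polynomial_partial_deriv_commute[OF p, of _ b] polynomial_partial_deriv_commute[OF polynomial_partial_deriv[OF p], of _ b])
  also have "\<dots> = partial_deriv b (\<lambda>x. \<Sum>c\<in>Basis. partial_deriv c (partial_deriv c p) x) x"
    by (rule partial_deriv_sum[symmetric]) (auto intro!: polynomial_differentiable polynomial_partial_deriv p)
  also have "(\<lambda>x. \<Sum>c\<in>Basis. partial_deriv c (partial_deriv c p) x) = (\<lambda>_. 0)"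
    using h by (simp add: laplacian_def fun_eq_iff)
  finally show ?thesis by simp
qed

lemma homogeneous_harmonic_add:
  "homogeneous_harmonic n p \<Longrightarrow> homogeneous_harmonic n q \<Longrightarrow> homogeneous_harmonic n (\<lambda>x. p x + q x)"
  by (auto simp: homogeneous_harmonic_def laplacian_polynomial_add scaleR_add_right)

lemma homogeneous_harmonic_cmult:
  "homogeneous_harmonic n p \<Longrightarrow> homogeneous_harmonic n (\<lambda>x. c * p x)"
  by (auto simp: homogeneous_harmonic_def laplacian_polynomial_cmult polynomial_function_complex_mult)

lemma homogeneous_harmonic_const: "homogeneous_harmonic 0 (\<lambda>_. c)"
  by (simp add: homogeneous_harmonic_def laplacian_def)

lemma homogeneous_harmonic_coord: "homogeneous_harmonic 1 (\<lambda>x. complex_of_real (x \<bullet> e))"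
  by (auto simp: homogeneous_harmonic_def laplacian_def partial_deriv_coord scaleR_conv_of_real)

lemma homogeneous_harmonic_cnj:
  assumes "homogeneous_harmonic n p" shows "homogeneous_harmonic n (\<lambda>x. cnj (p x))"
proof -
  note p = homogeneous_harmonicD[OF assms]
  have 1: "partial_deriv b (\<lambda>x. cnj (q x)) = (\<lambda>x. cnj (partial_deriv b q x))" if "polynomial_function q" for b and q :: "'a \<Rightarrow> complex"
    using that by (auto simp: partial_deriv_cnj polynomial_differentiable)
  have "laplacian (\<lambda>x. cnj (p x)) x = cnj (laplacian p x)" for x
    using p(1) by (simp add: laplacian_def 1 polynomial_partial_deriv)
  then show ?thesis using p by (simp add: homogeneous_harmonic_def polynomial_function_cnj)
qed

lemma homogeneous_harmonic_partial_deriv: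
  assumes "homogeneous_harmonic (Suc n) p" shows "homogeneous_harmonic n (partial_deriv b p)"
proof -
  note p = homogeneous_harmonicD[OF assms]
  show ?thesis unfolding homogeneous_harmonic_def
    using polynomial_partial_deriv[OF p(1)] partial_deriv_homogeneous[OF p(1) p(2)] laplacian_partial_deriv[OF p(1) p(3)]
    by blast
qed

lemma homogeneous_harmonic_0:
  assumes "homogeneous_harmonic 0 p" shows "p x = p 0"
  using homogeneous_harmonicD(2)[OF assms, of 0 x] by simp

text \<open>
  A coordinate times a harmonic is in general not harmonic, but its Laplacian \<open>2 * partial_deriv b p\<close> is again
  harmonic, so a multiple of \<open>(x \<bullet> x) * partial_deriv b p\<close> corrects it.
\<close>

lemma homogeneous_harmonic_coord_mult:
  fixes p :: "'a::euclidean_space \<Rightarrow> complex"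
  assumes d: "2 \<le> DIM('a)" and hp: "homogeneous_harmonic (Suc n) p" and b: "b \<in> Basis"
  shows "homogeneous_harmonic (Suc (Suc n))
    (\<lambda>x. of_real (x \<bullet> b) * p x + of_real (x \<bullet> x) * (of_real (- 1 / (2 * real n + real DIM('a))) * partial_deriv b p x))"
proof -
  note p = homogeneous_harmonicD[OF hp]
  define c where "c = complex_of_real (- 1 / (2 * real n + real DIM('a)))"
  define q where "q = (\<lambda>x. c * partial_deriv b p x)"
  have hq: "homogeneous_harmonic n q"
    unfolding q_def by (intro homogeneous_harmonic_cmult homogeneous_harmonic_partial_deriv hp)
  note q = homogeneous_harmonicD[OF hq]
  note n2 = polynomial_function_inner_self[where 'a='a]
  have lap: "laplacian (\<lambda>x. of_real (x \<bullet> b) * p x + of_real (x \<bullet> x) * q x) x = 0" for x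
  proof -
    have "laplacian (\<lambda>x. of_real (x \<bullet> b) * p x + of_real (x \<bullet> x) * q x) x =
       laplacian (\<lambda>x. of_real (x \<bullet> b) * p x) x + laplacian (\<lambda>x. of_real (x \<bullet> x) * q x) x"
      by (intro laplacian_polynomial_add polynomial_function_complex_mult polynomial_function_coord n2 p(1) q(1))
    also have "\<dots> = 2 * partial_deriv b p x + (2 * of_nat DIM('a) * q x + 4 * (of_nat n * q x))"
      by (simp add: laplacian_coord_mult[OF p(1) b] laplacian_norm2_mult[OF q(1)] p(3) q(3) Euler_homogeneous[OF q(1) q(2)])
    also have "\<dots> = (2 + (2 * of_nat DIM('a) + 4 * of_nat n) * c) * partial_deriv b p x"
      by (simp add: q_def algebra_simps)
    also have "2 + (2 * of_nat DIM('a) + 4 * of_nat n) * c = 0"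
    proof -
      have "2 * real n + real DIM('a) \<noteq> 0" using d by linarith
      then have "2 + (2 * real DIM('a) + 4 * real n) * (- 1 / (2 * real n + real DIM('a))) = 0"
        by (simp add: field_simps)
      then have "complex_of_real (2 + (2 * real DIM('a) + 4 * real n) * (- 1 / (2 * real n + real DIM('a)))) = 0"
        by (simp only: of_real_0)
      then show ?thesis unfolding c_def by simp
    qed
    finally show ?thesis by simp
  qed
  have "polynomial_function (\<lambda>x. of_real (x \<bullet> b) * p x + of_real (x \<bullet> x) * q x)"
    by (intro polynomial_function_add polynomial_function_complex_mult polynomial_function_coord n2 p(1) q(1))
  moreover have "of_real ((t *\<^sub>R x) \<bullet> b) * p (t *\<^sub>R x) + of_real ((t *\<^sub>R x) \<bullet> (t *\<^sub>R x)) * q (t *\<^sub>R x)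
     = t ^ Suc (Suc n) *\<^sub>R (of_real (x \<bullet> b) * p x + of_real (x \<bullet> x) * q x)" for t x
    by (simp add: p(2) q(2) scaleR_conv_of_real algebra_simps)
  ultimately have "homogeneous_harmonic (Suc (Suc n)) (\<lambda>x. of_real (x \<bullet> b) * p x + of_real (x \<bullet> x) * q x)"
    using lap unfolding homogeneous_harmonic_def by blast
  then show ?thesis unfolding q_def c_def .
qed

lemma homogeneous_real_on_sphere:
  assumes hp: "homogeneous_harmonic n p" and r: "\<forall>x\<in>sphere 0 1. p x \<in> \<real>"
  shows "p x \<in> \<real>"
proof -
  obtain e :: 'a where e: "e \<in> Basis" using SOME_Basis by blast
  have "p x \<in> \<real>" if "x \<noteq> 0" for x
  proof -
    have "p (norm x *\<^sub>R (x /\<^sub>R norm x)) = norm x ^ n *\<^sub>R p (x /\<^sub>R norm x)"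
      by (rule homogeneous_harmonicD(2)[OF hp])
    moreover have "norm x *\<^sub>R (x /\<^sub>R norm x) = x" using that by simp
    moreover have "p (x /\<^sub>R norm x) \<in> \<real>" using r that by simp
    ultimately show ?thesis by (simp add: scaleR_conv_of_real)
  qed
  moreover have "p 0 \<in> \<real>"
  proof -
    have "p 0 = 0 ^ n *\<^sub>R p e" using homogeneous_harmonicD(2)[OF hp, of 0 e] by simp
    moreover have "p e \<in> \<real>" using r e by simp
    ultimately show ?thesis by (simp add: scaleR_conv_of_real)
  qed
  ultimately show ?thesis by metis
qed

lemma partial_deriv_real:
  assumes "polynomial_function p" "\<And>x. p x \<in> \<real>"
  shows "partial_deriv b p x \<in> \<real>"
proof -
  have "(\<lambda>x. cnj (p x)) = p" using assms(2) Reals_cnj_iff by blast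
  then have "cnj (partial_deriv b p x) = partial_deriv b p x"
    using partial_deriv_cnj[OF polynomial_differentiable[OF assms(1)], of b x] by simp
  then show ?thesis using Reals_cnj_iff by blast
qed

lemma spherical_harmonics_continuous:
  assumes "Y \<in> spherical_harmonics n" shows "continuous_on (sphere 0 1) Y"
proof -
  obtain p where p: "homogeneous_harmonic n p" "\<forall>x\<in>sphere 0 1. Y x = p x"
    using assms by (auto simp: spherical_harmonics_eq)
  have "continuous_on (sphere 0 1) p"
    using homogeneous_harmonicD(1)[OF p(1)] by (rule continuous_on_polymonial_function)
  then show ?thesis using p(2) continuous_on_cong[of "sphere 0 1" "sphere 0 1" Y p] by auto
qed

lemma spherical_harmonics_square_integrable:
  "Y \<in> spherical_harmonics n \<Longrightarrow> square_integrable Y"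
  by (intro square_integrable_continuous spherical_harmonics_continuous)

lemma spherical_harmonics_add:
  assumes "Y \<in> spherical_harmonics n" "Z \<in> spherical_harmonics n"
  shows "(\<lambda>x. Y x + Z x) \<in> spherical_harmonics n"
proof -
  obtain p q where pq: "homogeneous_harmonic n p" "homogeneous_harmonic n q"
    "\<forall>x\<in>sphere 0 1. Y x = p x" "\<forall>x\<in>sphere 0 1. Z x = q x"
    using assms by (auto simp: spherical_harmonics_eq)
  have "\<forall>x\<in>sphere 0 1. Y x + Z x = p x + q x" using pq by simp
  moreover have "sphere_valued (\<lambda>x. Y x + Z x)"
    using assms by (auto simp: spherical_harmonics_eq sphere_valued_def)
  ultimately show ?thesis
    unfolding spherical_harmonics_eq using homogeneous_harmonic_add[OF pq(1,2)] by blast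
qed

lemma spherical_harmonics_cmult:
  fixes Y :: "'a::euclidean_space \<Rightarrow> complex"
  assumes Y: "Y \<in> spherical_harmonics n" and c: "3 \<le> DIM('a) \<Longrightarrow> c \<in> \<real>"
  shows "(\<lambda>x. c * Y x) \<in> spherical_harmonics n"
proof -
  obtain p where p: "homogeneous_harmonic n p" "\<forall>x\<in>sphere 0 1. Y x = p x"
    using Y by (auto simp: spherical_harmonics_eq)
  have "\<forall>x\<in>sphere 0 1. c * Y x = c * p x" using p by simp
  moreover have "sphere_valued (\<lambda>x. c * Y x)"
    using Y c by (auto simp: spherical_harmonics_eq sphere_valued_def)
  ultimately show ?thesis
    unfolding spherical_harmonics_eq using homogeneous_harmonic_cmult[OF p(1)] by blast
qed

lemma spherical_harmonics_scaleR:
  "Y \<in> spherical_harmonics n \<Longrightarrow> (\<lambda>x. c *\<^sub>R Y x) \<in> spherical_harmonics n"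
  using spherical_harmonics_cmult[of Y n "of_real c"] by (simp add: scaleR_conv_of_real)

lemma spherical_harmonics_const:
  fixes c :: complex
  assumes "3 \<le> DIM('a::euclidean_space) \<Longrightarrow> c \<in> \<real>"
  shows "(\<lambda>_::'a. c) \<in> spherical_harmonics 0"
  using homogeneous_harmonic_const[of c] assms by (auto simp: spherical_harmonics_eq sphere_valued_def)

lemma spherical_harmonics_zero: "(\<lambda>_. 0) \<in> spherical_harmonics n"
proof -
  have "homogeneous_harmonic n (\<lambda>_. 0)" by (simp add: homogeneous_harmonic_def laplacian_def)
  then show ?thesis by (auto simp: spherical_harmonics_eq sphere_valued_def)
qed

text \<open>
  On the sphere the corrected product is a harmonic of degree \<open>n + 1\<close> and the correction itself is one of
  degree \<open>n - 1\<close>.  For \<open>n = 0\<close>, where \<open>n - 1\<close> is again \<open>0\<close>, the correction is \<open>0\<close>.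
\<close>

lemma spherical_harmonics_coord_mult:
  fixes Y :: "'a::euclidean_space \<Rightarrow> complex"
  assumes d: "2 \<le> DIM('a)" and Y: "Y \<in> spherical_harmonics n" and b: "b \<in> Basis"
  shows "\<exists>Z\<in>spherical_harmonics (Suc n). \<exists>W\<in>spherical_harmonics (n - 1). \<forall>x\<in>sphere 0 1. of_real (x \<bullet> b) * Y x = Z x + W x"
proof -
  obtain p where p: "homogeneous_harmonic n p" "\<forall>x\<in>sphere 0 1. Y x = p x"
    using Y by (auto simp: spherical_harmonics_eq)
  have Yr: "sphere_valued Y" using Y by (simp add: spherical_harmonics_eq)
  show ?thesis
  proof (cases n)
    case 0
    define c where "c = p 0"
    have c: "p x = c" for x using homogeneous_harmonic_0[of p] p(1) 0 by (simp add: c_def)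
    have "homogeneous_harmonic 1 (\<lambda>x::'a. c * of_real (x \<bullet> b))"
      by (rule homogeneous_harmonic_cmult[OF homogeneous_harmonic_coord])
    moreover have "sphere_valued (\<lambda>x. of_real (x \<bullet> b) * Y x)" using Yr by (auto simp: sphere_valued_def)
    moreover have "\<forall>x\<in>sphere 0 1. of_real (x \<bullet> b) * Y x = c * of_real (x \<bullet> b)" using p c by (simp add: mult.commute)
    ultimately have "(\<lambda>x. of_real (x \<bullet> b) * Y x) \<in> spherical_harmonics 1"
      unfolding spherical_harmonics_eq by blast
    then show ?thesis using 0 spherical_harmonics_zero[of "n - 1"] by force
  next
    case (Suc m)
    define a where "a = - 1 / (2 * real m + real DIM('a))"
    define q where "q = (\<lambda>x. partial_deriv b p x)"
    have hp: "homogeneous_harmonic (Suc m) p" using p(1) Suc by simp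
    have hq: "homogeneous_harmonic m q" unfolding q_def by (rule homogeneous_harmonic_partial_deriv[OF hp])
    have qr: "sphere_valued q"
      unfolding sphere_valued_def
    proof (intro impI ballI)
      fix x :: 'a assume "3 \<le> DIM('a)"
      then have "\<forall>x\<in>sphere 0 1. p x \<in> \<real>" using Yr p(2) by (auto simp: sphere_valued_def)
      then have "\<And>x. p x \<in> \<real>" using homogeneous_real_on_sphere[OF hp] by blast
      then show "q x \<in> \<real>" unfolding q_def by (intro partial_deriv_real homogeneous_harmonicD(1)[OF hp])
    qed
    let ?Z = "\<lambda>x. of_real (x \<bullet> b) * p x + of_real (x \<bullet> x) * (of_real a * q x)"
    let ?W = "\<lambda>x. of_real (- a) * q x"
    have "homogeneous_harmonic (Suc (Suc m)) ?Z"
      using homogeneous_harmonic_coord_mult[OF d hp b] by (simp add: a_def q_def)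
    moreover have "sphere_valued ?Z" using Yr qr p(2) by (auto simp: sphere_valued_def)
    ultimately have Z: "?Z \<in> spherical_harmonics (Suc n)" unfolding spherical_harmonics_eq Suc by blast
    have "homogeneous_harmonic m ?W" by (rule homogeneous_harmonic_cmult[OF hq])
    moreover have "sphere_valued ?W" using qr by (auto simp: sphere_valued_def)
    ultimately have W: "?W \<in> spherical_harmonics (n - 1)" unfolding spherical_harmonics_eq using Suc by auto
    have "of_real (x \<bullet> b) * Y x = ?Z x + ?W x" if "x \<in> sphere 0 1" for x
    proof -
      have "x \<bullet> x = 1" using that by (simp add: dot_square_norm)
      then show ?thesis using p(2) that by simp
    qed
    then show ?thesis by (intro bexI[OF _ Z] bexI[OF _ W] ballI)
  qed
qed

subsection \<open>Multiplication by a linear function\<close>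

lemma square_integrable_coord_mult:
  assumes "square_integrable f" shows "square_integrable (\<lambda>x. of_real (x \<bullet> e) * f x)"
proof (rule square_integrable_dom[OF assms, of _ "norm e"])
  have "(\<lambda>x. complex_of_real (x \<bullet> e)) \<in> borel_measurable sphere_measure"
    by (intro continuous_on_sphere_measurable continuous_intros)
  then show "(\<lambda>x. of_real (x \<bullet> e) * f x) \<in> borel_measurable sphere_measure"
    using square_integrableD[OF assms] by measurable
  fix x :: 'a assume "norm x = 1"
  then have "\<bar>x \<bullet> e\<bar> \<le> norm e" using Cauchy_Schwarz_ineq2[of x e] by simp
  then show "norm (of_real (x \<bullet> e) * f x) \<le> norm e * norm (f x)"
    by (simp add: norm_mult mult_right_mono)
qed

text \<open>
  This operator carries all integrals with the weight \<open>x \<bullet> e\<close>.  It is self-adjoint, and of norm at most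
  \<open>1\<close> for a unit vector \<open>e\<close>.
\<close>

lift_definition coord_mult :: "'a::euclidean_space \<Rightarrow> 'a sphere_l2 \<Rightarrow> 'a sphere_l2" is
  "\<lambda>e f x. of_real (x \<bullet> e) * f x"
  by (safe intro!: square_integrable_coord_mult) simp_all

lemma coord_mult_cls: "square_integrable f \<Longrightarrow> coord_mult e (cls f) = cls (\<lambda>x. of_real (x \<bullet> e) * f x)"
  by (simp add: coord_mult.abs_eq)

lemma linear_coord_mult: "linear (coord_mult e)"
proof
  fix F G :: "'a sphere_l2" and c :: real
  show "coord_mult e (F + G) = coord_mult e F + coord_mult e G"
    by transfer (simp add: square_integrable_coord_mult square_integrable_add distrib_left)
  show "coord_mult e (c *\<^sub>R F) = c *\<^sub>R coord_mult e F"
    by transfer (simp add: square_integrable_coord_mult square_integrable_scaleR)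
qed

lemma coord_mult_inner: "coord_mult e F \<bullet> G = F \<bullet> coord_mult e G"
  by transfer (simp add: inner_complex_def algebra_simps)

lemma norm_coord_mult_le: "norm (coord_mult e F) \<le> norm e * norm F"
proof -
  obtain f where f: "square_integrable f" "F = cls f" by (rule cls_cases)
  have "norm (coord_mult e F) \<le> norm (cls (\<lambda>x. norm e *\<^sub>R f x))"
    unfolding f(2) coord_mult_cls[OF f(1)]
  proof (rule norm_cls_le)
    fix x :: 'a assume "norm x = 1"
    then have "\<bar>x \<bullet> e\<bar> \<le> norm e" using Cauchy_Schwarz_ineq2[of x e] by simp
    then show "norm (of_real (x \<bullet> e) * f x) \<le> norm (norm e *\<^sub>R f x)"
      by (simp add: norm_mult mult_right_mono)
  qed (use f in \<open>auto intro: square_integrable_coord_mult square_integrable_scaleR\<close>)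
  then show ?thesis by (simp add: cls_scaleR f)
qed

lemma bounded_linear_coord_mult: "bounded_linear (coord_mult e)"
  unfolding bounded_linear_def bounded_linear_axioms_def
  using linear_coord_mult norm_coord_mult_le by (metis mult.commute)

subsection \<open>Homogeneous polynomials of a fixed degree are finite-dimensional\<close>

text \<open>
  Orthogonal projections onto the harmonics of degree \<open>n\<close> exist because these lie in a space of finite
  dimension.  Building homogeneous polynomials up by one coordinate at a time gives the spanning sets by
  induction on the degree.
\<close>

inductive homogeneous_polynomial :: "nat \<Rightarrow> ('a::euclidean_space \<Rightarrow> complex) \<Rightarrow> bool" where
  const: "homogeneous_polynomial 0 (\<lambda>_. c)"
| coord: "homogeneous_polynomial n p \<Longrightarrow> b \<in> Basis \<Longrightarrow> homogeneous_polynomial (Suc n) (\<lambda>x. of_real (x \<bullet> b) * p x)"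
| zero: "homogeneous_polynomial n (\<lambda>_. 0)"
| add: "homogeneous_polynomial n p \<Longrightarrow> homogeneous_polynomial n q \<Longrightarrow> homogeneous_polynomial n (\<lambda>x. p x + q x)"

lemma homogeneous_polynomial_cmult:
  "homogeneous_polynomial n p \<Longrightarrow> homogeneous_polynomial n (\<lambda>x. c * p x)"
proof (induction rule: homogeneous_polynomial.induct)
  case (coord n p b)
  from homogeneous_polynomial.coord[OF coord.IH coord.hyps(2)] show ?case by (simp add: mult.left_commute)
qed (auto simp: distrib_left intro: homogeneous_polynomial.intros)

lemma homogeneous_polynomial_continuous: "homogeneous_polynomial n p \<Longrightarrow> continuous_on S p"
  by (induction rule: homogeneous_polynomial.induct) (auto intro!: continuous_intros)

lemma homogeneous_polynomial_scale: "homogeneous_polynomial n p \<Longrightarrow> p (t *\<^sub>R x) = t ^ n *\<^sub>R p x"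
  by (induction rule: homogeneous_polynomial.induct) (auto simp: algebra_simps scaleR_conv_of_real)

text \<open>
  The step applies the operators \<open>coord_mult b\<close> to a spanning set for the previous degree.
\<close>

lemma homogeneous_polynomial_span:
  "\<exists>B :: 'a::euclidean_space sphere_l2 set. finite B \<and> (\<forall>p. homogeneous_polynomial n p \<longrightarrow> cls p \<in> span B)"
proof (induction n)
  case 0
  have "cls p \<in> span {cls (\<lambda>_. 1), cls (\<lambda>_. \<i>)}" if "homogeneous_polynomial 0 p" for p :: "'a \<Rightarrow> complex"
    using that
  proof (induction "0 :: nat" p rule: homogeneous_polynomial.induct)
    case (const c)
    have c: "c = Re c *\<^sub>R 1 + Im c *\<^sub>R \<i>" by (auto simp: complex_eq_iff)
    have "cls (\<lambda>_::'a. c) = cls (\<lambda>_. Re c *\<^sub>R 1 + Im c *\<^sub>R \<i>)" by (subst c) (rule refl)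
    also have "\<dots> = Re c *\<^sub>R cls (\<lambda>_. 1) + Im c *\<^sub>R cls (\<lambda>_. \<i>)"
      by (simp only: cls_add cls_scaleR square_integrable_scaleR square_integrable_const)
    finally have "cls (\<lambda>_::'a. c) = Re c *\<^sub>R cls (\<lambda>_. 1) + Im c *\<^sub>R cls (\<lambda>_. \<i>)" .
    then show ?case by (simp only:) (intro span_add span_scale span_base; simp)
  next
    case zero show ?case by (simp add: cls_zero span_zero)
  next
    case (add p q)
    then show ?case
      by (simp add: cls_add square_integrable_continuous homogeneous_polynomial_continuous span_add)
  qed
  then show ?case by (intro exI[of _ "{cls (\<lambda>_. 1), cls (\<lambda>_. \<i>)}"]) simp
next
  case (Suc n)
  then obtain B :: "'a sphere_l2 set" where B: "finite B" "\<And>p. homogeneous_polynomial n p \<Longrightarrow> cls p \<in> span B" by blast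
  define B' where "B' = (\<Union>b\<in>Basis. coord_mult b ` B)"
  have "cls p \<in> span B'" if "homogeneous_polynomial (Suc n) p" for p
    using that
  proof (induction "Suc n" p rule: homogeneous_polynomial.induct)
    case (coord p b)
    have "cls (\<lambda>x. of_real (x \<bullet> b) * p x) = coord_mult b (cls p)"
      using coord by (simp add: coord_mult_cls square_integrable_continuous homogeneous_polynomial_continuous)
    also have "\<dots> \<in> coord_mult b ` span B" using B(2) coord by blast
    also have "\<dots> = span (coord_mult b ` B)" by (rule linear_span_image[OF linear_coord_mult, symmetric])
    also have "\<dots> \<subseteq> span B'" using coord by (intro span_mono) (auto simp: B'_def)
    finally show ?case .
  next
    case zero show ?case by (simp add: cls_zero span_zero)
  next
    case (add p q)
    then show ?case
      by (simp add: cls_add square_integrable_continuous homogeneous_polynomial_continuous span_add)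
  qed
  moreover have "finite B'" using B(1) by (simp add: B'_def)
  ultimately show ?case by blast
qed

text \<open>
  Sums of homogeneous parts.  The parts are indexed by all degrees, with zeros beyond \<open>N\<close>, so that two such
  sums can be added part by part.
\<close>

definition graded :: "('a::euclidean_space \<Rightarrow> complex) \<Rightarrow> bool" where
  "graded p \<longleftrightarrow> (\<exists>N a. (\<forall>k. homogeneous_polynomial k (a k)) \<and> (\<forall>k>N. a k = (\<lambda>_. 0)) \<and> (\<forall>x. p x = (\<Sum>k\<le>N. a k x)))"

lemma graded_const: "graded (\<lambda>_. c)"
  unfolding graded_def
  by (intro exI[of _ 0] exI[of _ "\<lambda>k. if k = 0 then (\<lambda>_. c) else (\<lambda>_. 0)"])
     (auto intro: homogeneous_polynomial.intros)

lemma graded_add: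
  assumes "graded p" "graded q" shows "graded (\<lambda>x. p x + q x)"
proof -
  obtain N a where a: "\<And>k. homogeneous_polynomial k (a k)" "\<And>k. k > N \<Longrightarrow> a k = (\<lambda>_. 0)" "\<And>x. p x = (\<Sum>k\<le>N. a k x)"
    using assms(1) by (auto simp: graded_def)
  obtain M c where c: "\<And>k. homogeneous_polynomial k (c k)" "\<And>k. k > M \<Longrightarrow> c k = (\<lambda>_. 0)" "\<And>x. q x = (\<Sum>k\<le>M. c k x)"
    using assms(2) by (auto simp: graded_def)
  have 1: "p x = (\<Sum>k\<le>max N M. a k x)" for x
    unfolding a(3) by (rule sum.mono_neutral_left) (auto simp: a(2))
  have 2: "q x = (\<Sum>k\<le>max N M. c k x)" for x
    unfolding c(3) by (rule sum.mono_neutral_left) (auto simp: c(2))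
  show ?thesis unfolding graded_def
  proof (intro exI[of _ "max N M"] exI[of _ "\<lambda>k x. a k x + c k x"] conjI allI impI)
    show "homogeneous_polynomial k (\<lambda>x. a k x + c k x)" for k by (intro homogeneous_polynomial.add a c)
    show "(\<lambda>x. a k x + c k x) = (\<lambda>_. 0)" if "max N M < k" for k using that by (simp add: a(2) c(2))
    show "p x + q x = (\<Sum>k\<le>max N M. a k x + c k x)" for x by (simp add: 1 2 sum.distrib)
  qed
qed

lemma graded_coord:
  assumes "graded p" "b \<in> Basis" shows "graded (\<lambda>x. of_real (x \<bullet> b) * p x)"
proof -
  obtain N a where a: "\<And>k. homogeneous_polynomial k (a k)" "\<And>k. k > N \<Longrightarrow> a k = (\<lambda>_. 0)" "\<And>x. p x = (\<Sum>k\<le>N. a k x)"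
    using assms(1) by (auto simp: graded_def)
  define c where "c = (\<lambda>k. case k of 0 \<Rightarrow> (\<lambda>_. 0) | Suc j \<Rightarrow> (\<lambda>x. of_real (x \<bullet> b) * a j x))"
  show ?thesis unfolding graded_def
  proof (intro exI[of _ "Suc N"] exI[of _ c] conjI allI impI)
    show "homogeneous_polynomial k (c k)" for k
      using assms(2) a(1) by (cases k) (auto simp: c_def intro: homogeneous_polynomial.intros)
    show "c k = (\<lambda>_. 0)" if "Suc N < k" for k using that by (cases k) (auto simp: c_def a(2))
    show "of_real (x \<bullet> b) * p x = (\<Sum>k\<le>Suc N. c k x)" for x
      unfolding sum.atMost_Suc_shift by (simp add: c_def a(3) sum_distrib_left)
  qed
qed

lemma graded_cmult:
  assumes "graded p" shows "graded (\<lambda>x. c * p x)"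
proof -
  obtain N a where a: "\<And>k. homogeneous_polynomial k (a k)" "\<And>k. k > N \<Longrightarrow> a k = (\<lambda>_. 0)" "\<And>x. p x = (\<Sum>k\<le>N. a k x)"
    using assms(1) by (auto simp: graded_def)
  show ?thesis unfolding graded_def
    by (intro exI[of _ N] exI[of _ "\<lambda>k x. c * a k x"])
       (auto simp: a(2,3) sum_distrib_left intro!: homogeneous_polynomial_cmult a(1))
qed

text \<open>
  Multiplication by a fixed polynomial preserves graded sums, which is proved for the generators of
  the polynomial ring first; applying it to the constant \<open>1\<close> splits the polynomial.
\<close>

lemma polynomial_graded:
  fixes p :: "'a::euclidean_space \<Rightarrow> complex"
  assumes "polynomial_function p" shows "graded p"
proof -
  have "\<forall>q. graded q \<longrightarrow> graded (\<lambda>x. p x * q x)"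
    using assms
  proof (induction p rule: complex_polynomial_induct)
    case (add p q)
    then show ?case by (simp add: distrib_right graded_add)
  next
    case (mult p q)
    then show ?case by (simp add: mult.assoc)
  qed (simp_all add: graded_cmult graded_coord)
  from this[rule_format, OF graded_const[of 1]] show ?thesis by simp
qed

text \<open>
  Both sides of \<open>p (t *\<^sub>R x) = t ^ n *\<^sub>R p x\<close> are polynomials in \<open>t\<close>; comparing coefficients leaves only
  the part of degree \<open>n\<close>.
\<close>

lemma homogeneous_harmonic_imp_homogeneous_polynomial:
  fixes p :: "'a::euclidean_space \<Rightarrow> complex"
  assumes "homogeneous_harmonic n p" shows "homogeneous_polynomial n p"
proof -
  note p = homogeneous_harmonicD[OF assms]
  obtain N a where a: "\<And>k. homogeneous_polynomial k (a k)" "\<And>k. k > N \<Longrightarrow> a k = (\<lambda>_. 0)" "\<And>x. p x = (\<Sum>k\<le>N. a k x)"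
    using polynomial_graded[OF p(1)] by (auto simp: graded_def)
  have "p x = a n x" for x
  proof -
    have eq: "(\<Sum>k\<le>max n N. t ^ k *\<^sub>R a k x) = (\<Sum>k\<le>max n N. t ^ k *\<^sub>R (if k = n then p x else 0))" for t :: real
    proof -
      have "(\<Sum>k\<le>max n N. t ^ k *\<^sub>R a k x) = (\<Sum>k\<le>N. t ^ k *\<^sub>R a k x)"
        by (rule sum.mono_neutral_right) (auto simp: a(2))
      also have "\<dots> = p (t *\<^sub>R x)"
        unfolding a(3) by (intro sum.cong refl) (simp add: homogeneous_polynomial_scale[OF a(1)])
      also have "\<dots> = t ^ n *\<^sub>R p x" by (rule p(2))
      also have "\<dots> = (\<Sum>k\<le>max n N. if k = n then t ^ k *\<^sub>R p x else 0)" by simp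
      also have "\<dots> = (\<Sum>k\<le>max n N. t ^ k *\<^sub>R (if k = n then p x else 0))" by (rule sum.cong) auto
      finally show ?thesis .
    qed
    have "\<forall>t. (\<Sum>k\<le>max n N. Re (a k x) * t ^ k) = (\<Sum>k\<le>max n N. Re (if k = n then p x else 0) * t ^ k)"
      using arg_cong[OF eq, of Re] by (simp add: mult.commute)
    then have "Re (a n x) = Re (p x)" unfolding polyfun_eq_coeffs by auto
    moreover have "\<forall>t. (\<Sum>k\<le>max n N. Im (a k x) * t ^ k) = (\<Sum>k\<le>max n N. Im (if k = n then p x else 0) * t ^ k)"
      using arg_cong[OF eq, of Im] by (simp add: mult.commute)
    then have "Im (a n x) = Im (p x)" unfolding polyfun_eq_coeffs by auto
    ultimately show ?thesis by (simp add: complex_eq_iff)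
  qed
  then have "p = a n" by (rule ext)
  then show ?thesis using a(1) by simp
qed

subsection \<open>The spaces of spherical harmonics\<close>

definition harmonic_space :: "nat \<Rightarrow> 'a::euclidean_space sphere_l2 set" where
  "harmonic_space n = cls ` spherical_harmonics n"

lemma subspace_harmonic_space: "subspace (harmonic_space n)"
  unfolding harmonic_space_def
proof (rule subspaceI)
  show "0 \<in> cls ` spherical_harmonics n"
    by (rule image_eqI[where x="\<lambda>_. 0"]) (simp_all add: cls_zero spherical_harmonics_zero)
  fix F G :: "'a sphere_l2" assume "F \<in> cls ` spherical_harmonics n" "G \<in> cls ` spherical_harmonics n"
  then obtain Y Z where YZ: "Y \<in> spherical_harmonics n" "Z \<in> spherical_harmonics n" "F = cls Y" "G = cls Z" by blast
  show "F + G \<in> cls ` spherical_harmonics n"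
    by (rule image_eqI[where x="\<lambda>x. Y x + Z x"])
       (simp_all add: YZ spherical_harmonics_add cls_add spherical_harmonics_square_integrable[OF YZ(1)]
         spherical_harmonics_square_integrable[OF YZ(2)])
next
  fix c :: real and F :: "'a sphere_l2" assume "F \<in> cls ` spherical_harmonics n"
  then obtain Y where Y: "Y \<in> spherical_harmonics n" "F = cls Y" by blast
  show "c *\<^sub>R F \<in> cls ` spherical_harmonics n"
    by (rule image_eqI[where x="\<lambda>x. c *\<^sub>R Y x"])
       (simp_all add: Y(2) spherical_harmonics_scaleR[OF Y(1)] cls_scaleR[OF spherical_harmonics_square_integrable[OF Y(1)]])
qed

lemma harmonic_space_finite_span: "\<exists>B. finite B \<and> harmonic_space n \<subseteq> span (B :: 'a::euclidean_space sphere_l2 set)"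
proof -
  obtain B :: "'a sphere_l2 set" where B: "finite B" "\<And>p. homogeneous_polynomial n p \<Longrightarrow> cls p \<in> span B"
    using homogeneous_polynomial_span[of n] by blast
  have "cls Y \<in> span B" if Y: "Y \<in> spherical_harmonics n" for Y
  proof -
    obtain p where p: "homogeneous_harmonic n p" "\<forall>x\<in>sphere 0 1. Y x = p x"
      using Y by (auto simp: spherical_harmonics_eq)
    have "cls Y = cls p"
      by (rule cls_cong) (use p Y in \<open>auto intro: spherical_harmonics_square_integrable square_integrable_continuous
         homogeneous_polynomial_continuous homogeneous_harmonic_imp_homogeneous_polynomial\<close>)
    then show ?thesis using B(2) homogeneous_harmonic_imp_homogeneous_polynomial[OF p(1)] by simp
  qed
  then show ?thesis using B(1) by (auto simp: harmonic_space_def)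
qed

section \<open>Green's identity on the sphere\<close>

lemma has_derivative_inverse_norm_power:
  fixes x :: "'a::euclidean_space"
  assumes "x \<noteq> 0"
  shows "((\<lambda>x. inverse (norm x) ^ k) has_derivative (\<lambda>v. - real k * inverse (norm x) ^ (k + 2) * (x \<bullet> v))) (at x)"
proof -
  have n: "(norm has_derivative (\<lambda>v. v \<bullet> sgn x)) (at x)"
    by (rule has_derivative_norm[OF assms])
  have "((\<lambda>x. inverse (norm x) ^ k) has_derivative
     (\<lambda>v. of_nat k * (- (inverse (norm x) * (v \<bullet> sgn x) * inverse (norm x))) * inverse (norm x) ^ (k - 1))) (at x)"
    by (intro has_derivative_power Deriv.has_derivative_inverse n) (use assms in simp)
  moreover have "(\<lambda>v. of_nat k * (- (inverse (norm x) * (v \<bullet> sgn x) * inverse (norm x))) * inverse (norm x) ^ (k - 1))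
     = (\<lambda>v. - real k * inverse (norm x) ^ (k + 2) * (x \<bullet> v))"
    by (rule ext, cases k) (simp_all add: sgn_div_norm inner_commute[of _ x] divide_inverse power2_eq_square algebra_simps)
  ultimately show ?thesis by (simp only:)
qed

lemma radial_extension_homogeneous:
  "t > 0 \<Longrightarrow> radial_extension u (t *\<^sub>R x) = radial_extension u x"
proof -
  assume t: "t > 0"
  then have "inverse t * inverse (norm x) * t = inverse (norm x)" by simp
  then have "u ((inverse t * inverse (norm x) * t) *\<^sub>R x) = u (x /\<^sub>R norm x)" by (simp only:)
  then show ?thesis using t by (simp add: radial_extension_def)
qed

lemma radial_extension_sphere: "norm x = 1 \<Longrightarrow> radial_extension u x = u x"
  by (simp add: radial_extension_def)

lemma partial_deriv_radial_extension:
  fixes u :: "'a::euclidean_space \<Rightarrow> complex"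
  assumes u: "\<And>x. x \<noteq> 0 \<Longrightarrow> radial_extension u differentiable (at x)" and x: "x \<noteq> 0"
  shows "partial_deriv b (radial_extension u) x = inverse (norm x) *\<^sub>R partial_deriv b (radial_extension u) (x /\<^sub>R norm x)"
proof -
  define t where "t = inverse (norm x)"
  have t: "t > 0" using x by (simp add: t_def)
  obtain F' where F': "(radial_extension u has_derivative F') (at (t *\<^sub>R x))"
    using u[of "t *\<^sub>R x"] x t by (auto simp: differentiable_def)
  have "((\<lambda>y. radial_extension u (t *\<^sub>R y)) has_derivative (\<lambda>v. F' (t *\<^sub>R v))) (at x)"
    by (rule has_derivative_compose[where f="\<lambda>y. t *\<^sub>R y"]) (auto intro!: derivative_eq_intros F')
  then have "(radial_extension u has_derivative (\<lambda>v. F' (t *\<^sub>R v))) (at x)"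
    by (simp add: radial_extension_homogeneous[OF t])
  then have "partial_deriv b (radial_extension u) x = F' (t *\<^sub>R b)" by (rule partial_deriv_eq)
  also have "\<dots> = t *\<^sub>R partial_deriv b (radial_extension u) (t *\<^sub>R x)"
    by (simp add: linear_cmul[OF has_derivative_linear[OF F']] partial_deriv_eq[OF F'])
  finally show ?thesis by (simp add: t_def)
qed

lemma sphere_C1D:
  assumes "u \<in> sphere_C1"
  shows "x \<noteq> 0 \<Longrightarrow> radial_extension u differentiable (at x)"
    "b \<in> Basis \<Longrightarrow> continuous_on (- {0}) (partial_deriv b (radial_extension u))" "sphere_valued u"
  using assms by (auto simp: sphere_C1_def)

lemma sphere_C1_continuous:
  fixes u :: "'a::euclidean_space \<Rightarrow> complex"
  assumes "u \<in> sphere_C1"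
  shows "continuous_on (- {0}) (radial_extension u)" "continuous_on (sphere 0 1) u"
    "b \<in> Basis \<Longrightarrow> continuous_on (sphere 0 1) (partial_deriv b (radial_extension u))"
proof -
  show 1: "continuous_on (- {0}) (radial_extension u)"
    using sphere_C1D(1)[OF assms] by (auto intro!: continuous_at_imp_continuous_on differentiable_imp_continuous_within)
  have s: "sphere 0 1 \<subseteq> - {0 :: 'a}" by auto
  have "continuous_on (sphere 0 1) (radial_extension u)" using continuous_on_subset[OF 1 s] .
  then show "continuous_on (sphere 0 1) u"
    by (subst (asm) continuous_on_cong[of _ "sphere 0 1" _ u]) (auto simp: radial_extension_sphere)
  show "b \<in> Basis \<Longrightarrow> continuous_on (sphere 0 1) (partial_deriv b (radial_extension u))"
    using continuous_on_subset[OF sphere_C1D(2)[OF assms] s] by blast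
qed

text \<open>The partial derivatives of \<open>p (x / norm x)\<close>, for a homogeneous \<open>p\<close> of degree \<open>n\<close>.\<close>

definition radial_gradient :: "nat \<Rightarrow> ('a::euclidean_space \<Rightarrow> complex) \<Rightarrow> 'a \<Rightarrow> 'a \<Rightarrow> complex" where
  "radial_gradient n p b x = inverse (norm x) ^ n *\<^sub>R partial_deriv b p x
     - (real n * inverse (norm x) ^ (n + 2) * (x \<bullet> b)) *\<^sub>R p x"

lemma polynomial_has_derivative:
  fixes p :: "'a::euclidean_space \<Rightarrow> complex"
  assumes "polynomial_function p"
  shows "(p has_derivative (\<lambda>v. \<Sum>b\<in>Basis. (v \<bullet> b) *\<^sub>R partial_deriv b p x)) (at x)"
  by (rule differentiable_has_partials[OF polynomial_differentiable[OF assms]])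

lemma radial_extension_harmonic_has_derivative:
  fixes p :: "'a::euclidean_space \<Rightarrow> complex"
  assumes p: "homogeneous_harmonic n p" and Y: "\<forall>x\<in>sphere 0 1. Y x = p x" and x: "x \<noteq> 0"
  shows "(radial_extension Y has_derivative (\<lambda>v. inverse (norm x) ^ n *\<^sub>R (\<Sum>b\<in>Basis. (v \<bullet> b) *\<^sub>R partial_deriv b p x)
     + (- real n * inverse (norm x) ^ (n + 2) * (x \<bullet> v)) *\<^sub>R p x)) (at x)"
proof -
  note P = homogeneous_harmonicD[OF p]
  have D: "((\<lambda>x. inverse (norm x) ^ n *\<^sub>R p x) has_derivative (\<lambda>v. inverse (norm x) ^ n *\<^sub>R (\<Sum>b\<in>Basis. (v \<bullet> b) *\<^sub>R partial_deriv b p x)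
     + (- real n * inverse (norm x) ^ (n + 2) * (x \<bullet> v)) *\<^sub>R p x)) (at x)"
    by (rule has_derivative_scaleR[OF has_derivative_inverse_norm_power[OF x] polynomial_has_derivative[OF P(1)]])
  have eq: "inverse (norm y) ^ n *\<^sub>R p y = radial_extension Y y" if "y \<in> - {0}" for y
  proof -
    have "y /\<^sub>R norm y \<in> sphere 0 1" using that by simp
    then show ?thesis using Y by (simp add: radial_extension_def P(2))
  qed
  show ?thesis
    by (rule has_derivative_transform_within_open[OF D _ _ eq, of "- {0}"]) (use x in auto)
qed

lemma partial_deriv_radial_harmonic:
  fixes p :: "'a::euclidean_space \<Rightarrow> complex"
  assumes p: "homogeneous_harmonic n p" and Y: "\<forall>x\<in>sphere 0 1. Y x = p x" and x: "x \<noteq> 0" and b: "b \<in> Basis"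
  shows "partial_deriv b (radial_extension Y) x = radial_gradient n p b x"
proof -
  have "(\<Sum>c\<in>Basis. (b \<bullet> c) *\<^sub>R partial_deriv c p x) = (\<Sum>c\<in>Basis. if c = b then partial_deriv b p x else 0)"
    by (rule sum.cong) (use b in \<open>auto simp: inner_Basis\<close>)
  also have "\<dots> = partial_deriv b p x" using b by simp
  finally show ?thesis
    unfolding partial_deriv_eq[OF radial_extension_harmonic_has_derivative[OF p Y x]] by (simp add: radial_gradient_def)
qed

lemma spherical_harmonics_C1:
  fixes Y :: "'a::euclidean_space \<Rightarrow> complex"
  assumes "Y \<in> spherical_harmonics n" shows "Y \<in> sphere_C1"
proof -
  obtain p where p: "homogeneous_harmonic n p" "\<forall>x\<in>sphere 0 1. Y x = p x"
    using assms by (auto simp: spherical_harmonics_eq)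
  have "continuous_on (- {0}) (partial_deriv b (radial_extension Y))" if b: "b \<in> Basis" for b
  proof -
    have "continuous_on (- {0}) (radial_gradient n p b)"
      unfolding radial_gradient_def
      using homogeneous_harmonicD(1)[OF p(1)]
      by (intro continuous_intros continuous_on_polymonial_function polynomial_partial_deriv) auto
    then show ?thesis
      by (subst continuous_on_cong[of _ "- {0}" _ "radial_gradient n p b"])
         (auto simp: partial_deriv_radial_harmonic[OF p _ b])
  qed
  moreover have "radial_extension Y differentiable (at x)" if "x \<noteq> 0" for x
    using radial_extension_harmonic_has_derivative[OF p that] by (auto simp: differentiable_def)
  ultimately show ?thesis using assms by (auto simp: sphere_C1_def spherical_harmonics_eq)
qed

text \<open>
  The derivative of \<open>radial_gradient n p b\<close> at \<open>x\<close> in the direction \<open>v\<close>.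
\<close>

definition radial_hessian :: "nat \<Rightarrow> ('a::euclidean_space \<Rightarrow> complex) \<Rightarrow> 'a \<Rightarrow> 'a \<Rightarrow> 'a \<Rightarrow> complex" where
  "radial_hessian n p b x v =
     (inverse (norm x) ^ n *\<^sub>R (\<Sum>c\<in>Basis. (v \<bullet> c) *\<^sub>R partial_deriv c (partial_deriv b p) x)
        + (- real n * inverse (norm x) ^ (n + 2) * (x \<bullet> v)) *\<^sub>R partial_deriv b p x)
     - ((real n * inverse (norm x) ^ (n + 2) * (x \<bullet> b)) *\<^sub>R (\<Sum>c\<in>Basis. (v \<bullet> c) *\<^sub>R partial_deriv c p x)
        + (real n * inverse (norm x) ^ (n + 2) * (v \<bullet> b)
           + real n * (- real (n + 2) * inverse (norm x) ^ (n + 2 + 2) * (x \<bullet> v)) * (x \<bullet> b)) *\<^sub>R p x)"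

lemma radial_gradient_has_derivative:
  fixes p :: "'a::euclidean_space \<Rightarrow> complex"
  assumes p: "polynomial_function p" and x: "x \<noteq> 0"
  shows "(radial_gradient n p b has_derivative radial_hessian n p b x) (at x)"
proof -
  have 1: "((\<lambda>x. inverse (norm x) ^ n *\<^sub>R partial_deriv b p x) has_derivative
     (\<lambda>v. inverse (norm x) ^ n *\<^sub>R (\<Sum>c\<in>Basis. (v \<bullet> c) *\<^sub>R partial_deriv c (partial_deriv b p) x)
        + (- real n * inverse (norm x) ^ (n + 2) * (x \<bullet> v)) *\<^sub>R partial_deriv b p x)) (at x)"
    by (rule has_derivative_scaleR[OF has_derivative_inverse_norm_power[OF x] polynomial_has_derivative[OF polynomial_partial_deriv[OF p]]])
  have 2: "((\<lambda>x. real n * inverse (norm x) ^ (n + 2) * (x \<bullet> b)) has_derivative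
     (\<lambda>v. (real n * inverse (norm x) ^ (n + 2)) * (v \<bullet> b)
        + (real n * (- real (n + 2) * inverse (norm x) ^ (n + 2 + 2) * (x \<bullet> v))) * (x \<bullet> b))) (at x)"
    by (rule has_derivative_mult[OF has_derivative_mult_right[OF has_derivative_inverse_norm_power[OF x]]
        has_derivative_inner_left[OF has_derivative_ident]])
  show ?thesis
    unfolding radial_gradient_def [abs_def] radial_hessian_def [abs_def]
    by (rule has_derivative_diff[OF 1 has_derivative_scaleR[OF 2 polynomial_has_derivative[OF p]]])
qed

text \<open>The Laplacian of \<open>p (x / norm x)\<close>: the Laplace--Beltrami eigenvalue of degree \<open>n\<close> appears.\<close>

lemma radial_hessian_trace:
  fixes p :: "'a::euclidean_space \<Rightarrow> complex"
  assumes p: "homogeneous_harmonic n p" and x: "x \<noteq> 0"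
  shows "(\<Sum>b\<in>Basis. radial_hessian n p b x b) =
    - (real n * (real n + real DIM('a) - 2) * inverse (norm x) ^ (n + 2)) *\<^sub>R p x"
proof -
  note P = homogeneous_harmonicD[OF p]
  define r where "r = inverse (norm x)"
  have r2: "r\<^sup>2 * (x \<bullet> x) = 1" using x by (simp add: r_def dot_square_norm power_inverse field_simps)
  have pick: "(\<Sum>c\<in>Basis. (b \<bullet> c) *\<^sub>R q c) = q b" if "b \<in> Basis" for b :: 'a and q :: "'a \<Rightarrow> complex"
  proof -
    have "(\<Sum>c\<in>Basis. (b \<bullet> c) *\<^sub>R q c) = (\<Sum>c\<in>Basis. if c = b then q b else 0)"
      by (rule sum.cong) (use that in \<open>auto simp: inner_Basis\<close>)
    then show ?thesis using that by simp
  qed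
  have E: "(\<Sum>b\<in>Basis. (x \<bullet> b) *\<^sub>R partial_deriv b p x) = real n *\<^sub>R p x"
    using Euler_homogeneous[OF P(1,2), of x] by (simp add: scaleR_conv_of_real)
  have L: "(\<Sum>b\<in>Basis. partial_deriv b (partial_deriv b p) x) = 0" using P(3)[of x] by (simp add: laplacian_def)
  have xx: "(\<Sum>b\<in>Basis. (x \<bullet> b) * (x \<bullet> b)) = x \<bullet> x" by (rule euclidean_inner[symmetric])
  have "(\<Sum>b\<in>Basis. radial_hessian n p b x b) =
    (\<Sum>b\<in>Basis. r ^ n *\<^sub>R partial_deriv b (partial_deriv b p) x - (2 * real n * r ^ (n + 2)) *\<^sub>R ((x \<bullet> b) *\<^sub>R partial_deriv b p x)
       - (real n * r ^ (n + 2)) *\<^sub>R p x + (real n * (real n + 2) * r ^ (n + 4) * ((x \<bullet> b) * (x \<bullet> b))) *\<^sub>R p x)"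
  proof (rule sum.cong[OF refl])
    fix b :: 'a assume b: "b \<in> Basis"
    show "radial_hessian n p b x b = r ^ n *\<^sub>R partial_deriv b (partial_deriv b p) x - (2 * real n * r ^ (n + 2)) *\<^sub>R ((x \<bullet> b) *\<^sub>R partial_deriv b p x)
       - (real n * r ^ (n + 2)) *\<^sub>R p x + (real n * (real n + 2) * r ^ (n + 4) * ((x \<bullet> b) * (x \<bullet> b))) *\<^sub>R p x"
      unfolding radial_hessian_def r_def[symmetric] pick[OF b]
      using b by (simp add: scaleR_conv_of_real algebra_simps numeral_eq_Suc)
  qed
  also have "\<dots> = r ^ n *\<^sub>R (\<Sum>b\<in>Basis. partial_deriv b (partial_deriv b p) x) - (2 * real n * r ^ (n + 2)) *\<^sub>R (\<Sum>b\<in>Basis. (x \<bullet> b) *\<^sub>R partial_deriv b p x)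
       - (real DIM('a) * (real n * r ^ (n + 2))) *\<^sub>R p x + (real n * (real n + 2) * r ^ (n + 4) * (\<Sum>b\<in>Basis. (x \<bullet> b) * (x \<bullet> b))) *\<^sub>R p x"
    by (simp add: sum.distrib sum_subtractf scaleR_sum_right scaleR_sum_left[symmetric] sum_distrib_left scaleR_conv_of_real)
       (simp add: sum_distrib_right)
  also have "\<dots> = - (2 * real n * r ^ (n + 2) * real n) *\<^sub>R p x - (real DIM('a) * (real n * r ^ (n + 2))) *\<^sub>R p x
      + (real n * (real n + 2) * r ^ (n + 2) * (r\<^sup>2 * (x \<bullet> x))) *\<^sub>R p x"
    unfolding E L xx by (simp add: power_add numeral_eq_Suc mult_ac)
  also have "\<dots> = - (real n * (real n + real DIM('a) - 2) * r ^ (n + 2)) *\<^sub>R p x"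
    unfolding r2 by (simp add: scaleR_conv_of_real algebra_simps)
  finally show ?thesis by (simp add: r_def)
qed

text \<open>
  The function \<open>p (x / norm x)\<close> is constant along rays; for the explicit formula this is Euler's identity.
\<close>

lemma radial_gradient_tangential:
  fixes p :: "'a::euclidean_space \<Rightarrow> complex"
  assumes p: "homogeneous_harmonic n p" and x: "x \<noteq> 0"
  shows "(\<Sum>b\<in>Basis. (x \<bullet> b) *\<^sub>R radial_gradient n p b x) = 0"
proof -
  note P = homogeneous_harmonicD[OF p]
  have E: "(\<Sum>b\<in>Basis. (x \<bullet> b) *\<^sub>R partial_deriv b p x) = real n *\<^sub>R p x"
    using Euler_homogeneous[OF P(1,2), of x] by (simp add: scaleR_conv_of_real)
  have "(\<Sum>b\<in>Basis. (x \<bullet> b) *\<^sub>R radial_gradient n p b x) =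
     (\<Sum>b\<in>Basis. inverse (norm x) ^ n *\<^sub>R ((x \<bullet> b) *\<^sub>R partial_deriv b p x) - (real n * inverse (norm x) ^ (n + 2) * ((x \<bullet> b) * (x \<bullet> b))) *\<^sub>R p x)"
    by (simp add: radial_gradient_def scaleR_diff_right mult_ac)
  also have "\<dots> = inverse (norm x) ^ n *\<^sub>R (\<Sum>b\<in>Basis. (x \<bullet> b) *\<^sub>R partial_deriv b p x)
     - (real n * inverse (norm x) ^ (n + 2) * (\<Sum>b\<in>Basis. (x \<bullet> b) * (x \<bullet> b))) *\<^sub>R p x"
    by (simp only: sum_subtractf scaleR_sum_right scaleR_sum_left sum_distrib_left)
  also have "\<dots> = 0"
    using x unfolding E euclidean_inner[symmetric] by (simp add: dot_square_norm power2_eq_square field_simps)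
  finally show ?thesis .
qed

lemma max_square_has_derivative:
  "((\<lambda>s::real. (max 0 s)\<^sup>2) has_real_derivative 2 * max 0 s) (at s)"
proof -
  consider "s < 0" | "s = 0" | "s > 0" by linarith
  then show ?thesis
  proof cases
    case 1
    have "((\<lambda>s::real. 0) has_real_derivative 0) (at s)" by simp
    then have "((\<lambda>s::real. (max 0 s)\<^sup>2) has_real_derivative 0) (at s)"
      by (rule has_field_derivative_transform_within[where d="- s"]) (use 1 in \<open>auto simp: dist_real_def\<close>)
    then show ?thesis using 1 by simp
  next
    case 2
    have "((\<lambda>h. (max 0 h)\<^sup>2 / h) \<longlongrightarrow> 0) (at (0::real))"
    proof (rule Lim_null_comparison[where g="\<lambda>h. \<bar>h\<bar>"])
      show "\<forall>\<^sub>F h in at (0::real). norm ((max 0 h)\<^sup>2 / h) \<le> \<bar>h\<bar>"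
        by (rule always_eventually) (auto simp: max_def power2_eq_square)
      show "((\<lambda>h. \<bar>h\<bar>) \<longlongrightarrow> 0) (at (0::real))" by (auto intro!: tendsto_eq_intros)
    qed
    then show ?thesis using 2 by (simp add: DERIV_def)
  next
    case 3
    have "((\<lambda>s::real. s\<^sup>2) has_real_derivative 2 * s) (at s)" by (auto intro!: derivative_eq_intros)
    then have "((\<lambda>s::real. (max 0 s)\<^sup>2) has_real_derivative 2 * s) (at s)"
      by (rule has_field_derivative_transform_within[where d="s"]) (use 3 in \<open>auto simp: dist_real_def\<close>)
    then show ?thesis using 3 by simp
  qed
qed

text \<open>
  A continuously differentiable weight, applied to the squared norm: it lives on the annulus where the norm
  is between \<open>1\<close> and \<open>2\<close>, away from the singularity of radial extensions at the origin.
\<close>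

definition bump :: "real \<Rightarrow> real" where "bump s = (max 0 ((s - 1) * (4 - s)))\<^sup>2"
definition bump' :: "real \<Rightarrow> real" where "bump' s = 2 * max 0 ((s - 1) * (4 - s)) * (5 - 2 * s)"

lemma bump_has_derivative: "(bump has_real_derivative bump' s) (at s)"
  unfolding bump_def[abs_def] bump'_def
  by (rule DERIV_chain2[OF max_square_has_derivative]) (auto intro!: derivative_eq_intros simp: algebra_simps)

lemma bump_zero: "s \<le> 1 \<or> 4 \<le> s \<Longrightarrow> bump s = 0" "s \<le> 1 \<or> 4 \<le> s \<Longrightarrow> bump' s = 0"
  by (auto simp: bump_def bump'_def max_def mult_le_0_iff zero_le_mult_iff not_le dest: antisym)

lemma bump_continuous [continuous_intros]:
  "continuous_on S f \<Longrightarrow> continuous_on S (\<lambda>x. bump (f x))"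
  "continuous_on S f \<Longrightarrow> continuous_on S (\<lambda>x. bump' (f x))"
  by (auto simp: bump_def bump'_def intro!: continuous_intros)

lemma bump_nonneg: "bump s \<ge> 0" by (simp add: bump_def)

text \<open>
  The constant \<open>K\<close> is positive because the weight is, on the open annulus.
\<close>

lemma bump_radial_integral:
  obtains K where "K > 0" "\<And>F :: 'a::euclidean_space \<Rightarrow> real. continuous_on (sphere 0 1) F \<Longrightarrow>
     (\<integral>x. bump (norm x ^ 2) * (indicator (cball 0 2 - {0}) x * F (x /\<^sub>R norm x)) \<partial>lborel) = K * integral\<^sup>L sphere_measure F"
proof -
  obtain K where K: "\<And>F :: 'a \<Rightarrow> real. \<And>C. F \<in> borel_measurable sphere_measure \<Longrightarrow>
     (\<And>x. norm x = 1 \<Longrightarrow> norm (F x) \<le> C) \<Longrightarrow>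
     (\<integral>x. bump (norm x ^ 2) * (indicator (cball 0 2 - {0}) x * F (x /\<^sub>R norm x)) \<partial>lborel) = K * integral\<^sup>L sphere_measure F"
  proof (rule radial_weight_integral[where k="\<lambda>t. bump (t ^ 2)" and k'="\<lambda>t. bump' (t ^ 2) * (2 * t)"])
    show "((\<lambda>t. bump (t\<^sup>2)) has_real_derivative bump' (t\<^sup>2) * (2 * t)) (at t)" for t
      by (rule DERIV_chain2[OF bump_has_derivative]) (auto intro!: derivative_eq_intros)
    show "continuous_on UNIV (\<lambda>t. bump' (t ^ 2) * (2 * t))" by (intro continuous_intros)
    show "bump (t\<^sup>2) = 0" if "t \<ge> 2" for t :: real
    proof -
      have "t\<^sup>2 \<ge> 2\<^sup>2" using that by (intro power_mono) auto
      then show ?thesis by (simp add: bump_zero)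
    qed
  qed blast
  have Kc: "(\<integral>x. bump (norm x ^ 2) * (indicator (cball 0 2 - {0}) x * F (x /\<^sub>R norm x)) \<partial>lborel) = K * integral\<^sup>L sphere_measure F"
    if F: "continuous_on (sphere 0 1) F" for F :: "'a \<Rightarrow> real"
  proof -
    obtain C where "\<And>x. norm x = 1 \<Longrightarrow> norm (F x) \<le> C"
      by (rule continuous_on_sphere_bounded[OF F]) (rule that; assumption)
    then show ?thesis by (intro K[where C=C] continuous_on_sphere_measurable F) auto
  qed
  define h where "h = (\<lambda>x::'a. bump (norm x ^ 2) * (indicator (cball 0 2 - {0}) x * 1))"
  have h: "integral\<^sup>L lborel h = K * sphere_area TYPE('a)"
    unfolding h_def using Kc[of "\<lambda>_. 1"] by (simp add: measure_sphere_measure)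
  have hi: "integrable lborel h"
  proof -
    have "integrable lborel (\<lambda>x::'a. indicator (cball 0 2) x *\<^sub>R bump (norm x ^ 2))"
      by (rule borel_integrable_compact) (auto intro!: continuous_intros)
    moreover have "indicator (cball 0 2) x *\<^sub>R bump (norm x ^ 2) = h x" for x :: 'a
      by (auto simp: h_def indicator_def bump_zero)
    ultimately show ?thesis by simp
  qed
  have h0: "h x \<ge> 0" for x by (simp add: h_def bump_nonneg indicator_def)
  have "K \<noteq> 0"
  proof
    assume "K = 0"
    then have "AE x in lborel. h x = 0"
      using integral_nonneg_eq_0_iff_AE[OF hi] h h0 by simp
    then have "AE x in lborel. x \<notin> {x :: 'a. 1 < norm x \<and> norm x < 2}"
    proof eventually_elim
      case (elim x)
      show ?case
      proof
        assume "x \<in> {x. 1 < norm x \<and> norm x < 2}"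
        then have x: "1 < norm x" "norm x < 2" by auto
        then have "norm x ^ 2 > 1" "norm x ^ 2 < 2 ^ 2" using power_strict_mono[of "norm x" 2 2] by auto
        then have "bump (norm x ^ 2) > 0" by (simp add: bump_def)
        then show False using elim x by (auto simp: h_def indicator_def)
      qed
    qed
    then have AE: "AE x in lebesgue. x \<notin> {x :: 'a. 1 < norm x \<and> norm x < 2}" by (rule AE_completion)
    have op: "open {x :: 'a. 1 < norm x \<and> norm x < 2}"
      by (intro open_Collect_conj open_Collect_less continuous_intros)
    obtain e :: 'a where e: "e \<in> Basis" using SOME_Basis by blast
    have "(3/2) *\<^sub>R e \<in> {x :: 'a. 1 < norm x \<and> norm x < 2}" using e by simp
    then have "\<not> negligible {x :: 'a. 1 < norm x \<and> norm x < 2}" using open_not_negligible[OF op] by blast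
    moreover have "{x :: 'a. 1 < norm x \<and> norm x < 2} \<in> null_sets lebesgue" using AE op by (simp add: AE_iff_null_sets)
    ultimately show False by (simp add: negligible_iff_null_sets)
  qed
  moreover have "0 \<le> K * sphere_area TYPE('a)" using h h0 Bochner_Integration.integral_nonneg[of lborel h] by simp
  then have "0 \<le> K" using sphere_area_pos[where 'a='a] by (simp add: zero_le_mult_iff)
  ultimately have "K > 0" by simp
  then show ?thesis using that Kc by blast
qed


text \<open>
  Integrate the divergence of \<open>m * (U \<bullet> radial_gradient n p b)\<close> over the whole space, where \<open>U\<close> is the
  radial extension of \<open>u\<close> and \<open>m x = (x \<bullet> x) * bump (x \<bullet> x)\<close> lives on an annulus.  The derivative of
  the radial weight drops out because the radial gradient is tangential, and the factor \<open>x \<bullet> x\<close> makes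
  what remains depend on \<open>x / norm x\<close> only, up to the weight \<open>bump\<close>.
\<close>

lemma Green_identity_sphere:
  fixes u Y :: "'a::euclidean_space \<Rightarrow> complex"
  assumes u: "u \<in> sphere_C1" and Y: "Y \<in> spherical_harmonics n"
  shows "(\<integral>x. (\<Sum>b\<in>Basis. partial_deriv b (radial_extension u) x \<bullet> partial_deriv b (radial_extension Y) x) \<partial>sphere_measure)
     = real n * (real n + real DIM('a) - 2) * (\<integral>x. u x \<bullet> Y x \<partial>sphere_measure)"
proof -
  obtain p where p: "homogeneous_harmonic n p" "\<forall>x\<in>sphere 0 1. Y x = p x"
    using Y by (auto simp: spherical_harmonics_eq)
  note P = homogeneous_harmonicD[OF p(1)]
  define lam where "lam = real n * (real n + real DIM('a) - 2)"
  define U where "U = radial_extension u"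
  define W where "W = radial_gradient n p"
  define dU where "dU = (\<lambda>x v. \<Sum>c\<in>Basis. (v \<bullet> c) *\<^sub>R partial_deriv c U x)"
  define m where "m = (\<lambda>s::real. s * bump s)"
  define m' where "m' = (\<lambda>s::real. bump s + s * bump' s)"
  define H where "H = (\<lambda>b x. m (x \<bullet> x) * (U x \<bullet> W b x))"
  define H' where "H' = (\<lambda>b x v. m (x \<bullet> x) * (U x \<bullet> radial_hessian n p b x v + dU x v \<bullet> W b x) + (m' (x \<bullet> x) * (2 * (x \<bullet> v))) * (U x \<bullet> W b x))"
  define h where "h = (\<lambda>b x. H' b x b)"
  have m0: "m s = 0" "m' s = 0" if "s \<le> 1 \<or> 4 \<le> s" for s
    using bump_zero[OF that] by (simp_all add: m_def m'_def)
  have out: "m (x \<bullet> x) = 0" "m' (x \<bullet> x) = 0" if "norm x \<le> 1 \<or> 2 \<le> norm x" for x :: 'a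
  proof -
    have "x \<bullet> x \<le> 1 \<or> 4 \<le> x \<bullet> x"
      using that power_mono[of "norm x" 1 2] power_mono[of 2 "norm x" 2] by (auto simp: dot_square_norm)
    then show "m (x \<bullet> x) = 0" "m' (x \<bullet> x) = 0" using m0 by blast+
  qed
  have mder: "((\<lambda>x::'a. m (x \<bullet> x)) has_derivative (\<lambda>v. m' (x \<bullet> x) * (2 * (x \<bullet> v)))) (at x)" for x
  proof -
    have 1: "(m has_real_derivative m' (x \<bullet> x)) (at (x \<bullet> x))"
      unfolding m_def m'_def by (auto intro!: derivative_eq_intros bump_has_derivative)
    have 2: "((\<lambda>x::'a. x \<bullet> x) has_derivative (\<lambda>v. 2 * (x \<bullet> v))) (at x)"
      by (auto intro!: derivative_eq_intros simp: inner_commute)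
    show ?thesis
      using has_derivative_compose[OF 2 has_field_derivative_imp_has_derivative[OF 1]] by simp
  qed
  have Hd: "(H b has_derivative H' b x) (at x)" for b x
  proof (cases "x = 0")
    case False
    have dUx: "(U has_derivative dU x) (at x)"
      unfolding dU_def U_def by (rule differentiable_has_partials[OF sphere_C1D(1)[OF u False]])
    have dW: "(W b has_derivative radial_hessian n p b x) (at x)"
      unfolding W_def by (rule radial_gradient_has_derivative[OF P(1) False])
    show ?thesis
      unfolding H_def H'_def
      by (rule has_derivative_mult[OF mder has_derivative_inner[OF dUx dW]])
  next
    case True
    have "H' b x = (\<lambda>_. 0)" using out[of x] True by (simp add: H'_def)
    moreover have "(H b has_derivative (\<lambda>_. 0)) (at 0)"
    proof (rule has_derivative_transform_within_open[of "\<lambda>_. 0" _ _ UNIV "ball 0 1"])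
      show "0 = H b y" if "y \<in> ball 0 1" for y using that out[of y] by (simp add: H_def)
    qed auto
    ultimately show ?thesis using True by simp
  qed
  define A where "A = cball (0::'a) 2 - ball 0 1"
  have A: "compact A" "0 \<notin> A" "A \<subseteq> - {0}" unfolding A_def by (auto intro: compact_diff)
  have hA: "continuous_on A (h b)" if b: "b \<in> Basis" for b
  proof -
    have cU: "continuous_on A U" unfolding U_def
      using continuous_on_subset[OF sphere_C1_continuous(1)[OF u] A(3)] .
    have cdU: "continuous_on A (\<lambda>x. dU x b)"
    proof -
      have "continuous_on A (partial_deriv c U)" if "c \<in> Basis" for c
        unfolding U_def using continuous_on_subset[OF sphere_C1D(2)[OF u that] A(3)] .
      then show ?thesis unfolding dU_def by (intro continuous_intros) auto
    qed
    have cW: "continuous_on A (W b)"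
      unfolding W_def radial_gradient_def [abs_def] using A(2)
      by (intro continuous_intros continuous_on_polymonial_function polynomial_partial_deriv P(1)) auto
    have cR: "continuous_on A (\<lambda>x. radial_hessian n p b x b)"
      unfolding radial_hessian_def using A(2)
      by (intro continuous_intros continuous_on_polymonial_function polynomial_partial_deriv P(1)) auto
    show ?thesis
      unfolding h_def H'_def m_def m'_def by (intro continuous_intros cU cdU cW cR)
  qed
  have hout: "h b x = 0" if "x \<notin> A" for b x
    using that out[of x] by (auto simp: h_def H'_def A_def)
  have hint: "integrable lborel (h b)" if "b \<in> Basis" for b
  proof -
    have "integrable lborel (\<lambda>x. indicator A x *\<^sub>R h b x)"
      by (rule borel_integrable_compact[OF A(1) hA[OF that]])
    moreover have "indicator A x *\<^sub>R h b x = h b x" for x using hout[of x b] by (cases "x \<in> A") simp_all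
    ultimately show ?thesis by (simp only:)
  qed
  have h0: "(\<integral>x. h b x \<partial>lborel) = 0" if b: "b \<in> Basis" for b
  proof -
    have "compact (h b ` A)" by (rule compact_continuous_image[OF hA[OF b] A(1)])
    then obtain M where M: "\<forall>x\<in>A. \<bar>h b x\<bar> \<le> M"
      using compact_imp_bounded[of "h b ` A"] by (auto simp: bounded_iff)
    have "\<bar>H' b x b\<bar> \<le> max M 0" for x
      using M hout[of x b] by (cases "x \<in> A") (auto simp: h_def)
    then show ?thesis
      unfolding h_def
      by (intro integral_partial_derivative_zero[OF Hd, where R=2]) (auto simp: H_def out)
  qed
  define F where "F = (\<lambda>x. (\<Sum>b\<in>Basis. partial_deriv b U x \<bullet> partial_deriv b (radial_extension Y) x) - lam * (u x \<bullet> Y x))"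
  have YC: "Y \<in> sphere_C1" by (rule spherical_harmonics_C1[OF Y])
  have Fc: "continuous_on (sphere 0 1) F"
    unfolding F_def U_def
    by (intro continuous_intros sphere_C1_continuous[OF u] sphere_C1_continuous[OF YC])
  have sumh: "(\<Sum>b\<in>Basis. h b x) = bump (norm x ^ 2) * (indicator (cball 0 2 - {0}) x * F (x /\<^sub>R norm x))" for x
  proof (cases "norm x \<le> 1 \<or> 2 < norm x")
    case True
    then have "h b x = 0" for b using out[of x] by (auto simp: h_def H'_def)
    moreover have "indicator (cball 0 2 - {0}) x * bump (norm x ^ 2) = 0"
      using True power_mono[of "norm x" 1 2] by (auto simp: indicator_def bump_zero)
    ultimately show ?thesis by (auto simp: mult.commute)
  next
    case False
    then have x: "x \<noteq> 0" "norm x \<le> 2" by auto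
    let ?y = "x /\<^sub>R norm x" and ?r = "inverse (norm x)"
    have y: "?y \<in> sphere 0 1" using x by simp
    have pick: "dU x b = partial_deriv b U x" if "b \<in> Basis" for b
    proof -
      have "dU x b = (\<Sum>c\<in>Basis. if c = b then partial_deriv b U x else 0)"
        unfolding dU_def by (rule sum.cong) (use that in \<open>auto simp: inner_Basis\<close>)
      then show ?thesis using that by simp
    qed
    have W: "W b x = partial_deriv b (radial_extension Y) x" if "b \<in> Basis" for b
      unfolding W_def by (rule partial_deriv_radial_harmonic[OF p x(1) that, symmetric])
    have T: "(\<Sum>b\<in>Basis. (x \<bullet> b) * (U x \<bullet> W b x)) = 0"
    proof -
      have "(\<Sum>b\<in>Basis. (x \<bullet> b) * (U x \<bullet> W b x)) = U x \<bullet> (\<Sum>b\<in>Basis. (x \<bullet> b) *\<^sub>R W b x)"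
        by (simp add: inner_sum_right)
      then show ?thesis using radial_gradient_tangential[OF p(1) x(1)] by (simp add: W_def)
    qed
    have L: "(\<Sum>b\<in>Basis. U x \<bullet> radial_hessian n p b x b) = - (lam * ?r\<^sup>2) * (u ?y \<bullet> Y ?y)"
    proof -
      have "(\<Sum>b\<in>Basis. U x \<bullet> radial_hessian n p b x b) = U x \<bullet> (\<Sum>b\<in>Basis. radial_hessian n p b x b)"
        by (simp add: inner_sum_right)
      also have "\<dots> = - (lam * ?r\<^sup>2) * (U x \<bullet> (?r ^ n *\<^sub>R p x))"
        unfolding radial_hessian_trace[OF p(1) x(1)] by (simp add: lam_def power_add mult_ac power2_eq_square)
      also have "U x \<bullet> (?r ^ n *\<^sub>R p x) = u ?y \<bullet> Y ?y"
      proof -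
        have "?r ^ n *\<^sub>R p x = Y ?y" using p(2) y by (simp add: P(2))
        then show ?thesis by (simp add: U_def radial_extension_def)
      qed
      finally show ?thesis .
    qed
    have G: "(\<Sum>b\<in>Basis. dU x b \<bullet> W b x) = ?r\<^sup>2 * (\<Sum>b\<in>Basis. partial_deriv b U ?y \<bullet> partial_deriv b (radial_extension Y) ?y)"
      unfolding sum_distrib_left
    proof (rule sum.cong[OF refl])
      fix b :: 'a assume b: "b \<in> Basis"
      have "partial_deriv b U x = ?r *\<^sub>R partial_deriv b U ?y"
        unfolding U_def by (rule partial_deriv_radial_extension[OF sphere_C1D(1)[OF u] x(1)])
      moreover have "partial_deriv b (radial_extension Y) x = ?r *\<^sub>R partial_deriv b (radial_extension Y) ?y"
        by (rule partial_deriv_radial_extension[OF sphere_C1D(1)[OF YC] x(1)])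
      ultimately show "dU x b \<bullet> W b x = ?r\<^sup>2 * (partial_deriv b U ?y \<bullet> partial_deriv b (radial_extension Y) ?y)"
        unfolding pick[OF b] W[OF b] by (simp add: power2_eq_square)
    qed
    have "(\<Sum>b\<in>Basis. h b x) = m (x \<bullet> x) * ((\<Sum>b\<in>Basis. U x \<bullet> radial_hessian n p b x b) + (\<Sum>b\<in>Basis. dU x b \<bullet> W b x))
       + 2 * m' (x \<bullet> x) * (\<Sum>b\<in>Basis. (x \<bullet> b) * (U x \<bullet> W b x))"
      by (simp add: h_def H'_def sum.distrib sum_distrib_left distrib_left mult_ac)
    also have "\<dots> = m (x \<bullet> x) * (?r\<^sup>2 * F ?y)"
      unfolding T L G by (simp add: F_def algebra_simps)
    also have "m (x \<bullet> x) = bump (norm x ^ 2) * (norm x)\<^sup>2" by (simp add: m_def dot_square_norm mult.commute)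
    also have "bump (norm x ^ 2) * (norm x)\<^sup>2 * (?r\<^sup>2 * F ?y) = bump (norm x ^ 2) * F ?y"
      using x by (simp add: power_inverse field_simps)
    finally show ?thesis using x by (simp add: indicator_def)
  qed
  obtain K where K0: "K > 0" "\<And>F :: 'a \<Rightarrow> real. continuous_on (sphere 0 1) F \<Longrightarrow>
     (\<integral>x. bump (norm x ^ 2) * (indicator (cball 0 2 - {0}) x * F (x /\<^sub>R norm x)) \<partial>lborel) = K * integral\<^sup>L sphere_measure F"
    by (rule bump_radial_integral) (rule that; assumption)
  note K = K0(1) K0(2)[OF Fc]
  have "K * integral\<^sup>L sphere_measure F = (\<integral>x. (\<Sum>b\<in>Basis. h b x) \<partial>lborel)"
    unfolding sumh K(2) ..
  also have "\<dots> = (\<Sum>b\<in>Basis. \<integral>x. h b x \<partial>lborel)"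
    by (rule Bochner_Integration.integral_sum) (rule hint)
  also have "\<dots> = 0" by (simp add: h0)
  finally have "integral\<^sup>L sphere_measure F = 0" using K(1) by simp
  moreover have "integral\<^sup>L sphere_measure F =
     (\<integral>x. (\<Sum>b\<in>Basis. partial_deriv b U x \<bullet> partial_deriv b (radial_extension Y) x) \<partial>sphere_measure) - (\<integral>x. lam * (u x \<bullet> Y x) \<partial>sphere_measure)"
    unfolding F_def
  proof (rule Bochner_Integration.integral_diff)
    show "integrable sphere_measure (\<lambda>x. \<Sum>b\<in>Basis. partial_deriv b U x \<bullet> partial_deriv b (radial_extension Y) x)"
      unfolding U_def
      by (intro integrable_sphere_continuous continuous_intros sphere_C1_continuous[OF u] sphere_C1_continuous[OF YC])
    show "integrable sphere_measure (\<lambda>x. lam * (u x \<bullet> Y x))"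
      by (intro integrable_sphere_continuous continuous_intros sphere_C1_continuous[OF u] sphere_C1_continuous[OF YC])
  qed
  ultimately show ?thesis by (simp add: lam_def U_def)
qed

section \<open>Expansion in spherical harmonics\<close>

definition eigenvalue :: "'a::euclidean_space itself \<Rightarrow> nat \<Rightarrow> real" where
  "eigenvalue _ n = real n * (real n + real DIM('a) - 2)"

lemma eigenvalue_mono:
  assumes "2 \<le> DIM('a::euclidean_space)" "m < n"
  shows "eigenvalue TYPE('a) m < eigenvalue TYPE('a) n"
proof -
  have "real m * (real m + real DIM('a) - 2) \<le> real m * (real n + real DIM('a) - 2)"
    using assms by (intro mult_left_mono) auto
  also have "\<dots> < real n * (real n + real DIM('a) - 2)"
    using assms by (intro mult_strict_right_mono) auto
  finally show ?thesis by (simp add: eigenvalue_def)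
qed

lemma eigenvalue_ge:
  assumes "2 \<le> DIM('a::euclidean_space)" "1 \<le> n"
  shows "real DIM('a) - 1 \<le> eigenvalue TYPE('a) n"
proof -
  have "eigenvalue TYPE('a) 1 \<le> eigenvalue TYPE('a) n"
    using eigenvalue_mono[OF assms(1), of 1 n] assms(2) by (cases "n = 1") auto
  then show ?thesis by (simp add: eigenvalue_def)
qed

lemma eigenvalue_0 [simp]: "eigenvalue TYPE('a::euclidean_space) 0 = 0"
  by (simp add: eigenvalue_def)

definition grad :: "'a::euclidean_space \<Rightarrow> ('a \<Rightarrow> complex) \<Rightarrow> 'a sphere_l2" where
  "grad b u = cls (partial_deriv b (radial_extension u))"

lemma sphere_C1_square_integrable:
  assumes "u \<in> sphere_C1"
  shows "square_integrable u" "b \<in> Basis \<Longrightarrow> square_integrable (partial_deriv b (radial_extension u))"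
  using sphere_C1_continuous[OF assms] by (auto intro: square_integrable_continuous)

text \<open>
  For a harmonic \<open>u\<close> of another degree both sides are symmetric in \<open>u\<close> and \<open>Y\<close> up to the eigenvalue,
  which gives orthogonality of different degrees; for \<open>u = Y\<close> it evaluates the energy of \<open>Y\<close>.
\<close>

lemma Green_identity_l2:
  fixes u Y :: "'a::euclidean_space \<Rightarrow> complex"
  assumes u: "u \<in> sphere_C1" and Y: "Y \<in> spherical_harmonics n"
  shows "(\<Sum>b\<in>Basis. grad b u \<bullet> grad b Y) = eigenvalue TYPE('a) n * (cls u \<bullet> cls Y)"
proof -
  have YC: "Y \<in> sphere_C1" by (rule spherical_harmonics_C1[OF Y])
  note sq = sphere_C1_square_integrable[OF u] sphere_C1_square_integrable[OF YC]
  have "(\<Sum>b\<in>Basis. grad b u \<bullet> grad b Y) =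
     (\<Sum>b\<in>Basis. (\<integral>x. partial_deriv b (radial_extension u) x \<bullet> partial_deriv b (radial_extension Y) x \<partial>sphere_measure) / sphere_area TYPE('a))"
    unfolding grad_def by (intro sum.cong refl inner_cls sq)
  also have "\<dots> = (\<integral>x. (\<Sum>b\<in>Basis. partial_deriv b (radial_extension u) x \<bullet> partial_deriv b (radial_extension Y) x) \<partial>sphere_measure) / sphere_area TYPE('a)"
    unfolding sum_divide_distrib[symmetric]
    by (subst Bochner_Integration.integral_sum) (auto intro!: square_integrable_inner sq)
  also have "\<dots> = eigenvalue TYPE('a) n * (cls u \<bullet> cls Y)"
    unfolding Green_identity_sphere[OF u Y] inner_cls[OF sq(1,3)] eigenvalue_def by simp
  finally show ?thesis .
qed

lemma spherical_harmonics_orthogonal: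
  fixes Y Z :: "'a::euclidean_space \<Rightarrow> complex"
  assumes d: "2 \<le> DIM('a)" and Y: "Y \<in> spherical_harmonics m" and Z: "Z \<in> spherical_harmonics n" and "m \<noteq> n"
  shows "cls Y \<bullet> cls Z = 0"
proof -
  have "(\<Sum>b\<in>Basis. grad b Y \<bullet> grad b Z) = eigenvalue TYPE('a) n * (cls Y \<bullet> cls Z)"
    by (rule Green_identity_l2[OF spherical_harmonics_C1[OF Y] Z])
  moreover have "(\<Sum>b\<in>Basis. grad b Z \<bullet> grad b Y) = eigenvalue TYPE('a) m * (cls Z \<bullet> cls Y)"
    by (rule Green_identity_l2[OF spherical_harmonics_C1[OF Z] Y])
  ultimately have "eigenvalue TYPE('a) n * (cls Y \<bullet> cls Z) = eigenvalue TYPE('a) m * (cls Y \<bullet> cls Z)"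
    by (simp add: inner_commute)
  moreover have "eigenvalue TYPE('a) n \<noteq> eigenvalue TYPE('a) m"
    using eigenvalue_mono[OF d, of m n] eigenvalue_mono[OF d, of n m] \<open>m \<noteq> n\<close> by linarith
  ultimately show ?thesis by simp
qed

subsection \<open>Completeness\<close>

text \<open>
  Polynomials approximate continuous functions uniformly on the sphere, by the Stone--Weierstrass theorem.
\<close>

lemma sphere_integral_continuous_zero:
  fixes \<phi> g :: "'a::euclidean_space \<Rightarrow> real"
  assumes \<phi>: "integrable sphere_measure \<phi>" and poly: "\<And>q. real_polynomial_function q \<Longrightarrow> (\<integral>x. q x * \<phi> x \<partial>sphere_measure) = 0"
    and g: "continuous_on UNIV g"
  shows "(\<integral>x. g x * \<phi> x \<partial>sphere_measure) = 0"
proof -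
  have gs: "continuous_on (sphere 0 1) g" using g continuous_on_subset by blast
  have int: "integrable sphere_measure (\<lambda>x. k x * \<phi> x)" if k: "continuous_on (sphere 0 1) k" for k :: "'a \<Rightarrow> real"
  proof -
    have "compact (k ` sphere 0 1)" by (rule compact_continuous_image[OF k]) auto
    then obtain C where C: "\<forall>x\<in>sphere 0 1. \<bar>k x\<bar> \<le> C"
      using compact_imp_bounded[of "k ` sphere 0 1"] by (auto simp: bounded_iff)
    show ?thesis
    proof (rule Bochner_Integration.integrable_bound[of _ "\<lambda>x. C * \<phi> x"])
      show "integrable sphere_measure (\<lambda>x. C * \<phi> x)" using \<phi> by simp
      show "(\<lambda>x. k x * \<phi> x) \<in> borel_measurable sphere_measure"
        using continuous_on_sphere_measurable[OF k] borel_measurable_integrable[OF \<phi>] by measurable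
      have "\<bar>k x\<bar> \<le> \<bar>C\<bar>" if "norm x = 1" for x using C that by force
      then show "AE x in sphere_measure. norm (k x * \<phi> x) \<le> norm (C * \<phi> x)"
        by (intro AE_I2) (simp add: abs_mult mult_right_mono)
    qed
  qed
  have le: "\<bar>\<integral>x. g x * \<phi> x \<partial>sphere_measure\<bar> \<le> e * (\<integral>x. \<bar>\<phi> x\<bar> \<partial>sphere_measure)" if e: "e > 0" for e
  proof -
    obtain q where q: "real_polynomial_function q" "\<And>x. x \<in> sphere 0 1 \<Longrightarrow> \<bar>g x - q x\<bar> < e"
      using Stone_Weierstrass_real_polynomial_function[OF compact_sphere gs e] by blast
    have qc: "continuous_on (sphere 0 1) q"
      using q(1) by (simp add: continuous_at_imp_continuous_on continuous_real_polymonial_function)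
    have "(\<integral>x. g x * \<phi> x \<partial>sphere_measure) = (\<integral>x. (g x - q x) * \<phi> x \<partial>sphere_measure)"
      using poly[OF q(1)] int[OF gs] int[OF qc] by (simp add: left_diff_distrib)
    also have "\<bar>\<dots>\<bar> \<le> (\<integral>x. \<bar>(g x - q x) * \<phi> x\<bar> \<partial>sphere_measure)"
      using integral_norm_bound[of sphere_measure "\<lambda>x. (g x - q x) * \<phi> x"] by simp
    also have "\<dots> \<le> (\<integral>x. e * \<bar>\<phi> x\<bar> \<partial>sphere_measure)"
    proof (rule integral_mono)
      show "integrable sphere_measure (\<lambda>x. \<bar>(g x - q x) * \<phi> x\<bar>)"
        by (intro integrable_abs int continuous_intros gs qc)
      show "integrable sphere_measure (\<lambda>x. e * \<bar>\<phi> x\<bar>)" using \<phi> by simp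
      fix x :: 'a assume "x \<in> space sphere_measure"
      then have "\<bar>g x - q x\<bar> \<le> e" using q(2)[of x] by simp
      then show "\<bar>(g x - q x) * \<phi> x\<bar> \<le> e * \<bar>\<phi> x\<bar>" by (simp add: abs_mult mult_right_mono)
    qed
    finally show ?thesis by simp
  qed
  have nn: "(\<integral>x. \<bar>\<phi> x\<bar> \<partial>sphere_measure) \<ge> 0" by simp
  show ?thesis
  proof (rule ccontr)
    assume nz: "(\<integral>x. g x * \<phi> x \<partial>sphere_measure) \<noteq> 0"
    define I where "I = (\<integral>x. \<bar>\<phi> x\<bar> \<partial>sphere_measure)"
    define J where "J = \<bar>\<integral>x. g x * \<phi> x \<partial>sphere_measure\<bar>"
    have J: "J > 0" using nz by (simp add: J_def)
    have I: "I \<ge> 0" using nn by (simp add: I_def)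
    have "J \<le> (J / (2 * (I + 1))) * I" using le[of "J / (2 * (I + 1))"] J I by (simp add: I_def[symmetric] J_def[symmetric])
    also have "\<dots> < J" using J I by (simp add: field_simps add_nonneg_pos)
    finally show False by simp
  qed
qed

text \<open>
  The indicator of a closed set is a pointwise limit of the continuous functions
  \<open>max 0 (1 - m * infdist x C)\<close>.
\<close>

lemma sphere_integral_closed_zero:
  fixes \<phi> :: "'a::euclidean_space \<Rightarrow> real"
  assumes \<phi>: "integrable sphere_measure \<phi>" and poly: "\<And>q. real_polynomial_function q \<Longrightarrow> (\<integral>x. q x * \<phi> x \<partial>sphere_measure) = 0"
    and C: "closed C"
  shows "(\<integral>x. indicator C x * \<phi> x \<partial>sphere_measure) = 0"
proof (cases "C = {}")
  case False
  define g where "g = (\<lambda>m x. max 0 (1 - real m * infdist x C))"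
  have g0: "(\<integral>x. g m x * \<phi> x \<partial>sphere_measure) = 0" for m
    unfolding g_def by (rule sphere_integral_continuous_zero[OF \<phi> poly]) (auto intro!: continuous_intros)
  have lim: "(\<lambda>m. g m x) \<longlonglongrightarrow> indicator C x" for x
  proof (cases "x \<in> C")
    case True
    then have "g m x = 1" for m by (simp add: g_def)
    then show ?thesis using True by simp
  next
    case F: False
    then have pos: "infdist x C > 0"
      using in_closed_iff_infdist_zero[OF C False] infdist_nonneg[of x C] by (metis less_eq_real_def)
    have "\<forall>\<^sub>F m in sequentially. g m x = 0"
    proof -
      obtain N :: nat where N: "real N > 1 / infdist x C" using reals_Archimedean2 by blast
      have "g m x = 0" if "m \<ge> N" for m
      proof -
        have "real m > 1 / infdist x C" using N that by (meson less_le_trans of_nat_mono)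
        then have "real m * infdist x C > 1" using pos by (simp add: field_simps)
        then show ?thesis by (simp add: g_def)
      qed
      then show ?thesis using eventually_sequentially by blast
    qed
    then show ?thesis using F by (simp add: tendsto_eventually)
  qed
  have cm: "g m \<in> borel_measurable sphere_measure" for m
    unfolding g_def by (intro continuous_on_sphere_measurable continuous_intros)
  have Cm: "(\<lambda>x. indicat_real C x) \<in> borel_measurable sphere_measure"
    by (rule borel_measurable_LIMSEQ_real[OF lim cm])
  have "(\<lambda>m. \<integral>x. g m x * \<phi> x \<partial>sphere_measure) \<longlonglongrightarrow> (\<integral>x. indicator C x * \<phi> x \<partial>sphere_measure)"
  proof (rule integral_dominated_convergence)
    show "(\<lambda>x. indicator C x * \<phi> x) \<in> borel_measurable sphere_measure"
      using Cm borel_measurable_integrable[OF \<phi>] by measurable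
    show "(\<lambda>x. g m x * \<phi> x) \<in> borel_measurable sphere_measure" for m
      using cm borel_measurable_integrable[OF \<phi>] by measurable
    show "integrable sphere_measure (\<lambda>x. \<bar>\<phi> x\<bar>)" using \<phi> by simp
    show "AE x in sphere_measure. (\<lambda>m. g m x * \<phi> x) \<longlonglongrightarrow> indicator C x * \<phi> x"
      by (intro AE_I2 tendsto_intros lim)
    have "\<bar>g m x\<bar> \<le> 1" for m x by (simp add: g_def infdist_nonneg)
    then show "AE x in sphere_measure. norm (g m x * \<phi> x) \<le> \<bar>\<phi> x\<bar>" for m
      by (intro AE_I2) (simp add: abs_mult mult_left_le_one_le)
  qed
  then show ?thesis by (simp add: g0 LIMSEQ_const_iff)
qed simp

text \<open>
  Open sets are stable under intersection and generate the Borel sets, and the sets over which \<open>\<phi>\<close> integrates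
  to \<open>0\<close> are closed under complements and disjoint unions.  A function whose integral over every measurable
  set vanishes is \<open>0\<close> almost everywhere.
\<close>

lemma polynomials_determine_integrable:
  fixes \<phi> :: "'a::euclidean_space \<Rightarrow> real"
  assumes \<phi>: "integrable sphere_measure \<phi>" and poly: "\<And>q. real_polynomial_function q \<Longrightarrow> (\<integral>x. q x * \<phi> x \<partial>sphere_measure) = 0"
  shows "AE x in sphere_measure. \<phi> x = 0"
proof -
  have Bm: "B \<inter> sphere 0 1 \<in> sets sphere_measure" if "B \<in> sets borel" for B :: "'a set"
    using that by (auto simp: sets_sphere_measure sets_restrict_space)
  have int: "integrable sphere_measure (\<lambda>x. indicator (B \<inter> sphere 0 1) x * \<phi> x)" if "B \<in> sets borel" for B
    using integrable_mult_indicator[OF Bm[OF that] \<phi>] by simp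
  have zero: "(\<integral>x. indicator (B \<inter> sphere 0 1) x * \<phi> x \<partial>sphere_measure) = 0" if B: "B \<in> sets borel" for B
  proof -
    have Bs: "B \<in> sigma_sets UNIV {S. open S}" using B by (simp add: borel_def)
    have cl: "(\<integral>x. indicator (C \<inter> sphere 0 1) x * \<phi> x \<partial>sphere_measure) = 0" if "closed C" for C
    proof -
      have "(\<integral>x. indicator (C \<inter> sphere 0 1) x * \<phi> x \<partial>sphere_measure) = (\<integral>x. indicator C x * \<phi> x \<partial>sphere_measure)"
        by (rule Bochner_Integration.integral_cong) (auto simp: indicator_def)
      then show ?thesis using sphere_integral_closed_zero[OF \<phi> poly that] by simp
    qed
    have co: "(\<integral>x. indicator ((UNIV - A) \<inter> sphere 0 1) x * \<phi> x \<partial>sphere_measure) = 0"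
      if A: "A \<in> sets borel" and z: "(\<integral>x. indicator (A \<inter> sphere 0 1) x * \<phi> x \<partial>sphere_measure) = 0" for A
    proof -
      have "(\<integral>x. indicator ((UNIV - A) \<inter> sphere 0 1) x * \<phi> x \<partial>sphere_measure) =
         (\<integral>x. indicator (UNIV \<inter> sphere 0 1) x * \<phi> x - indicator (A \<inter> sphere 0 1) x * \<phi> x \<partial>sphere_measure)"
        by (rule Bochner_Integration.integral_cong) (auto simp: indicator_def)
      also have "\<dots> = 0" using z cl[of UNIV] int[of UNIV] int[OF A] by (subst Bochner_Integration.integral_diff) auto
      finally show ?thesis .
    qed
    have borelI: "A \<in> sets borel" if "A \<in> sigma_sets UNIV {S. open S}" for A :: "'a set"
      using that by (simp add: borel_def)
    have st: "Int_stable {S :: 'a set. open S}" by (auto simp: Int_stable_def)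
    have sub: "{S :: 'a set. open S} \<subseteq> Pow UNIV" by simp
    show ?thesis
      using st sub Bs
    proof (induction rule: sigma_sets_induct_disjoint)
      case (basic A)
      then have "closed (UNIV - A)" by (simp add: Compl_eq_Diff_UNIV[symmetric] closed_Compl)
      from co[OF _ cl[OF this]] basic show ?case by (auto simp: double_diff)
    next
      case empty show ?case by simp
    next
      case (compl A)
      then show ?case using co[OF borelI] by blast
    next
      case (union A)
      define D where "D = (\<lambda>i. A i \<inter> sphere 0 1)"
      have Ds: "D i \<in> sets sphere_measure" for i unfolding D_def using union borelI Bm by blast
      have "(LINT x:(\<Union>i. D i)|sphere_measure. \<phi> x) = (\<Sum>i. (LINT x:(D i)|sphere_measure. \<phi> x))"
      proof (rule lebesgue_integral_countable_add)
        show "D i \<inter> D j = {}" if "i \<noteq> j" for i j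
          using union(1) that by (auto simp: D_def disjoint_family_on_def)
        show "set_integrable sphere_measure (\<Union>i. D i) \<phi>"
          unfolding set_integrable_def by (rule integrable_mult_indicator[OF _ \<phi>]) (use Ds in blast)
      qed (rule Ds)
      also have "\<dots> = 0" using union by (simp add: set_lebesgue_integral_def D_def)
      finally show ?case by (simp add: set_lebesgue_integral_def D_def)
    qed
  qed
  show ?thesis
  proof (rule density_unique_real[OF \<phi>])
    show "integrable sphere_measure (\<lambda>x::'a. 0 :: real)" by simp
    fix A :: "'a set" assume "A \<in> sets sphere_measure"
    then obtain B where "B \<in> sets borel" "A = B \<inter> sphere 0 1"
      by (auto simp: sets_sphere_measure sets_restrict_space)
    then show "(LINT x:A|sphere_measure. \<phi> x) = (LINT x:A|sphere_measure. 0)"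
      using zero by (simp add: set_lebesgue_integral_def)
  qed
qed

definition orthogonal_to_harmonics :: "'a::euclidean_space sphere_l2 \<Rightarrow> bool" where
  "orthogonal_to_harmonics F \<longleftrightarrow> (\<forall>n. \<forall>Y\<in>spherical_harmonics n. F \<bullet> cls Y = 0)"

text \<open>
  A coordinate times a harmonic is a sum of two harmonics on the sphere, and multiplication by a
  coordinate is self-adjoint.  So the space orthogonal to all harmonics is a module over the
  polynomials.
\<close>

lemma orthogonal_to_harmonics_coord_mult:
  fixes F :: "'a::euclidean_space sphere_l2"
  assumes d: "2 \<le> DIM('a)" and F: "orthogonal_to_harmonics F" and b: "b \<in> Basis"
  shows "orthogonal_to_harmonics (coord_mult b F)"
  unfolding orthogonal_to_harmonics_def
proof (intro allI ballI)
  fix n and Y :: "'a \<Rightarrow> complex" assume Y: "Y \<in> spherical_harmonics n"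
  note sqY = spherical_harmonics_square_integrable[OF Y]
  obtain Z W where Z: "Z \<in> spherical_harmonics (Suc n)" and W: "W \<in> spherical_harmonics (n - 1)"
    and eq: "\<forall>x\<in>sphere 0 1. of_real (x \<bullet> b) * Y x = Z x + W x"
    using spherical_harmonics_coord_mult[OF d Y b] by blast
  note sq = spherical_harmonics_square_integrable[OF Z] spherical_harmonics_square_integrable[OF W]
  have "coord_mult b (cls Y) = cls (\<lambda>x. Z x + W x)"
    unfolding coord_mult_cls[OF sqY]
    by (rule cls_cong) (use eq sq sqY in \<open>auto intro: square_integrable_coord_mult square_integrable_add\<close>)
  also have "\<dots> = cls Z + cls W" by (rule cls_add[OF sq])
  finally show "coord_mult b F \<bullet> cls Y = 0"
    using F Z W unfolding coord_mult_inner by (auto simp: orthogonal_to_harmonics_def inner_add_right)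
qed

lemma orthogonal_to_harmonics_poly_mult:
  fixes f :: "'a::euclidean_space \<Rightarrow> complex"
  assumes d: "2 \<le> DIM('a)" and q: "real_polynomial_function q"
    and f: "square_integrable f" "orthogonal_to_harmonics (cls f)"
  shows "square_integrable (\<lambda>x. of_real (q x) * f x) \<and> orthogonal_to_harmonics (cls (\<lambda>x. of_real (q x) * f x))"
  using q f
proof (induction q arbitrary: f rule: real_polynomial_function.induct)
  case (linear h)
  have eq: "(\<lambda>x. of_real (h x) * f x) = (\<lambda>x. \<Sum>b\<in>Basis. h b *\<^sub>R (of_real (x \<bullet> b) * f x))"
  proof
    fix x
    have "h x = h (\<Sum>b\<in>Basis. (x \<bullet> b) *\<^sub>R b)" by (simp add: euclidean_representation)
    also have "\<dots> = (\<Sum>b\<in>Basis. h b * (x \<bullet> b))"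
      using bounded_linear.linear[OF linear(1)] by (simp add: linear_sum linear_cmul mult.commute)
    finally have "of_real (h x) * f x = (\<Sum>b\<in>Basis. of_real (h b) * of_real (x \<bullet> b)) * f x"
      by (simp only: of_real_sum of_real_mult)
    then show "of_real (h x) * f x = (\<Sum>b\<in>Basis. h b *\<^sub>R (of_real (x \<bullet> b) * f x))"
      by (simp add: sum_distrib_right scaleR_conv_of_real mult.assoc)
  qed
  have sq: "square_integrable (\<lambda>x. h b *\<^sub>R (of_real (x \<bullet> b) * f x))" for b
    by (intro square_integrable_scaleR square_integrable_coord_mult linear)
  have "cls (\<lambda>x. \<Sum>b\<in>Basis. h b *\<^sub>R (of_real (x \<bullet> b) * f x)) = (\<Sum>b\<in>Basis. h b *\<^sub>R coord_mult b (cls f))"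
    using linear by (simp add: cls_sum sq cls_scaleR square_integrable_coord_mult coord_mult_cls)
  moreover have "orthogonal_to_harmonics (\<Sum>b\<in>Basis. h b *\<^sub>R coord_mult b (cls f))"
    using orthogonal_to_harmonics_coord_mult[OF d linear(3)]
    by (auto simp: orthogonal_to_harmonics_def inner_sum_left)
  ultimately show ?case unfolding eq by (simp add: square_integrable_sum sq)
next
  case (const c)
  then show ?case
    using cls_scaleR[OF const(1), of c] square_integrable_scaleR[OF const(1), of c]
    by (auto simp: orthogonal_to_harmonics_def scaleR_conv_of_real)
next
  case (add p q)
  from add.IH(1)[OF add.prems] add.IH(2)[OF add.prems]
  show ?case by (auto simp: distrib_right square_integrable_add cls_add orthogonal_to_harmonics_def inner_add_left)
next
  case (mult p q)
  have "square_integrable (\<lambda>x. of_real (q x) * f x)" "orthogonal_to_harmonics (cls (\<lambda>x. of_real (q x) * f x))"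
    using mult.IH(2)[OF mult.prems] by auto
  from mult.IH(1)[OF this] show ?case by (simp add: mult.assoc)
qed

text \<open>
  All polynomial multiples of \<open>f\<close> are orthogonal to the constants \<open>1\<close> and, for \<open>d = 2\<close>, \<open>\<i>\<close>.  So the real
  and imaginary parts of \<open>f\<close> integrate to \<open>0\<close> against every polynomial.
\<close>

lemma spherical_harmonics_complete:
  fixes f :: "'a::euclidean_space \<Rightarrow> complex"
  assumes d: "2 \<le> DIM('a)" and f: "square_integrable f" "sphere_valued f" and orth: "orthogonal_to_harmonics (cls f)"
  shows "cls f = 0"
proof -
  have fi: "integrable sphere_measure f"
    using square_integrable_mult[OF f(1) square_integrable_const[of 1]] by simp
  have part: "(\<integral>x. q x * (f x \<bullet> c) \<partial>sphere_measure) = 0"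
    if c: "3 \<le> DIM('a) \<longrightarrow> c \<in> \<real>" and q: "real_polynomial_function q" for c q
  proof -
    note qf = orthogonal_to_harmonics_poly_mult[OF d q f(1) orth]
    have "cls (\<lambda>x. of_real (q x) * f x) \<bullet> cls (\<lambda>_. c) = 0"
      using conjunct2[OF qf] spherical_harmonics_const[of c] c unfolding orthogonal_to_harmonics_def by blast
    then have "(\<integral>x. (of_real (q x) * f x) \<bullet> c \<partial>sphere_measure) = 0"
      using sphere_area_pos[where 'a='a] inner_cls[OF conjunct1[OF qf] square_integrable_const[of c]] by simp
    moreover have "(of_real (q x) * f x) \<bullet> c = q x * (f x \<bullet> c)" for x
      by (simp add: inner_complex_def algebra_simps)
    ultimately show ?thesis by simp
  qed
  have Re: "AE x in sphere_measure. f x \<bullet> 1 = 0"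
    by (rule polynomials_determine_integrable) (use fi part[of 1] in auto)
  have Im: "AE x in sphere_measure. f x \<bullet> \<i> = 0"
  proof (cases "3 \<le> DIM('a)")
    case True
    then have "f x \<bullet> \<i> = 0" if "norm x = 1" for x
      using f(2) that by (auto simp: sphere_valued_def inner_complex_def complex_is_Real_iff)
    then show ?thesis by (intro AE_I2) simp
  next
    case False
    then show ?thesis by (intro polynomials_determine_integrable) (use fi part[of "\<i>"] in auto)
  qed
  have "AE x in sphere_measure. f x = 0"
    using Re Im by eventually_elim (simp add: inner_complex_def complex_eq_iff)
  then show ?thesis
    using cls_eq_iff[OF f(1) square_integrable_const[of 0]] by (simp add: cls_zero)
qed

subsection \<open>Projections and Parseval's identity\<close>

lemma sphere_L2_iff: "f \<in> sphere_L2 \<longleftrightarrow> square_integrable f \<and> sphere_valued f"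
  by (auto simp: sphere_L2_def square_integrable_def)

lemma spherical_harmonics_sphere_L2:
  "Y \<in> spherical_harmonics n \<Longrightarrow> Y \<in> sphere_L2"
  by (simp add: sphere_L2_iff spherical_harmonics_square_integrable) (simp add: spherical_harmonics_eq)

lemma continuous_cls_eq_0:
  fixes f :: "'a::euclidean_space \<Rightarrow> complex"
  assumes f: "continuous_on (sphere 0 1) f" and z: "cls f = 0" and x: "norm x = 1"
  shows "f x = 0"
proof -
  have sq: "square_integrable f" by (rule square_integrable_continuous[OF f])
  have "(\<integral>x. (norm (f x))\<^sup>2 \<partial>sphere_measure) / sphere_area TYPE('a) = 0"
    using norm_cls_eq_integral[OF sq] z by simp
  then have "(\<integral>x. (norm (f x))\<^sup>2 \<partial>sphere_measure) = 0" using sphere_area_pos[where 'a='a] by simp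
  then have "(norm (f x))\<^sup>2 = 0"
    by (intro sphere_zero_continuous[where F="\<lambda>x. (norm (f x))\<^sup>2"] continuous_intros f x) auto
  then show ?thesis by simp
qed

lemma spherical_harmonics_cls_eqD:
  assumes Y: "Y \<in> spherical_harmonics n" and Z: "Z \<in> spherical_harmonics n" and eq: "cls Y = cls Z" and x: "norm x = 1"
  shows "Y x = Z x"
proof -
  have "cls (\<lambda>x. Y x - Z x) = 0"
    using eq by (simp add: cls_diff spherical_harmonics_square_integrable[OF Y] spherical_harmonics_square_integrable[OF Z])
  from continuous_cls_eq_0[OF _ this x] show ?thesis
    using spherical_harmonics_continuous[OF Y] spherical_harmonics_continuous[OF Z]
    by (simp add: continuous_on_diff)
qed

text \<open>
  The real inner product determines the complex one: for \<open>d \<ge> 3\<close> all functions are real, and for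
  \<open>d = 2\<close> the harmonics are closed under multiplication by \<open>\<i>\<close>.
\<close>

lemma complex_orthogonal:
  fixes f Z :: "'a::euclidean_space \<Rightarrow> complex"
  assumes f: "f \<in> sphere_L2" and Z: "Z \<in> spherical_harmonics n"
    and orth: "\<And>Z. Z \<in> spherical_harmonics n \<Longrightarrow> cls f \<bullet> cls Z = 0"
  shows "(\<integral>x. f x * cnj (Z x) \<partial>sphere_measure) = 0"
proof -
  have sqf: "square_integrable f" using f by (simp add: sphere_L2_iff)
  have cnjsq: "square_integrable (\<lambda>x. cnj (Z x))"
    by (intro square_integrable_continuous continuous_intros spherical_harmonics_continuous[OF Z])
  have int: "integrable sphere_measure (\<lambda>x. f x * cnj (Z x))"
    by (rule square_integrable_mult[OF sqf cnjsq])
  have orth': "(\<integral>x. f x \<bullet> W x \<partial>sphere_measure) = 0" if W: "W \<in> spherical_harmonics n" for W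
    using orth[OF W] inner_cls[OF sqf spherical_harmonics_square_integrable[OF W]] sphere_area_pos[where 'a='a] by simp
  have "Re (\<integral>x. f x * cnj (Z x) \<partial>sphere_measure) = (\<integral>x. Re (f x * cnj (Z x)) \<partial>sphere_measure)"
    using integral_Re[OF int] by simp
  also have "\<dots> = (\<integral>x. f x \<bullet> Z x \<partial>sphere_measure)" by (simp add: inner_complex_def)
  finally have R: "Re (\<integral>x. f x * cnj (Z x) \<partial>sphere_measure) = 0" using orth'[OF Z] by simp
  have I: "Im (\<integral>x. f x * cnj (Z x) \<partial>sphere_measure) = (\<integral>x. Im (f x * cnj (Z x)) \<partial>sphere_measure)"
    using integral_Im[OF int] by simp
  have "(\<integral>x. Im (f x * cnj (Z x)) \<partial>sphere_measure) = 0"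
  proof (cases "3 \<le> DIM('a)")
    case True
    have "(\<integral>x. Im (f x * cnj (Z x)) \<partial>sphere_measure) = (\<integral>x. 0 \<partial>(sphere_measure :: 'a measure))"
    proof (rule Bochner_Integration.integral_cong[OF refl])
      fix x :: 'a assume "x \<in> space sphere_measure"
      then have "f x \<in> \<real>" "Z x \<in> \<real>"
        using True f Z by (auto simp: sphere_L2_iff spherical_harmonics_eq sphere_valued_def)
      then show "Im (f x * cnj (Z x)) = 0" by (auto simp: complex_is_Real_iff)
    qed
    then show ?thesis by simp
  next
    case False
    then have "(\<lambda>x. \<i> * Z x) \<in> spherical_harmonics n" by (intro spherical_harmonics_cmult[OF Z]) simp
    from orth'[OF this] show ?thesis by (simp add: inner_complex_def algebra_simps)
  qed
  then show ?thesis using R I by (simp add: complex_eq_iff)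
qed

lemma cls_inner_of_complex_orthogonal:
  fixes f Z :: "'a::euclidean_space \<Rightarrow> complex"
  assumes f: "square_integrable f" and Z: "Z \<in> spherical_harmonics n"
    and z: "(\<integral>x. f x * cnj (Z x) \<partial>sphere_measure) = 0"
  shows "cls f \<bullet> cls Z = 0"
proof -
  have cnjsq: "square_integrable (\<lambda>x. cnj (Z x))"
    by (intro square_integrable_continuous continuous_intros spherical_harmonics_continuous[OF Z])
  have int: "integrable sphere_measure (\<lambda>x. f x * cnj (Z x))"
    by (rule square_integrable_mult[OF f cnjsq])
  have "(\<integral>x. f x \<bullet> Z x \<partial>sphere_measure) = (\<integral>x. Re (f x * cnj (Z x)) \<partial>sphere_measure)"
    by (simp add: inner_complex_def)
  also have "\<dots> = Re (\<integral>x. f x * cnj (Z x) \<partial>sphere_measure)" using integral_Re[OF int] by simp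
  finally show ?thesis
    using z inner_cls[OF f spherical_harmonics_square_integrable[OF Z]] by simp
qed

lemma sphere_proj:
  fixes f :: "'a::euclidean_space \<Rightarrow> complex"
  assumes f: "f \<in> sphere_L2"
  shows sphere_proj_in: "sphere_proj n f \<in> spherical_harmonics n"
    and sphere_proj_orth: "Z \<in> spherical_harmonics n \<Longrightarrow> (cls f - cls (sphere_proj n f)) \<bullet> cls Z = 0"
proof -
  have sqf: "square_integrable f" using f by (simp add: sphere_L2_iff)
  let ?P = "\<lambda>Y. Y \<in> spherical_harmonics n \<and>
        (\<forall>Z\<in>spherical_harmonics n. (\<integral>x. (f x - Y x) * cnj (Z x) \<partial>sphere_measure) = 0)"
  have "\<exists>y\<in>harmonic_space n. \<forall>z\<in>harmonic_space n. (cls f - y) \<bullet> z = 0"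
    using harmonic_space_finite_span[of n] orthogonal_projection_finite_span[OF subspace_harmonic_space] by blast
  then obtain Y where Y: "Y \<in> spherical_harmonics n" "\<And>Z. Z \<in> spherical_harmonics n \<Longrightarrow> (cls f - cls Y) \<bullet> cls Z = 0"
    by (auto simp: harmonic_space_def)
  note sqY = spherical_harmonics_square_integrable[OF Y(1)]
  have "(\<lambda>x. f x - Y x) \<in> sphere_L2"
    using f spherical_harmonics_sphere_L2[OF Y(1)] by (auto simp: sphere_L2_iff square_integrable_diff sphere_valued_def)
  then have "?P Y"
    using Y by (auto intro!: complex_orthogonal simp: cls_diff sqf sqY)
  from someI[of ?P, OF this] have P: "?P (sphere_proj n f)" unfolding sphere_proj_def[of n f] .
  then show in': "sphere_proj n f \<in> spherical_harmonics n" by blast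
  note sqp = spherical_harmonics_square_integrable[OF in']
  assume Z: "Z \<in> spherical_harmonics n"
  have "cls (\<lambda>x. f x - sphere_proj n f x) \<bullet> cls Z = 0"
    by (rule cls_inner_of_complex_orthogonal[OF square_integrable_diff[OF sqf sqp] Z]) (use P Z in blast)
  then show "(cls f - cls (sphere_proj n f)) \<bullet> cls Z = 0" by (simp add: cls_diff sqf sqp)
qed

lemma sphere_proj_unique:
  assumes f: "f \<in> sphere_L2" and Y: "Y \<in> spherical_harmonics n"
    and orth: "\<And>Z. Z \<in> spherical_harmonics n \<Longrightarrow> (cls f - cls Y) \<bullet> cls Z = 0"
  shows "cls (sphere_proj n f) = cls Y"
proof -
  note P = sphere_proj_in[OF f, of n]
  note sq = spherical_harmonics_square_integrable[OF P] spherical_harmonics_square_integrable[OF Y]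
  have D: "cls (sphere_proj n f) - cls Y \<in> harmonic_space n"
    by (rule subspace_diff[OF subspace_harmonic_space]) (use P Y in \<open>auto simp: harmonic_space_def\<close>)
  have orth2: "(cls (sphere_proj n f) - cls Y) \<bullet> cls Z = 0" if "Z \<in> spherical_harmonics n" for Z
    using sphere_proj_orth[OF f that] orth[OF that] by (simp add: inner_diff_left)
  from D obtain W where W: "W \<in> spherical_harmonics n" "cls (sphere_proj n f) - cls Y = cls W" by (auto simp: harmonic_space_def)
  from orth2[OF W(1)] W(2) have "cls W \<bullet> cls W = 0" by simp
  then show ?thesis using W(2) by simp
qed

lemma sphere_proj_inner:
  assumes f: "f \<in> sphere_L2" and Z: "Z \<in> spherical_harmonics n"
  shows "cls f \<bullet> cls Z = cls (sphere_proj n f) \<bullet> cls Z"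
  using sphere_proj_orth[OF f Z] by (simp add: inner_diff_left)

text \<open>
  For \<open>d \<ge> 3\<close> a limit of real-valued functions is represented by the real part of any representative, since
  taking real parts brings a function closer to the real-valued ones.
\<close>

lemma sphere_L2_limit:
  fixes f :: "nat \<Rightarrow> 'a::euclidean_space \<Rightarrow> complex"
  assumes f: "\<And>k. f k \<in> sphere_L2" and lim: "(\<lambda>k. cls (f k)) \<longlonglongrightarrow> F"
  shows "\<exists>g\<in>sphere_L2. F = cls g"
proof -
  obtain g where g: "square_integrable g" "F = cls g" by (rule cls_cases)
  show ?thesis
  proof (cases "3 \<le> DIM('a)")
    case False
    then show ?thesis using g by (auto simp: sphere_L2_iff sphere_valued_def)
  next
    case True
    define h where "h = (\<lambda>x. complex_of_real (Re (g x)))"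
    have hs: "square_integrable h"
    proof (rule square_integrable_dom[OF g(1), of _ 1])
      show "h \<in> borel_measurable sphere_measure" unfolding h_def using square_integrableD[OF g(1)] by measurable
    qed (simp add: h_def abs_Re_le_cmod)
    have fs: "square_integrable (f k)" for k using f[of k] by (simp add: sphere_L2_iff)
    have le: "norm (cls (f k) - cls h) \<le> norm (cls (f k) - cls g)" for k
    proof -
      have "norm (cls (\<lambda>x. f k x - h x)) \<le> norm (cls (\<lambda>x. f k x - g x))"
      proof (rule norm_cls_le)
        fix x :: 'a assume "norm x = 1"
        then have "f k x \<in> \<real>" using f[of k] True by (auto simp: sphere_L2_iff sphere_valued_def)
        then have "f k x - h x = complex_of_real (Re (f k x - g x))"
          by (auto simp: h_def complex_eq_iff complex_is_Real_iff)
        then show "norm (f k x - h x) \<le> norm (f k x - g x)" using abs_Re_le_cmod[of "f k x - g x"] by (simp only: norm_of_real)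
      qed (intro square_integrable_diff fs g hs)+
      then show ?thesis by (simp add: cls_diff fs g(1) hs)
    qed
    have t0: "(\<lambda>k. norm (cls (f k) - cls g)) \<longlonglongrightarrow> 0"
      using lim unfolding g(2) by (simp add: tendsto_norm_zero LIM_zero)
    have "(\<lambda>k. cls (f k) - cls h) \<longlonglongrightarrow> 0"
      by (rule Lim_null_comparison[OF always_eventually t0]) (rule allI, rule le)
    then have "(\<lambda>k. cls (f k)) \<longlonglongrightarrow> cls h" by (simp add: LIM_zero_iff)
    then have "F = cls h" using lim LIMSEQ_unique by blast
    moreover have "h \<in> sphere_L2" using hs by (auto simp: sphere_L2_iff sphere_valued_def h_def)
    ultimately show ?thesis by blast
  qed
qed

lemma sphere_L2_sum: "(\<And>i. i \<in> A \<Longrightarrow> f i \<in> sphere_L2) \<Longrightarrow> (\<lambda>x. \<Sum>i\<in>A. f i x) \<in> sphere_L2"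
  by (auto simp: sphere_L2_iff square_integrable_sum sphere_valued_def)

text \<open>
  The Riesz--Fischer direction of the correspondence between functions and sequences of harmonics: it
  produces functions with prescribed projections, such as negative powers of the Laplace--Beltrami operator.
\<close>

lemma harmonic_series_limit:
  fixes Y :: "nat \<Rightarrow> 'a::euclidean_space \<Rightarrow> complex"
  assumes d: "2 \<le> DIM('a)" and Y: "\<And>n. Y n \<in> spherical_harmonics n" and sm: "summable (\<lambda>n. (norm (cls (Y n)))\<^sup>2)"
  shows "\<exists>g\<in>sphere_L2. (\<lambda>n. cls (Y n)) sums cls g \<and> (\<forall>n. cls (sphere_proj n g) = cls (Y n))"
proof -
  have orth: "cls (Y m) \<bullet> cls (Y n) = 0" if "m \<noteq> n" for m n
    by (rule spherical_harmonics_orthogonal[OF d Y Y that])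
  obtain F where F: "(\<lambda>n. cls (Y n)) sums F"
    using orthogonal_series_summable[OF orth sm] by (auto simp: summable_def)
  have lim: "(\<lambda>N. cls (\<lambda>x. \<Sum>n<N. Y n x)) \<longlonglongrightarrow> F"
    using F unfolding sums_def by (simp add: cls_sum spherical_harmonics_square_integrable[OF Y])
  have "\<exists>g\<in>sphere_L2. F = cls g"
    by (rule sphere_L2_limit[OF _ lim]) (intro sphere_L2_sum spherical_harmonics_sphere_L2[OF Y])
  then obtain g where g: "g \<in> sphere_L2" "F = cls g" by blast
  have "cls (sphere_proj n g) = cls (Y n)" for n
  proof (rule sphere_proj_unique[OF g(1) Y])
    fix Z :: "'a \<Rightarrow> complex" assume Z: "Z \<in> spherical_harmonics n"
    have "(\<lambda>m. cls (Y m) \<bullet> cls Z) sums (F \<bullet> cls Z)"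
      using bounded_linear.sums[OF bounded_linear_inner_left F] .
    moreover have "(\<lambda>m. cls (Y m) \<bullet> cls Z) sums (cls (Y n) \<bullet> cls Z)"
    proof -
      have "(\<lambda>m. cls (Y m) \<bullet> cls Z) = (\<lambda>m. if m = n then cls (Y m) \<bullet> cls Z else 0)"
        using spherical_harmonics_orthogonal[OF d Y Z] by auto
      then show ?thesis using sums_single[of n "\<lambda>m. cls (Y m) \<bullet> cls Z"] by simp
    qed
    ultimately have "F \<bullet> cls Z = cls (Y n) \<bullet> cls Z" by (rule sums_unique2)
    then show "(cls g - cls (Y n)) \<bullet> cls Z = 0" by (simp add: g(2)[symmetric] inner_diff_left)
  qed
  then show ?thesis using g F by blast
qed

lemma sphere_proj_orthogonal:
  fixes f :: "'a::euclidean_space \<Rightarrow> complex"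
  assumes "2 \<le> DIM('a)" "f \<in> sphere_L2" "g \<in> sphere_L2" "m \<noteq> n"
  shows "cls (sphere_proj m f) \<bullet> cls (sphere_proj n g) = 0"
  by (rule spherical_harmonics_orthogonal[OF assms(1) sphere_proj_in[OF assms(2)] sphere_proj_in[OF assms(3)] assms(4)])

lemma sphere_proj_inner_self:
  assumes "f \<in> sphere_L2"
  shows "cls f \<bullet> cls (sphere_proj n f) = (norm (cls (sphere_proj n f)))\<^sup>2"
  unfolding sphere_proj_inner[OF assms sphere_proj_in[OF assms]] by (rule power2_norm_eq_inner[symmetric])

text \<open>
  By Bessel's inequality the series of projections converges, to some \<open>g\<close> with the same projections as \<open>f\<close>.
  Then \<open>f - g\<close> is orthogonal to all harmonics, and completeness applies.
\<close>

theorem harmonic_expansion: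
  fixes f :: "'a::euclidean_space \<Rightarrow> complex"
  assumes d: "2 \<le> DIM('a)" and f: "f \<in> sphere_L2"
  shows "(\<lambda>n. cls (sphere_proj n f)) sums cls f"
    and Parseval: "(\<lambda>n. (norm (cls (sphere_proj n f)))\<^sup>2) sums (norm (cls f))\<^sup>2"
proof -
  let ?Y = "\<lambda>n. sphere_proj n f"
  have orth: "cls (?Y m) \<bullet> cls (?Y n) = 0" if "m \<noteq> n" for m n
    by (rule sphere_proj_orthogonal[OF d f f that])
  have "summable (\<lambda>n. (norm (cls (?Y n)))\<^sup>2)"
  proof (rule bounded_imp_summable)
    show "(\<Sum>k\<le>n. (norm (cls (?Y k)))\<^sup>2) \<le> (norm (cls f))\<^sup>2" for n
      by (rule Bessel_inequality[OF orth sphere_proj_inner_self[OF f]]) auto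
  qed simp
  from harmonic_series_limit[OF d sphere_proj_in[OF f] this]
  obtain g where g: "g \<in> sphere_L2" "(\<lambda>n. cls (?Y n)) sums cls g" "\<And>n. cls (sphere_proj n g) = cls (?Y n)" by blast
  have sq: "square_integrable f" "square_integrable g" using f g by (auto simp: sphere_L2_iff)
  have "cls (\<lambda>x. f x - g x) = 0"
  proof (rule spherical_harmonics_complete[OF d])
    show "square_integrable (\<lambda>x. f x - g x)" using sq by (rule square_integrable_diff)
    show "sphere_valued (\<lambda>x. f x - g x)" using f g(1) by (auto simp: sphere_L2_iff sphere_valued_def)
    show "orthogonal_to_harmonics (cls (\<lambda>x. f x - g x))"
      unfolding orthogonal_to_harmonics_def cls_diff[OF sq]
      by (auto simp: inner_diff_left sphere_proj_inner[OF f] sphere_proj_inner[OF g(1)] g(3))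
  qed
  then have "cls f = cls g" by (simp add: cls_diff sq)
  then show 1: "(\<lambda>n. cls (?Y n)) sums cls f" using g(2) by simp
  show "(\<lambda>n. (norm (cls (?Y n)))\<^sup>2) sums (norm (cls f))\<^sup>2"
    by (rule orthogonal_series_norm[OF orth 1])
qed

lemma harmonic_coefficients_determine:
  fixes f g :: "'a::euclidean_space \<Rightarrow> complex"
  assumes "2 \<le> DIM('a)" "f \<in> sphere_L2" "g \<in> sphere_L2" "\<And>n. cls (sphere_proj n f) = cls (sphere_proj n g)"
  shows "cls f = cls g"
proof -
  have "(\<lambda>n. cls (sphere_proj n g)) sums cls f"
    using harmonic_expansion(1)[OF assms(1,2)] by (simp add: assms(4))
  then show ?thesis using harmonic_expansion(1)[OF assms(1,3)] by (rule sums_unique2)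
qed

lemma zero_mean_iff:
  fixes f :: "'a::euclidean_space \<Rightarrow> complex"
  assumes f: "f \<in> sphere_L2"
  shows "(\<integral>y. f y \<partial>sphere_measure) = 0 \<longleftrightarrow> cls (sphere_proj 0 f) = 0"
proof
  assume z: "(\<integral>y. f y \<partial>sphere_measure) = 0"
  have sqf: "square_integrable f" using f by (simp add: sphere_L2_iff)
  have "cls (sphere_proj 0 f) = cls (\<lambda>_. 0)"
  proof (rule sphere_proj_unique[OF f])
    show "(\<lambda>_. 0) \<in> spherical_harmonics 0" by (rule spherical_harmonics_zero)
    fix Z :: "'a \<Rightarrow> complex" assume Z: "Z \<in> spherical_harmonics 0"
    then obtain p where p: "homogeneous_harmonic 0 p" "\<forall>x\<in>sphere 0 1. Z x = p x" by (auto simp: spherical_harmonics_eq)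
    have "(\<integral>x. f x * cnj (Z x) \<partial>sphere_measure) = (\<integral>x. f x * cnj (p 0) \<partial>sphere_measure)"
      by (rule Bochner_Integration.integral_cong) (use p homogeneous_harmonic_0[OF p(1)] in auto)
    also have "\<dots> = 0" using z by simp
    finally show "(cls f - cls (\<lambda>_. 0)) \<bullet> cls Z = 0"
      using cls_inner_of_complex_orthogonal[OF sqf Z] by (simp add: cls_zero)
  qed
  then show "cls (sphere_proj 0 f) = 0" by (simp add: cls_zero)
next
  assume z: "cls (sphere_proj 0 f) = 0"
  have "(\<lambda>_::'a. 1) \<in> spherical_harmonics 0" by (rule spherical_harmonics_const) simp
  from complex_orthogonal[OF f this] sphere_proj_orth[OF f, of _ 0] z
  show "(\<integral>y. f y \<partial>sphere_measure) = 0" by simp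
qed

subsection \<open>Powers of the Laplace--Beltrami operator\<close>

lemma is_neg_laplace_beltrami_powerD:
  fixes f g :: "'a::euclidean_space \<Rightarrow> complex"
  assumes f: "f \<in> sphere_L2" and g: "is_neg_laplace_beltrami_power r f g"
  shows "g \<in> sphere_L2" "cls (sphere_proj 0 g) = 0"
    "1 \<le> n \<Longrightarrow> cls (sphere_proj n g) = (eigenvalue TYPE('a) n powr r) *\<^sub>R cls (sphere_proj n f)"
proof -
  show gL: "g \<in> sphere_L2" using g by (simp add: is_neg_laplace_beltrami_power_def)
  note P = spherical_harmonics_square_integrable[OF sphere_proj_in[OF gL]]
  note Pf = spherical_harmonics_square_integrable[OF sphere_proj_in[OF f]]
  have "cls (sphere_proj 0 g) = cls (\<lambda>_. 0)"
    by (rule cls_cong[OF P square_integrable_const]) (use g in \<open>simp add: is_neg_laplace_beltrami_power_def\<close>)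
  then show "cls (sphere_proj 0 g) = 0" by (simp add: cls_zero)
  assume n: "1 \<le> n"
  have "cls (sphere_proj n g) = cls (\<lambda>x. (eigenvalue TYPE('a) n powr r) *\<^sub>R sphere_proj n f x)"
    by (rule cls_cong[OF P square_integrable_scaleR[OF Pf]]) (use g n in \<open>simp add: is_neg_laplace_beltrami_power_def eigenvalue_def\<close>)
  then show "cls (sphere_proj n g) = (eigenvalue TYPE('a) n powr r) *\<^sub>R cls (sphere_proj n f)"
    by (simp add: cls_scaleR Pf)
qed

lemma is_neg_laplace_beltrami_powerI:
  fixes f g :: "'a::euclidean_space \<Rightarrow> complex"
  assumes f: "f \<in> sphere_L2" and g: "g \<in> sphere_L2" and 0: "cls (sphere_proj 0 g) = 0"
    and n: "\<And>n. 1 \<le> n \<Longrightarrow> cls (sphere_proj n g) = (eigenvalue TYPE('a) n powr r) *\<^sub>R cls (sphere_proj n f)"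
  shows "is_neg_laplace_beltrami_power r f g"
  unfolding is_neg_laplace_beltrami_power_def
proof (intro conjI allI impI ballI g)
  fix x :: 'a assume x: "x \<in> sphere 0 1"
  show "sphere_proj 0 g x = 0"
    using spherical_harmonics_cls_eqD[OF sphere_proj_in[OF g] spherical_harmonics_zero[of 0], of x] 0 x by (simp add: cls_zero)
  fix n :: nat assume n1: "1 \<le> n"
  note Pf = spherical_harmonics_square_integrable[OF sphere_proj_in[OF f]]
  have "sphere_proj n g x = (eigenvalue TYPE('a) n powr r) *\<^sub>R sphere_proj n f x"
    by (rule spherical_harmonics_cls_eqD[OF sphere_proj_in[OF g] spherical_harmonics_scaleR[OF sphere_proj_in[OF f]]])
       (use n[OF n1] x in \<open>simp_all add: cls_scaleR Pf\<close>)
  then show "sphere_proj n g x = ((real n * (real n + real DIM('a) - 2)) powr r) *\<^sub>R sphere_proj n f x"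
    by (simp add: eigenvalue_def)
qed

lemma neg_laplace_beltrami_power_eq:
  fixes f g :: "'a::euclidean_space \<Rightarrow> complex"
  assumes d: "2 \<le> DIM('a)" and f: "f \<in> sphere_L2" and g: "is_neg_laplace_beltrami_power r f g"
  shows "neg_laplace_beltrami_power r f \<in> sphere_L2" "cls (neg_laplace_beltrami_power r f) = cls g"
proof -
  have h: "is_neg_laplace_beltrami_power r f (neg_laplace_beltrami_power r f)"
    using someI[of "is_neg_laplace_beltrami_power r f", OF g] unfolding neg_laplace_beltrami_power_def .
  note H = is_neg_laplace_beltrami_powerD[OF f h] and G = is_neg_laplace_beltrami_powerD[OF f g]
  show "neg_laplace_beltrami_power r f \<in> sphere_L2" by (rule H(1))
  show "cls (neg_laplace_beltrami_power r f) = cls g"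
  proof (rule harmonic_coefficients_determine[OF d H(1) G(1)])
    show "cls (sphere_proj n (neg_laplace_beltrami_power r f)) = cls (sphere_proj n g)" for n
      using H(2,3) G(2,3) by (cases "n = 0") auto
  qed
qed

section \<open>The spherical gradient\<close>

lemma radial_extension_sum: "radial_extension (\<lambda>x. \<Sum>i\<in>A. u i x) = (\<lambda>x. \<Sum>i\<in>A. radial_extension (u i) x)"
  by (simp add: radial_extension_def fun_eq_iff)

lemma sphere_C1_sum:
  fixes u :: "'i \<Rightarrow> 'a::euclidean_space \<Rightarrow> complex"
  assumes A: "finite A" and u: "\<And>i. i \<in> A \<Longrightarrow> u i \<in> sphere_C1"
  shows "(\<lambda>x. \<Sum>i\<in>A. u i x) \<in> sphere_C1"
    and "x \<noteq> 0 \<Longrightarrow> partial_deriv b (radial_extension (\<lambda>x. \<Sum>i\<in>A. u i x)) x = (\<Sum>i\<in>A. partial_deriv b (radial_extension (u i)) x)"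
proof -
  show eq: "partial_deriv b (radial_extension (\<lambda>x. \<Sum>i\<in>A. u i x)) x = (\<Sum>i\<in>A. partial_deriv b (radial_extension (u i)) x)"
    if "x \<noteq> 0" for x b
    unfolding radial_extension_sum by (rule partial_deriv_sum[OF A sphere_C1D(1)[OF u that]])
  show "(\<lambda>x. \<Sum>i\<in>A. u i x) \<in> sphere_C1"
    unfolding sphere_C1_def
  proof (intro CollectI conjI allI impI ballI)
    show "sphere_valued (\<lambda>x. \<Sum>i\<in>A. u i x)"
      using sphere_C1D(3)[OF u] by (auto simp: sphere_valued_def)
    show "radial_extension (\<lambda>x. \<Sum>i\<in>A. u i x) differentiable at x" if "x \<noteq> 0" for x
      unfolding radial_extension_sum by (rule differentiable_sum[OF A]) (use sphere_C1D(1)[OF u that] in blast)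
    fix b :: 'a assume b: "b \<in> Basis"
    have "continuous_on (- {0}) (\<lambda>x. \<Sum>i\<in>A. partial_deriv b (radial_extension (u i)) x)"
      by (intro continuous_on_sum sphere_C1D(2)[OF u b])
    then show "continuous_on (- {0}) (partial_deriv b (radial_extension (\<lambda>x. \<Sum>i\<in>A. u i x)))"
      by (subst continuous_on_cong[of "- {0}" "- {0}" _ "\<lambda>x. \<Sum>i\<in>A. partial_deriv b (radial_extension (u i)) x"]) (auto simp: eq)
  qed
qed

lemma grad_sum:
  fixes u :: "'i \<Rightarrow> 'a::euclidean_space \<Rightarrow> complex"
  assumes A: "finite A" and u: "\<And>i. i \<in> A \<Longrightarrow> u i \<in> sphere_C1" and b: "b \<in> Basis"
  shows "grad b (\<lambda>x. \<Sum>i\<in>A. u i x) = (\<Sum>i\<in>A. grad b (u i))"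
proof -
  note sq = sphere_C1_square_integrable(2)[OF u b]
  have "grad b (\<lambda>x. \<Sum>i\<in>A. u i x) = cls (\<lambda>x. \<Sum>i\<in>A. partial_deriv b (radial_extension (u i)) x)"
    unfolding grad_def
  proof (rule cls_cong)
    show "square_integrable (partial_deriv b (radial_extension (\<lambda>x. \<Sum>i\<in>A. u i x)))"
      by (rule sphere_C1_square_integrable(2)[OF sphere_C1_sum(1)[OF A u] b])
    show "square_integrable (\<lambda>x. \<Sum>i\<in>A. partial_deriv b (radial_extension (u i)) x)"
      by (rule square_integrable_sum) (rule sq)
    fix x :: 'a assume "norm x = 1"
    then have "x \<noteq> 0" by auto
    then show "partial_deriv b (radial_extension (\<lambda>x. \<Sum>i\<in>A. u i x)) x = (\<Sum>i\<in>A. partial_deriv b (radial_extension (u i)) x)"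
      using sphere_C1_sum(2)[OF A, of u x b] u by blast
  qed
  also have "\<dots> = (\<Sum>i\<in>A. grad b (u i))" unfolding grad_def by (rule cls_sum) (rule sq)
  finally show ?thesis .
qed

lemma grad_sphere_L2:
  fixes u :: "'a::euclidean_space \<Rightarrow> complex"
  assumes u: "u \<in> sphere_C1" and b: "b \<in> Basis"
  shows "partial_deriv b (radial_extension u) \<in> sphere_L2"
  unfolding sphere_L2_iff
proof
  show "square_integrable (partial_deriv b (radial_extension u))" by (rule sphere_C1_square_integrable(2)[OF u b])
  show "sphere_valued (partial_deriv b (radial_extension u))"
    unfolding sphere_valued_def
  proof (intro impI ballI)
    fix x :: 'a assume d: "3 \<le> DIM('a)" and x: "x \<in> sphere 0 1"
    then have x0: "x \<noteq> 0" by auto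
    have real: "radial_extension u y \<in> \<real>" if "y \<noteq> 0" for y
      using sphere_C1D(3)[OF u] d that by (simp add: sphere_valued_def radial_extension_def)
    have ev: "\<forall>\<^sub>F y in nhds x. radial_extension u y = cnj (radial_extension u y)"
    proof -
      have "\<forall>\<^sub>F y in nhds x. y \<in> - {0}" by (rule eventually_nhds_in_open) (use x0 in auto)
      then show ?thesis
      proof eventually_elim
        case (elim y)
        then show ?case using real[of y] by (simp add: Reals_cnj_iff)
      qed
    qed
    have D: "radial_extension u differentiable (at x)" by (rule sphere_C1D(1)[OF u x0])
    from partial_deriv_cong_nhds[OF ev D, of b] partial_deriv_cnj[OF D, of b]
    show "partial_deriv b (radial_extension u) x \<in> \<real>" by (simp add: Reals_cnj_iff)
  qed
qed

lemma energy_orthogonal: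
  fixes Y :: "nat \<Rightarrow> 'a::euclidean_space \<Rightarrow> complex"
  assumes d: "2 \<le> DIM('a)" and Y: "\<And>n. Y n \<in> spherical_harmonics n" and I: "finite I"
  shows "(\<Sum>b\<in>Basis. (norm (\<Sum>n\<in>I. grad b (Y n)))\<^sup>2) = (\<Sum>n\<in>I. eigenvalue TYPE('a) n * (norm (cls (Y n)))\<^sup>2)"
proof -
  have "(\<Sum>b\<in>Basis. (norm (\<Sum>n\<in>I. grad b (Y n)))\<^sup>2) = (\<Sum>b\<in>Basis. \<Sum>n\<in>I. \<Sum>m\<in>I. grad b (Y m) \<bullet> grad b (Y n))"
    unfolding power2_norm_eq_inner inner_sum_right inner_sum_left ..
  also have "\<dots> = (\<Sum>n\<in>I. \<Sum>m\<in>I. \<Sum>b\<in>Basis. grad b (Y m) \<bullet> grad b (Y n))"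
    by (subst sum.swap, rule sum.cong[OF refl], rule sum.swap)
  also have "\<dots> = (\<Sum>n\<in>I. \<Sum>m\<in>I. eigenvalue TYPE('a) n * (cls (Y m) \<bullet> cls (Y n)))"
    by (intro sum.cong refl Green_identity_l2 spherical_harmonics_C1[OF Y] Y)
  also have "\<dots> = (\<Sum>n\<in>I. \<Sum>m\<in>I. if m = n then eigenvalue TYPE('a) n * (norm (cls (Y n)))\<^sup>2 else 0)"
    by (intro sum.cong refl)
       (use spherical_harmonics_orthogonal[OF d Y Y] in \<open>auto simp: power2_norm_eq_inner\<close>)
  also have "\<dots> = (\<Sum>n\<in>I. eigenvalue TYPE('a) n * (norm (cls (Y n)))\<^sup>2)"
    using I by (intro sum.cong refl) simp
  finally show ?thesis .
qed

text \<open>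
  The partial sums of the harmonic expansion serve as smooth approximations: by \<open>energy_orthogonal\<close> their
  gradients form a Cauchy sequence in each component.
\<close>

lemma sphere_gradient_exists:
  fixes f :: "'a::euclidean_space \<Rightarrow> complex"
  assumes d: "2 \<le> DIM('a)" and f: "f \<in> sphere_L2"
    and sm: "summable (\<lambda>n. eigenvalue TYPE('a) n * (norm (cls (sphere_proj n f)))\<^sup>2)"
  shows "\<exists>G. has_sphere_gradient f G"
proof -
  let ?Y = "\<lambda>n. sphere_proj n f"
  note Y = sphere_proj_in[OF f]
  note YC = spherical_harmonics_C1[OF Y]
  have sqf: "square_integrable f" using f by (simp add: sphere_L2_iff)
  define u where "u = (\<lambda>N x. \<Sum>n<N. ?Y n x)"
  have uC: "u N \<in> sphere_C1" for N unfolding u_def by (rule sphere_C1_sum(1)[OF _ YC]) simp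
  have gu: "grad b (u N) = (\<Sum>n<N. grad b (?Y n))" if "b \<in> Basis" for b N
    unfolding u_def by (rule grad_sum[OF _ YC that]) simp
  have summ: "summable (\<lambda>n. grad b (?Y n))" if b: "b \<in> Basis" for b
    unfolding summable_Cauchy
  proof (intro allI impI)
    fix e :: real assume e: "e > 0"
    then obtain N where N: "\<And>m n. m \<ge> N \<Longrightarrow> norm (\<Sum>i=m..<n. eigenvalue TYPE('a) i * (norm (cls (?Y i)))\<^sup>2) < e\<^sup>2"
      using sm unfolding summable_Cauchy by (meson zero_less_power)
    have "norm (\<Sum>i=m..<n. grad b (?Y i)) < e" if "m \<ge> N" for m n
    proof (rule power2_less_imp_less)
      have "(norm (\<Sum>i=m..<n. grad b (?Y i)))\<^sup>2 \<le> (\<Sum>b\<in>Basis. (norm (\<Sum>i=m..<n. grad b (?Y i)))\<^sup>2)"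
        by (rule member_le_sum[OF b]) auto
      also have "\<dots> = (\<Sum>i=m..<n. eigenvalue TYPE('a) i * (norm (cls (?Y i)))\<^sup>2)"
        by (rule energy_orthogonal[OF d Y]) simp
      also have "\<dots> < e\<^sup>2" using N[OF that, of n] by (simp add: abs_less_iff)
      finally show "(norm (\<Sum>i=m..<n. grad b (?Y i)))\<^sup>2 < e\<^sup>2" .
    qed (use e in simp)
    then show "\<exists>N. \<forall>m\<ge>N. \<forall>n. norm (\<Sum>i=m..<n. grad b (?Y i)) < e" by blast
  qed
  have "\<exists>g\<in>sphere_L2. (\<lambda>N. grad b (u N)) \<longlonglongrightarrow> cls g" if b: "b \<in> Basis" for b
  proof -
    obtain F where "(\<lambda>n. grad b (?Y n)) sums F" using summ[OF b] by (auto simp: summable_def)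
    then have F: "(\<lambda>N. grad b (u N)) \<longlonglongrightarrow> F" unfolding sums_def gu[OF b] .
    have "\<exists>g\<in>sphere_L2. F = cls g"
      by (rule sphere_L2_limit[OF grad_sphere_L2[OF uC b] F[unfolded grad_def]])
    then show ?thesis using F by blast
  qed
  then obtain g where g: "\<And>b. b \<in> Basis \<Longrightarrow> g b \<in> sphere_L2" "\<And>b. b \<in> Basis \<Longrightarrow> (\<lambda>N. grad b (u N)) \<longlonglongrightarrow> cls (g b)"
    by metis
  have "has_sphere_gradient f (\<lambda>x b. g b x)"
    unfolding has_sphere_gradient_def
  proof (intro conjI ballI f exI[of _ u] allI uC)
    show "(\<lambda>x. g b x) \<in> sphere_L2" if "b \<in> Basis" for b using g(1)[OF that] by simp
    have squ: "square_integrable (u N)" for N by (rule sphere_C1_square_integrable(1)[OF uC])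
    have "(\<lambda>N. cls (u N)) \<longlonglongrightarrow> cls f"
      using harmonic_expansion(1)[OF d f] unfolding sums_def u_def
      by (simp add: cls_sum spherical_harmonics_square_integrable[OF Y])
    then have "(\<lambda>N. norm (cls (u N) - cls f)) \<longlonglongrightarrow> 0" by (simp add: tendsto_norm_zero LIM_zero)
    then show "(\<lambda>k. sphere_norm (\<lambda>x. u k x - f x)) \<longlonglongrightarrow> 0"
      by (simp add: norm_cls[symmetric] square_integrable_diff squ sqf cls_diff)
    fix b :: 'a assume b: "b \<in> Basis"
    have sq: "square_integrable (partial_deriv b (radial_extension (u N)))" for N
      by (rule sphere_C1_square_integrable(2)[OF uC b])
    have sqg: "square_integrable (g b)" using g(1)[OF b] by (simp add: sphere_L2_iff)
    have "(\<lambda>N. norm (grad b (u N) - cls (g b))) \<longlonglongrightarrow> 0" using g(2)[OF b] by (simp add: tendsto_norm_zero LIM_zero)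
    then show "(\<lambda>k. sphere_norm (\<lambda>x. partial_deriv b (radial_extension (u k)) x - g b x)) \<longlonglongrightarrow> 0"
      by (simp add: norm_cls[symmetric] square_integrable_diff sq sqg cls_diff grad_def)
  qed
  then show ?thesis by blast
qed

lemma has_sphere_gradient_limit:
  fixes f :: "'a::euclidean_space \<Rightarrow> complex"
  assumes "has_sphere_gradient f G"
  obtains u where "\<And>k. u k \<in> sphere_C1" "(\<lambda>k. cls (u k)) \<longlonglongrightarrow> cls f"
    "\<And>b. b \<in> Basis \<Longrightarrow> (\<lambda>k. grad b (u k)) \<longlonglongrightarrow> cls (\<lambda>x. G x b)"
proof -
  have G: "square_integrable (\<lambda>x. G x b)" if "b \<in> Basis" for b
    using assms that by (auto simp: has_sphere_gradient_def sphere_L2_iff)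
  have f: "square_integrable f" using assms by (simp add: has_sphere_gradient_def sphere_L2_iff)
  obtain u where u: "\<And>k. u k \<in> sphere_C1"
    and 0: "(\<lambda>k. sphere_norm (\<lambda>x. u k x - f x)) \<longlonglongrightarrow> 0"
    and 1: "\<And>b. b \<in> Basis \<Longrightarrow> (\<lambda>k. sphere_norm (\<lambda>x. partial_deriv b (radial_extension (u k)) x - G x b)) \<longlonglongrightarrow> 0"
    using assms unfolding has_sphere_gradient_def by blast
  have squ: "square_integrable (u k)" for k by (rule sphere_C1_square_integrable(1)[OF u])
  show ?thesis
  proof (rule that[OF u])
    have "(\<lambda>k. norm (cls (u k) - cls f)) \<longlonglongrightarrow> 0"
      using 0 by (simp add: norm_cls[symmetric] square_integrable_diff squ f cls_diff)
    then show "(\<lambda>k. cls (u k)) \<longlonglongrightarrow> cls f" by (simp add: tendsto_norm_zero_iff LIM_zero_iff)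
    fix b :: 'a assume b: "b \<in> Basis"
    have sq: "square_integrable (partial_deriv b (radial_extension (u k)))" for k
      by (rule sphere_C1_square_integrable(2)[OF u b])
    have "(\<lambda>k. norm (grad b (u k) - cls (\<lambda>x. G x b))) \<longlonglongrightarrow> 0"
      using 1[OF b] by (simp add: norm_cls[symmetric] square_integrable_diff sq G[OF b] cls_diff grad_def)
    then show "(\<lambda>k. grad b (u k)) \<longlonglongrightarrow> cls (\<lambda>x. G x b)" by (simp add: tendsto_norm_zero_iff LIM_zero_iff)
  qed
qed

lemma sphere_gradient_norm_eq:
  fixes f :: "'a::euclidean_space \<Rightarrow> complex"
  assumes "has_sphere_gradient f (sphere_gradient f)"
  shows "(sphere_gradient_norm f)\<^sup>2 = (\<Sum>b\<in>Basis. (norm (cls (\<lambda>x. sphere_gradient f x b)))\<^sup>2)"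
proof -
  let ?G = "sphere_gradient f"
  have G: "square_integrable (\<lambda>x. ?G x b)" if "b \<in> Basis" for b
    using assms that by (auto simp: has_sphere_gradient_def sphere_L2_iff)
  have nn: "0 \<le> (\<Sum>b\<in>Basis. (norm (?G x b))\<^sup>2)" for x by (simp add: sum_nonneg)
  have I: "(\<integral>x. (\<Sum>b\<in>Basis. (norm (?G x b))\<^sup>2) \<partial>sphere_measure) = (\<Sum>b\<in>Basis. \<integral>x. (norm (?G x b))\<^sup>2 \<partial>sphere_measure)"
    by (rule Bochner_Integration.integral_sum) (rule square_integrable_norm2[OF G])
  have "(sphere_gradient_norm f)\<^sup>2 = 1 / sphere_area TYPE('a) * (\<integral>x. (\<Sum>b\<in>Basis. (norm (?G x b))\<^sup>2) \<partial>sphere_measure)"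
    unfolding sphere_gradient_norm_def sphere_norm_def using sphere_area_pos[where 'a='a] nn
    by (simp add: sum_nonneg)
  also have "\<dots> = (\<Sum>b\<in>Basis. (\<integral>x. (norm (?G x b))\<^sup>2 \<partial>sphere_measure) / sphere_area TYPE('a))"
    unfolding I by (simp add: sum_divide_distrib)
  also have "\<dots> = (\<Sum>b\<in>Basis. (norm (cls (\<lambda>x. ?G x b)))\<^sup>2)"
    by (intro sum.cong refl norm_cls_eq_integral[symmetric] G)
  finally show ?thesis .
qed

text \<open>
  Let \<open>S\<close> be the gradient of a partial sum of the harmonic expansion.  Green's identity passes to the limit
  and gives \<open>G \<bullet> S = S \<bullet> S\<close>, and \<open>S \<bullet> S\<close> is the sum on the left.  The claim is that
  \<open>(G - S) \<bullet> (G - S)\<close> is nonnegative.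
\<close>

lemma gradient_Bessel:
  fixes f :: "'a::euclidean_space \<Rightarrow> complex"
  assumes d: "2 \<le> DIM('a)" and G: "has_sphere_gradient f G"
  shows "(\<Sum>n<N. eigenvalue TYPE('a) n * (norm (cls (sphere_proj n f)))\<^sup>2) \<le> (\<Sum>b\<in>Basis. (norm (cls (\<lambda>x. G x b)))\<^sup>2)"
proof -
  have f: "f \<in> sphere_L2" using G by (simp add: has_sphere_gradient_def)
  note Y = sphere_proj_in[OF f]
  let ?Y = "\<lambda>n. sphere_proj n f"
  obtain u where u: "\<And>k. u k \<in> sphere_C1" "(\<lambda>k. cls (u k)) \<longlonglongrightarrow> cls f"
    "\<And>b. b \<in> Basis \<Longrightarrow> (\<lambda>k. grad b (u k)) \<longlonglongrightarrow> cls (\<lambda>x. G x b)"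
    by (rule has_sphere_gradient_limit[OF G]) blast
  define S where "S = (\<lambda>b. \<Sum>n<N. grad b (?Y n))"
  define L where "L = (\<Sum>n<N. eigenvalue TYPE('a) n * (norm (cls (?Y n)))\<^sup>2)"
  have S2: "(\<Sum>b\<in>Basis. (norm (S b))\<^sup>2) = L" unfolding S_def L_def by (rule energy_orthogonal[OF d Y]) simp
  have eq: "(\<Sum>b\<in>Basis. grad b (u k) \<bullet> S b) = (\<Sum>n<N. eigenvalue TYPE('a) n * (cls (u k) \<bullet> cls (?Y n)))" for k
  proof -
    have "(\<Sum>b\<in>Basis. grad b (u k) \<bullet> S b) = (\<Sum>n<N. \<Sum>b\<in>Basis. grad b (u k) \<bullet> grad b (?Y n))"
      unfolding S_def inner_sum_right by (rule sum.swap)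
    then show ?thesis using Green_identity_l2[OF u(1) Y] by simp
  qed
  have "(\<lambda>k. \<Sum>b\<in>Basis. grad b (u k) \<bullet> S b) \<longlonglongrightarrow> (\<Sum>b\<in>Basis. cls (\<lambda>x. G x b) \<bullet> S b)"
    by (intro tendsto_intros u(3))
  moreover have "(\<lambda>k. \<Sum>b\<in>Basis. grad b (u k) \<bullet> S b) \<longlonglongrightarrow> (\<Sum>n<N. eigenvalue TYPE('a) n * (cls f \<bullet> cls (?Y n)))"
    unfolding eq by (intro tendsto_intros u(2))
  ultimately have "(\<Sum>b\<in>Basis. cls (\<lambda>x. G x b) \<bullet> S b) = (\<Sum>n<N. eigenvalue TYPE('a) n * (cls f \<bullet> cls (?Y n)))"
    by (rule LIMSEQ_unique)
  then have GS: "(\<Sum>b\<in>Basis. cls (\<lambda>x. G x b) \<bullet> S b) = L"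
    by (simp add: L_def sphere_proj_inner_self[OF f])
  have "0 \<le> (\<Sum>b\<in>Basis. (norm (cls (\<lambda>x. G x b) - S b))\<^sup>2)" by (simp add: sum_nonneg)
  also have "\<dots> = (\<Sum>b\<in>Basis. (norm (cls (\<lambda>x. G x b)))\<^sup>2 - 2 * (cls (\<lambda>x. G x b) \<bullet> S b) + (norm (S b))\<^sup>2)"
    by (intro sum.cong refl) (simp add: power2_norm_eq_inner inner_diff_left inner_diff_right inner_commute)
  also have "\<dots> = (\<Sum>b\<in>Basis. (norm (cls (\<lambda>x. G x b)))\<^sup>2) - 2 * L + L"
    by (simp add: sum.distrib sum_subtractf S2 GS[symmetric] sum_distrib_left)
  finally show ?thesis by (simp add: L_def)
qed

lemma sphere_W21_gradient:
  fixes f :: "'a::euclidean_space \<Rightarrow> complex"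
  assumes d: "2 \<le> DIM('a)" and f: "f \<in> sphere_W21"
  shows "f \<in> sphere_L2" "has_sphere_gradient f (sphere_gradient f)"
proof -
  obtain g where fL: "f \<in> sphere_L2" and g: "is_neg_laplace_beltrami_power (1/2) f g"
    using f by (auto simp: sphere_W21_def)
  show "f \<in> sphere_L2" by (rule fL)
  note gD = is_neg_laplace_beltrami_powerD[OF fL g]
  have "eigenvalue TYPE('a) n * (norm (cls (sphere_proj n f)))\<^sup>2 = (norm (cls (sphere_proj n g)))\<^sup>2" for n
  proof (cases "n = 0")
    case False
    then have "eigenvalue TYPE('a) n \<ge> 0" using eigenvalue_ge[OF d, of n] d by simp
    then show ?thesis using gD(3)[of n] False
      by (simp add: power_mult_distrib powr_half_sqrt)
  qed (simp add: gD(2))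
  then have "summable (\<lambda>n. eigenvalue TYPE('a) n * (norm (cls (sphere_proj n f)))\<^sup>2)"
    using harmonic_expansion(2)[OF d gD(1)] by (simp add: sums_iff)
  then have "\<exists>G. has_sphere_gradient f G" by (rule sphere_gradient_exists[OF d fL])
  then show "has_sphere_gradient f (sphere_gradient f)" unfolding sphere_gradient_def by (rule someI_ex)
qed

section \<open>Weights linear in the position\<close>

lemma weighted_integral:
  fixes f :: "'a::euclidean_space \<Rightarrow> complex"
  assumes f: "square_integrable f"
  shows "(\<integral>x. (1 - x \<bullet> e) * (norm (f x))\<^sup>2 \<partial>sphere_measure) =
     sphere_area TYPE('a) * ((norm (cls f))\<^sup>2 - coord_mult e (cls f) \<bullet> cls f)"
proof -
  have xf: "square_integrable (\<lambda>x. of_real (x \<bullet> e) * f x)" by (rule square_integrable_coord_mult[OF f])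
  have 1: "(of_real (x \<bullet> e) * f x) \<bullet> f x = (x \<bullet> e) * (norm (f x))\<^sup>2" for x
    by (simp add: power2_norm_eq_inner inner_complex_def algebra_simps)
  have int: "integrable sphere_measure (\<lambda>x. (x \<bullet> e) * (norm (f x))\<^sup>2)"
    using square_integrable_inner[OF xf f] unfolding 1 .
  have "coord_mult e (cls f) \<bullet> cls f = (\<integral>x. (x \<bullet> e) * (norm (f x))\<^sup>2 \<partial>sphere_measure) / sphere_area TYPE('a)"
    unfolding coord_mult_cls[OF f] inner_cls[OF xf f] 1 ..
  moreover have "(\<integral>x. (1 - x \<bullet> e) * (norm (f x))\<^sup>2 \<partial>sphere_measure) =
     (\<integral>x. (norm (f x))\<^sup>2 \<partial>sphere_measure) - (\<integral>x. (x \<bullet> e) * (norm (f x))\<^sup>2 \<partial>sphere_measure)"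
    unfolding left_diff_distrib using square_integrable_norm2[OF f] int by simp
  ultimately show ?thesis
    using sphere_area_pos[where 'a='a] by (simp add: norm_cls_eq_integral[OF f] right_diff_distrib)
qed

lemma coord_mult_sum: "coord_mult e F = (\<Sum>b\<in>Basis. (e \<bullet> b) *\<^sub>R coord_mult b F)"
proof -
  obtain f where f: "square_integrable f" "F = cls f" by (rule cls_cases)
  have xf: "square_integrable (\<lambda>x. of_real (x \<bullet> b) * f x)" for b by (rule square_integrable_coord_mult[OF f(1)])
  have "of_real (x \<bullet> e) * f x = (\<Sum>b\<in>Basis. (e \<bullet> b) *\<^sub>R (of_real (x \<bullet> b) * f x))" for x
  proof -
    have "complex_of_real (x \<bullet> e) = (\<Sum>b\<in>Basis. complex_of_real ((x \<bullet> b) * (e \<bullet> b)))"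
      by (subst euclidean_inner) simp
    then show ?thesis by (simp add: sum_distrib_right sum_distrib_left scaleR_conv_of_real mult_ac)
  qed
  then have "coord_mult e F = cls (\<lambda>x. \<Sum>b\<in>Basis. (e \<bullet> b) *\<^sub>R (of_real (x \<bullet> b) * f x))"
    by (simp add: f(2) coord_mult_cls f(1))
  also have "\<dots> = (\<Sum>b\<in>Basis. (e \<bullet> b) *\<^sub>R coord_mult b F)"
    by (simp add: cls_sum square_integrable_scaleR xf cls_scaleR f coord_mult_cls)
  finally show ?thesis .
qed

lemma sphere_min_attained:
  fixes \<phi> :: "'a::euclidean_space \<Rightarrow> real"
  assumes "continuous_on (sphere 0 1) \<phi>"
  obtains e where "norm e = 1" "sphere_min \<phi> = \<phi> e" "\<And>e'. norm e' = 1 \<Longrightarrow> \<phi> e \<le> \<phi> e'"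
proof -
  obtain b :: 'a where "b \<in> Basis" using SOME_Basis by blast
  then have "sphere 0 1 \<noteq> ({} :: 'a set)" by (metis dist_0_norm empty_iff mem_sphere norm_Basis)
  then obtain e where e: "e \<in> sphere 0 1" "\<forall>e'\<in>sphere 0 1. \<phi> e \<le> \<phi> e'"
    using continuous_attains_inf[OF compact_sphere _ assms] by blast
  have "sphere_min \<phi> = \<phi> e"
    unfolding sphere_min_def by (rule Least_equality) (use e in auto)
  then show ?thesis using that[of e] e by simp
qed

lemma weighted_min:
  fixes f :: "'a::euclidean_space \<Rightarrow> complex"
  assumes f: "square_integrable f" and c: "c \<ge> 0"
  obtains e where "norm e = 1"
    "sphere_min (\<lambda>e. c * (\<integral>x. (1 - x \<bullet> e) * (norm (f x))\<^sup>2 \<partial>sphere_measure)) =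
       c * sphere_area TYPE('a) * ((norm (cls f))\<^sup>2 - coord_mult e (cls f) \<bullet> cls f)"
    "\<And>e'. norm e' = 1 \<Longrightarrow> c * sphere_area TYPE('a) * ((norm (cls f))\<^sup>2 - coord_mult e (cls f) \<bullet> cls f)
        \<le> c * sphere_area TYPE('a) * ((norm (cls f))\<^sup>2 - coord_mult e' (cls f) \<bullet> cls f)"
proof -
  let ?\<phi> = "\<lambda>e :: 'a. c * sphere_area TYPE('a) * ((norm (cls f))\<^sup>2 - (\<Sum>b\<in>Basis. (e \<bullet> b) *\<^sub>R coord_mult b (cls f)) \<bullet> cls f)"
  have eq: "(\<lambda>e. c * (\<integral>x. (1 - x \<bullet> e) * (norm (f x))\<^sup>2 \<partial>sphere_measure)) = ?\<phi>"
    by (simp add: weighted_integral[OF f] coord_mult_sum[symmetric] mult.assoc)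
  have "continuous_on (sphere 0 1) ?\<phi>" by (intro continuous_intros)
  then obtain e where "norm e = 1" "sphere_min ?\<phi> = ?\<phi> e" "\<And>e'. norm e' = 1 \<Longrightarrow> ?\<phi> e \<le> ?\<phi> e'"
    by (rule sphere_min_attained) blast
  then show ?thesis using that unfolding eq by (simp only: coord_mult_sum[symmetric])
qed

lemma uncertainty_inequalityI:
  fixes f :: "'a::euclidean_space \<Rightarrow> complex"
  assumes f: "square_integrable f" and n: "norm (cls f) = 1"
    and B: "\<And>e. norm e = 1 \<Longrightarrow> B \<le> (1 - coord_mult e (cls f) \<bullet> cls f) * (sphere_gradient_norm f)\<^sup>2"
  shows "uncertainty_inequality f B"
proof -
  have "(0::real) \<le> 1 / sphere_area TYPE('a)" using sphere_area_pos[where 'a='a] by simp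
  then obtain e where "norm e = 1" "sphere_min (\<lambda>e. 1 / sphere_area TYPE('a) * (\<integral>x. (1 - x \<bullet> e) * (norm (f x))\<^sup>2 \<partial>sphere_measure)) =
       1 / sphere_area TYPE('a) * sphere_area TYPE('a) * ((norm (cls f))\<^sup>2 - coord_mult e (cls f) \<bullet> cls f)"
    by (rule weighted_min[OF f]) (rule that; assumption)
  then show ?thesis using B[of e] sphere_area_pos[where 'a='a] n by (simp add: uncertainty_inequality_def)
qed

lemma coord_mult_inner_le:
  assumes "norm e = 1" shows "coord_mult e F \<bullet> F \<le> (norm F)\<^sup>2"
proof -
  have "coord_mult e F \<bullet> F \<le> norm (coord_mult e F) * norm F" by (rule norm_cauchy_schwarz)
  also have "\<dots> \<le> norm F * norm F" using norm_coord_mult_le[of e F] assms by (intro mult_right_mono) auto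
  finally show ?thesis by (simp add: power2_eq_square)
qed

text \<open>
  Pairing \<open>(-\<Delta>\<^sub>0)\<^sup>1\<^sup>/\<^sup>2 f\<close> with \<open>g = (-\<Delta>\<^sub>0)\<^sup>-\<^sup>1\<^sup>/\<^sup>2 f\<close> gives \<open>(norm f)\<^sup>4 \<le> (norm (\<nabla>\<^sub>0 f))\<^sup>2 * (norm g)\<^sup>2\<close>, and the
  Hardy--Rellich inequality for \<open>g\<close> bounds \<open>norm g\<close> by the weighted integral of \<open>f\<close>.
\<close>

lemma Hardy_Rellich_imp_uncertainty:
  fixes f :: "'a::euclidean_space \<Rightarrow> complex"
  assumes d: "2 \<le> DIM('a)" and f: "f \<in> sphere_W21_zero_mean" and n1: "sphere_norm f = 1"
    and HR: "hardy_rellich_constant TYPE('a) C"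
  shows "uncertainty_inequality f (inverse C)"
proof -
  have fW: "f \<in> sphere_W21" and fm: "(\<integral>y. f y \<partial>sphere_measure) = 0"
    using f by (auto simp: sphere_W21_zero_mean_def)
  note fL = sphere_W21_gradient(1)[OF d fW] and fG = sphere_W21_gradient(2)[OF d fW]
  have sqf: "square_integrable f" using fL by (simp add: sphere_L2_iff)
  have nf: "norm (cls f) = 1" using n1 by (simp add: norm_cls[OF sqf])
  define D where "D = (sphere_gradient_norm f)\<^sup>2"
  define y where "y = (\<lambda>n. (norm (cls (sphere_proj n f)))\<^sup>2)"
  define lam where "lam = eigenvalue TYPE('a)"
  have lam1: "lam n \<ge> 1" if "1 \<le> n" for n
    using eigenvalue_ge[OF d that] d by (simp add: lam_def)
  have y0: "y 0 = 0" using zero_mean_iff[OF fL] fm by (simp add: y_def)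
  have y: "y sums 1" using harmonic_expansion(2)[OF d fL] nf by (simp add: y_def)
  have ynn: "y n \<ge> 0" for n by (simp add: y_def)
  have D: "(\<Sum>n<N. lam n * y n) \<le> D" for N
    unfolding D_def lam_def y_def sphere_gradient_norm_eq[OF fG] by (rule gradient_Bessel[OF d fG])
  show ?thesis
  proof (rule uncertainty_inequalityI[OF sqf nf])
    fix e :: 'a assume e: "norm e = 1"
    define A where "A = coord_mult e (cls f) \<bullet> cls f"
    have A1: "A \<le> 1" using coord_mult_inner_le[OF e, of "cls f"] nf by (simp add: A_def)
    have D0: "D \<ge> 0" by (simp add: D_def)
    show "inverse C \<le> (1 - coord_mult e (cls f) \<bullet> cls f) * (sphere_gradient_norm f)\<^sup>2"
      unfolding A_def[symmetric] D_def[symmetric]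
    proof (cases "C > 0")
      case False
      then have "inverse C \<le> 0" by simp
      also have "0 \<le> (1 - A) * D" using A1 D0 by simp
      finally show "inverse C \<le> (1 - A) * D" .
    next
      case C: True
      define Z where "Z = (\<lambda>n x. (lam n powr (- (1/2))) *\<^sub>R sphere_proj n f x)"
      have Z: "Z n \<in> spherical_harmonics n" for n
        unfolding Z_def by (rule spherical_harmonics_scaleR[OF sphere_proj_in[OF fL]])
      have clsZ: "cls (Z n) = (lam n powr (- (1/2))) *\<^sub>R cls (sphere_proj n f)" for n
        unfolding Z_def by (rule cls_scaleR[OF spherical_harmonics_square_integrable[OF sphere_proj_in[OF fL]]])
      have nZ: "(norm (cls (Z n)))\<^sup>2 = y n / lam n" for n
      proof (cases "n = 0")
        case True
        then show ?thesis using y0 by (simp add: clsZ y_def)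
      next
        case False
        then have l: "lam n > 0" using lam1[of n] by simp
        have "lam n powr (- (1/2)) = inverse (lam n powr (1/2))" by (rule powr_minus)
        also have "lam n powr (1/2) = sqrt (lam n)" by (rule powr_half_sqrt) (use l in simp)
        finally have "lam n powr (- (1/2)) = inverse (sqrt (lam n))" .
        then have c: "cls (Z n) = inverse (sqrt (lam n)) *\<^sub>R cls (sphere_proj n f)" unfolding clsZ by (rule arg_cong)
        have "(inverse (sqrt (lam n)))\<^sup>2 = inverse (lam n)"
          unfolding power_inverse real_sqrt_pow2[OF less_imp_le[OF l]] by (rule refl)
        then show ?thesis
          unfolding c norm_scaleR power_mult_distrib power2_abs y_def divide_inverse by (metis mult.commute)
      qed
      have "summable (\<lambda>n. (norm (cls (Z n)))\<^sup>2)"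
      proof (rule summable_comparison_test_ev)
        show "summable y" using y by (rule sums_summable)
        show "\<forall>\<^sub>F n in sequentially. norm ((norm (cls (Z n)))\<^sup>2) \<le> y n"
          using eventually_ge_at_top[of 1]
        proof eventually_elim
          case (elim n)
          have "y n / lam n \<le> y n / 1" by (rule divide_left_mono) (use lam1[OF elim] ynn in auto)
          then show ?case unfolding nZ using ynn lam1[OF elim] by simp
        qed
      qed
      from harmonic_series_limit[OF d Z this]
      obtain g where g: "g \<in> sphere_L2" "\<And>n. cls (sphere_proj n g) = cls (Z n)" by blast
      have sqg: "square_integrable g" using g by (simp add: sphere_L2_iff)
      have g0: "cls (sphere_proj 0 g) = 0" unfolding g(2) clsZ using y0 by (simp add: y_def)
      have nlb: "is_neg_laplace_beltrami_power (1/2) g f"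
      proof (rule is_neg_laplace_beltrami_powerI[OF g(1) fL])
        show "cls (sphere_proj 0 f) = 0" using y0 by (simp add: y_def)
        fix n :: nat assume n: "1 \<le> n"
        have "lam n powr (1/2) * lam n powr (- (1/2)) = 1"
          using lam1[OF n] by (simp add: powr_add[symmetric])
        then show "cls (sphere_proj n f) = (eigenvalue TYPE('a) n powr (1/2)) *\<^sub>R cls (sphere_proj n g)"
          unfolding g(2) clsZ by (simp add: lam_def)
      qed
      have gW: "g \<in> sphere_W21_zero_mean"
        using g(1) nlb g0 zero_mean_iff[OF g(1)] by (auto simp: sphere_W21_zero_mean_def sphere_W21_def)
      define h where "h = neg_laplace_beltrami_power (1/2) g"
      have h: "h \<in> sphere_L2" "cls h = cls f"
        unfolding h_def by (rule neg_laplace_beltrami_power_eq[OF d g(1) nlb])+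
      have sqh: "square_integrable h" using h by (simp add: sphere_L2_iff)
      have ap: "sphere_area TYPE('a) > 0" by (rule sphere_area_pos)
      have hr: "(norm (cls g))\<^sup>2 \<le> C * (1 - A)"
      proof -
        have one: "(0::real) \<le> 1" by simp
        obtain e0 where
          m: "sphere_min (\<lambda>e. 1 * (\<integral>x. (1 - x \<bullet> e) * (norm (h x))\<^sup>2 \<partial>sphere_measure)) =
             1 * sphere_area TYPE('a) * ((norm (cls h))\<^sup>2 - coord_mult e0 (cls h) \<bullet> cls h)"
          and le: "\<And>e'. norm e' = 1 \<Longrightarrow> 1 * sphere_area TYPE('a) * ((norm (cls h))\<^sup>2 - coord_mult e0 (cls h) \<bullet> cls h)
             \<le> 1 * sphere_area TYPE('a) * ((norm (cls h))\<^sup>2 - coord_mult e' (cls h) \<bullet> cls h)"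
          by (rule weighted_min[OF sqh one]) (rule that; assumption)
        have "sphere_area TYPE('a) * (norm (cls g))\<^sup>2 = (\<integral>x. (norm (g x))\<^sup>2 \<partial>sphere_measure)"
          using norm_cls_eq_integral[OF sqg] ap by (simp add: field_simps)
        also have "\<dots> \<le> C * sphere_min (\<lambda>e. \<integral>x. (1 - x \<bullet> e) * (norm (h x))\<^sup>2 \<partial>sphere_measure)"
          using HR gW unfolding hardy_rellich_constant_def h_def by blast
        also have "\<dots> \<le> C * (sphere_area TYPE('a) * (1 - A))"
          using m le[OF e] C nf by (intro mult_left_mono) (auto simp: h(2) A_def)
        finally show ?thesis using ap by (simp add: mult.left_commute)
      qed
      have bd: "(\<Sum>n<N. y n)\<^sup>2 \<le> D * (C * (1 - A))" for N
      proof -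
        have "(\<Sum>n<N. y n) = (\<Sum>n<N. (sqrt (lam n * y n)) * sqrt (y n / lam n))"
        proof (rule sum.cong[OF refl])
          fix n
          show "y n = sqrt (lam n * y n) * sqrt (y n / lam n)"
          proof (cases "n = 0")
            case True then show ?thesis using y0 by simp
          next
            case False
            then have "lam n > 0" using lam1[of n] by simp
            then have "sqrt (lam n * y n) * sqrt (y n / lam n) = sqrt ((y n)\<^sup>2)"
              unfolding real_sqrt_mult[symmetric] by (simp add: power2_eq_square)
            then show ?thesis using ynn by simp
          qed
        qed
        then have "(\<Sum>n<N. y n)\<^sup>2 \<le> (\<Sum>n<N. (sqrt (lam n * y n))\<^sup>2) * (\<Sum>n<N. (sqrt (y n / lam n))\<^sup>2)"
          using Cauchy_Schwarz_ineq_sum[of "\<lambda>n. sqrt (lam n * y n)" "\<lambda>n. sqrt (y n / lam n)" "{..<N}"] by simp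
        also have "(\<Sum>n<N. (sqrt (lam n * y n))\<^sup>2) = (\<Sum>n<N. lam n * y n)"
        proof (rule sum.cong[OF refl])
          fix n show "(sqrt (lam n * y n))\<^sup>2 = lam n * y n"
            using ynn lam1[of n] y0 by (cases "n = 0") auto
        qed
        also have "(\<Sum>n<N. (sqrt (y n / lam n))\<^sup>2) = (\<Sum>n<N. (norm (cls (Z n)))\<^sup>2)"
        proof (rule sum.cong[OF refl])
          fix n show "(sqrt (y n / lam n))\<^sup>2 = (norm (cls (Z n)))\<^sup>2"
            using ynn lam1[of n] y0 unfolding nZ by (cases "n = 0") auto
        qed
        also have "(\<Sum>n<N. lam n * y n) * (\<Sum>n<N. (norm (cls (Z n)))\<^sup>2) \<le> D * (C * (1 - A))"
        proof (rule mult_mono[OF D _ D0])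
          have "(\<Sum>n<N. (norm (cls (Z n)))\<^sup>2) = (\<Sum>n<N. (norm (cls (sphere_proj n g)))\<^sup>2)" by (simp add: g(2))
          also have "\<dots> \<le> (norm (cls g))\<^sup>2"
            by (rule Bessel_inequality[OF sphere_proj_orthogonal[OF d g(1) g(1)] sphere_proj_inner_self[OF g(1)]]) auto
          finally show "(\<Sum>n<N. (norm (cls (Z n)))\<^sup>2) \<le> C * (1 - A)" using hr by simp
        qed (simp add: sum_nonneg)
        finally show ?thesis .
      qed
      have "(\<lambda>N. (\<Sum>n<N. y n)\<^sup>2) \<longlonglongrightarrow> 1\<^sup>2" using y unfolding sums_def by (intro tendsto_intros)
      then have "1\<^sup>2 \<le> D * (C * (1 - A))" by (rule LIMSEQ_le_const2) (use bd in blast)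
      then show "inverse C \<le> (1 - A) * D" using C by (simp add: field_simps)
    qed
  qed
qed

section \<open>The explicit bound\<close>

lemma norm_square_C1:
  fixes u :: "'a::euclidean_space \<Rightarrow> complex"
  assumes u: "u \<in> sphere_C1"
  defines "v \<equiv> (\<lambda>x. complex_of_real ((norm (u x))\<^sup>2))"
  shows "v \<in> sphere_C1"
    and "x \<noteq> 0 \<Longrightarrow> partial_deriv b (radial_extension v) x = complex_of_real (2 * (radial_extension u x \<bullet> partial_deriv b (radial_extension u) x))"
proof -
  let ?U = "radial_extension u"
  have vU: "radial_extension v = (\<lambda>x. complex_of_real (?U x \<bullet> ?U x))"
    by (rule ext) (simp add: v_def radial_extension_def dot_square_norm)
  have der: "(radial_extension v has_derivative (\<lambda>h. complex_of_real (?U x \<bullet> F' h + F' h \<bullet> ?U x))) (at x)"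
    if "(?U has_derivative F') (at x)" for x F'
    unfolding vU by (rule has_derivative_of_real[OF has_derivative_inner[OF that that]])
  have pd: "partial_deriv b (radial_extension v) x = complex_of_real (2 * (?U x \<bullet> partial_deriv b ?U x))" if x: "x \<noteq> 0" for x b
  proof -
    obtain F' where F': "(?U has_derivative F') (at x)" using sphere_C1D(1)[OF u x] by (auto simp: differentiable_def)
    show ?thesis unfolding partial_deriv_eq[OF der[OF F']] partial_deriv_eq[OF F'] by (simp add: inner_commute)
  qed
  show "x \<noteq> 0 \<Longrightarrow> partial_deriv b (radial_extension v) x = complex_of_real (2 * (?U x \<bullet> partial_deriv b ?U x))"
    by (rule pd)
  show "v \<in> sphere_C1"
    unfolding sphere_C1_def
  proof (intro CollectI conjI allI impI ballI)
    show "sphere_valued v" by (simp add: sphere_valued_def v_def)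
    show "radial_extension v differentiable at x" if "x \<noteq> 0" for x
      using sphere_C1D(1)[OF u that] der by (auto simp: differentiable_def)
    fix b :: 'a assume b: "b \<in> Basis"
    have "continuous_on (- {0}) (\<lambda>x. complex_of_real (2 * (?U x \<bullet> partial_deriv b ?U x)))"
      by (intro continuous_intros sphere_C1_continuous(1)[OF u] sphere_C1D(2)[OF u b])
    then show "continuous_on (- {0}) (partial_deriv b (radial_extension v))"
      by (subst continuous_on_cong[of "- {0}" "- {0}" _ "\<lambda>x. complex_of_real (2 * (?U x \<bullet> partial_deriv b ?U x))"]) (auto simp: pd)
  qed
qed

text \<open>
  The vector with components \<open>b \<bullet> e - (x \<bullet> b) * (x \<bullet> e)\<close> is the tangential part of \<open>e\<close> at \<open>x\<close>, of squared
  length \<open>1 - (x \<bullet> e)\<^sup>2\<close>.  After Cauchy--Schwarz the product of two norms is split with the weight \<open>s\<close>, which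
  keeps all terms quadratic and hence stable under limits.
\<close>

lemma tangential_Cauchy_Schwarz:
  fixes w :: complex and D :: "'a::euclidean_space \<Rightarrow> complex"
  assumes x: "norm x = 1" and e: "norm e = 1" and s: "s > 0"
  shows "(\<Sum>b\<in>Basis. 2 * (w \<bullet> D b) * (b \<bullet> e - (x \<bullet> b) * (x \<bullet> e)))
     \<le> s * ((norm w)\<^sup>2 - (norm (of_real (x \<bullet> e) * w))\<^sup>2) + (1 / s) * (\<Sum>b\<in>Basis. (norm (D b))\<^sup>2)"
proof -
  define t where "t = (\<lambda>b. b \<bullet> e - (x \<bullet> b) * (x \<bullet> e))"
  have t: "t b = (e - (x \<bullet> e) *\<^sub>R x) \<bullet> b" for b
    unfolding t_def inner_diff_left inner_scaleR_left by (simp add: inner_commute mult.commute)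
  have "(\<Sum>b\<in>Basis. (t b)\<^sup>2) = (e - (x \<bullet> e) *\<^sub>R x) \<bullet> (e - (x \<bullet> e) *\<^sub>R x)"
    unfolding t by (subst (3) euclidean_inner) (simp add: power2_eq_square)
  also have "\<dots> = 1 - (x \<bullet> e)\<^sup>2"
  proof -
    have "x \<bullet> x = 1" "e \<bullet> e = 1" using x e by (simp_all add: dot_square_norm)
    then show ?thesis
      by (simp only: inner_diff_left inner_diff_right inner_scaleR_left inner_scaleR_right inner_commute[of e x])
         (simp add: power2_eq_square)
  qed
  finally have tt: "(\<Sum>b\<in>Basis. (t b)\<^sup>2) = 1 - (x \<bullet> e)\<^sup>2" .
  define T where "T = (\<Sum>b\<in>Basis. \<bar>t b\<bar> * norm (D b))"
  define Q where "Q = (\<Sum>b\<in>Basis. (norm (D b))\<^sup>2)"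
  have T0: "T \<ge> 0" by (simp add: T_def sum_nonneg)
  have T2: "T\<^sup>2 \<le> (1 - (x \<bullet> e)\<^sup>2) * Q"
    using Cauchy_Schwarz_ineq_sum[of "\<lambda>b. \<bar>t b\<bar>" "\<lambda>b. norm (D b)" Basis] by (simp add: T_def Q_def tt)
  have "(\<Sum>b\<in>Basis. 2 * (w \<bullet> D b) * t b) \<le> (\<Sum>b\<in>Basis. 2 * (norm w * (\<bar>t b\<bar> * norm (D b))))"
  proof (rule sum_mono)
    fix b :: 'a
    have "(w \<bullet> D b) * t b \<le> \<bar>w \<bullet> D b\<bar> * \<bar>t b\<bar>" by (metis abs_ge_self abs_mult)
    also have "\<dots> \<le> (norm w * norm (D b)) * \<bar>t b\<bar>" by (intro mult_right_mono Cauchy_Schwarz_ineq2) simp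
    finally show "2 * (w \<bullet> D b) * t b \<le> 2 * (norm w * (\<bar>t b\<bar> * norm (D b)))" by (simp add: mult_ac)
  qed
  also have "\<dots> = 2 * (norm w * T)" by (simp add: T_def sum_distrib_left)
  also have "\<dots> \<le> s * ((norm w)\<^sup>2 * (1 - (x \<bullet> e)\<^sup>2)) + (1 / s) * Q"
  proof -
    have xe: "0 \<le> 1 - (x \<bullet> e)\<^sup>2" unfolding tt[symmetric] by (simp add: sum_nonneg)
    have Q0: "0 \<le> Q" by (simp add: Q_def sum_nonneg)
    define a where "a = norm w * sqrt (1 - (x \<bullet> e)\<^sup>2)"
    have "T \<le> sqrt ((1 - (x \<bullet> e)\<^sup>2) * Q)" using T2 by (rule real_le_rsqrt)
    then have "norm w * T \<le> norm w * (sqrt (1 - (x \<bullet> e)\<^sup>2) * sqrt Q)"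
      by (intro mult_left_mono) (simp_all add: real_sqrt_mult)
    then have "norm w * T \<le> a * sqrt Q" by (simp add: a_def mult.assoc)
    moreover have "2 * (a * sqrt Q) \<le> s * a\<^sup>2 + (1 / s) * (sqrt Q)\<^sup>2"
    proof -
      have "0 \<le> (s * a - sqrt Q)\<^sup>2 / s" using s by simp
      also have "\<dots> = s * a\<^sup>2 + (1 / s) * (sqrt Q)\<^sup>2 - 2 * (a * sqrt Q)"
        using s by (simp add: power2_eq_square field_simps)
      finally show ?thesis by simp
    qed
    moreover have "a\<^sup>2 = (norm w)\<^sup>2 * (1 - (x \<bullet> e)\<^sup>2)" using xe by (simp add: a_def power_mult_distrib)
    ultimately show ?thesis using Q0 by simp
  qed
  also have "(norm w)\<^sup>2 * (1 - (x \<bullet> e)\<^sup>2) = (norm w)\<^sup>2 - (norm (of_real (x \<bullet> e) * w))\<^sup>2"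
    by (simp add: norm_mult power_mult_distrib algebra_simps)
  finally show ?thesis by (simp add: t_def Q_def)
qed

text \<open>
  Green's identity for \<open>(norm u)\<^sup>2\<close> and the linear harmonic \<open>x \<bullet> e\<close>, followed by Cauchy--Schwarz with
  the free parameter \<open>s\<close>.
\<close>

lemma mean_direction_bound_C1:
  fixes u :: "'a::euclidean_space \<Rightarrow> complex"
  assumes u: "u \<in> sphere_C1" and e: "norm e = 1" and s: "s > 0"
  shows "(real DIM('a) - 1) * (coord_mult e (cls u) \<bullet> cls u)
     \<le> s * ((norm (cls u))\<^sup>2 - (norm (coord_mult e (cls u)))\<^sup>2) + (1 / s) * (\<Sum>b\<in>Basis. (norm (grad b u))\<^sup>2)"
proof -
  let ?A = "sphere_area TYPE('a)"
  define v where "v = (\<lambda>x. complex_of_real ((norm (u x))\<^sup>2))"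
  define Y where "Y = (\<lambda>x. complex_of_real (x \<bullet> e))"
  note vC = norm_square_C1[OF u, folded v_def]
  have hY: "homogeneous_harmonic 1 Y" unfolding Y_def by (rule homogeneous_harmonic_coord)
  have Y: "Y \<in> spherical_harmonics 1"
    using hY by (auto simp: spherical_harmonics_eq sphere_valued_def Y_def)
  have squ: "square_integrable u" by (rule sphere_C1_square_integrable(1)[OF u])
  have sqx: "square_integrable (\<lambda>x. of_real (x \<bullet> e) * u x)" by (rule square_integrable_coord_mult[OF squ])
  have sqg: "square_integrable (partial_deriv b (radial_extension u))" if "b \<in> Basis" for b
    by (rule sphere_C1_square_integrable(2)[OF u that])
  let ?I = "\<lambda>x. \<Sum>b\<in>Basis. partial_deriv b (radial_extension v) x \<bullet> partial_deriv b (radial_extension Y) x"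
  let ?R = "\<lambda>x. s * ((norm (u x))\<^sup>2 - (norm (of_real (x \<bullet> e) * u x))\<^sup>2) + (1 / s) * (\<Sum>b\<in>Basis. (norm (partial_deriv b (radial_extension u) x))\<^sup>2)"
  have "(real DIM('a) - 1) * (\<integral>x. v x \<bullet> Y x \<partial>sphere_measure) = (\<integral>x. ?I x \<partial>sphere_measure)"
    using Green_identity_sphere[OF vC(1) Y] by simp
  also have "\<dots> \<le> (\<integral>x. ?R x \<partial>sphere_measure)"
  proof (rule integral_mono)
    show "integrable sphere_measure ?I"
      by (intro integrable_sphere_continuous continuous_intros sphere_C1_continuous(3)[OF vC(1)]
          sphere_C1_continuous(3)[OF spherical_harmonics_C1[OF Y]])
    show "integrable sphere_measure ?R"
      by (intro integrable_sphere_continuous continuous_intros sphere_C1_continuous[OF u])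
    fix x :: 'a assume "x \<in> space sphere_measure"
    then have x: "norm x = 1" by simp
    then have x0: "x \<noteq> 0" by auto
    have "?I x = (\<Sum>b\<in>Basis. 2 * (u x \<bullet> partial_deriv b (radial_extension u) x) * (b \<bullet> e - (x \<bullet> b) * (x \<bullet> e)))"
    proof (rule sum.cong[OF refl])
      fix b :: 'a assume b: "b \<in> Basis"
      have "partial_deriv b (radial_extension Y) x = radial_gradient 1 Y b x"
        by (rule partial_deriv_radial_harmonic[OF hY _ x0 b]) simp
      also have "\<dots> = complex_of_real (b \<bullet> e - (x \<bullet> b) * (x \<bullet> e))"
        using x by (simp add: radial_gradient_def Y_def partial_deriv_coord scaleR_conv_of_real)
      finally show "partial_deriv b (radial_extension v) x \<bullet> partial_deriv b (radial_extension Y) x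
         = 2 * (u x \<bullet> partial_deriv b (radial_extension u) x) * (b \<bullet> e - (x \<bullet> b) * (x \<bullet> e))"
        by (simp only: vC(2)[OF x0] radial_extension_sphere[OF x]) (simp add: inner_complex_def)
    qed
    also have "\<dots> \<le> ?R x" by (rule tangential_Cauchy_Schwarz[OF x e s])
    finally show "?I x \<le> ?R x" .
  qed
  also have "\<dots> = s * ((\<integral>x. (norm (u x))\<^sup>2 \<partial>sphere_measure) - (\<integral>x. (norm (of_real (x \<bullet> e) * u x))\<^sup>2 \<partial>sphere_measure))
     + (1 / s) * (\<Sum>b\<in>Basis. \<integral>x. (norm (partial_deriv b (radial_extension u) x))\<^sup>2 \<partial>sphere_measure)"
  proof -
    note i1 = square_integrable_norm2[OF squ] and i2 = square_integrable_norm2[OF sqx]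
    have i3: "integrable sphere_measure (\<lambda>x. \<Sum>b\<in>Basis. (norm (partial_deriv b (radial_extension u) x))\<^sup>2)"
      by (intro Bochner_Integration.integrable_sum square_integrable_norm2 sqg)
    have "(\<integral>x. ?R x \<partial>sphere_measure) = (\<integral>x. s * ((norm (u x))\<^sup>2 - (norm (of_real (x \<bullet> e) * u x))\<^sup>2) \<partial>sphere_measure)
       + (\<integral>x. (1 / s) * (\<Sum>b\<in>Basis. (norm (partial_deriv b (radial_extension u) x))\<^sup>2) \<partial>sphere_measure)"
      by (intro Bochner_Integration.integral_add integrable_mult_right Bochner_Integration.integrable_diff i1 i2 i3)
    also have "(\<integral>x. (1 / s) * (\<Sum>b\<in>Basis. (norm (partial_deriv b (radial_extension u) x))\<^sup>2) \<partial>sphere_measure)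
       = (1 / s) * (\<Sum>b\<in>Basis. \<integral>x. (norm (partial_deriv b (radial_extension u) x))\<^sup>2 \<partial>sphere_measure)"
      unfolding integral_mult_right_zero
      by (intro arg_cong[of _ _ "\<lambda>t. (1 / s) * t"] Bochner_Integration.integral_sum square_integrable_norm2 sqg)
    also have "(\<integral>x. s * ((norm (u x))\<^sup>2 - (norm (of_real (x \<bullet> e) * u x))\<^sup>2) \<partial>sphere_measure) =
       s * ((\<integral>x. (norm (u x))\<^sup>2 \<partial>sphere_measure) - (\<integral>x. (norm (of_real (x \<bullet> e) * u x))\<^sup>2 \<partial>sphere_measure))"
      unfolding integral_mult_right_zero by (intro arg_cong[of _ _ "\<lambda>t. s * t"] Bochner_Integration.integral_diff i1 i2)
    finally show ?thesis .
  qed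
  also have "\<dots> = ?A * (s * ((norm (cls u))\<^sup>2 - (norm (coord_mult e (cls u)))\<^sup>2) + (1 / s) * (\<Sum>b\<in>Basis. (norm (grad b u))\<^sup>2))"
  proof -
    have A: "(\<integral>x. (norm (f x))\<^sup>2 \<partial>sphere_measure) = ?A * (norm (cls f))\<^sup>2" if "square_integrable f" for f :: "'a \<Rightarrow> complex"
      using norm_cls_eq_integral[OF that] sphere_area_pos[where 'a='a] by simp
    have "(\<Sum>b\<in>Basis. \<integral>x. (norm (partial_deriv b (radial_extension u) x))\<^sup>2 \<partial>sphere_measure) = ?A * (\<Sum>b\<in>Basis. (norm (grad b u))\<^sup>2)"
      unfolding sum_distrib_left grad_def by (intro sum.cong refl A sqg)
    then show ?thesis unfolding A[OF squ] A[OF sqx] coord_mult_cls[OF squ] by (simp add: algebra_simps)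
  qed
  also have "(\<integral>x. v x \<bullet> Y x \<partial>sphere_measure) = ?A * (coord_mult e (cls u) \<bullet> cls u)"
  proof -
    have "v x \<bullet> Y x = (x \<bullet> e) * (u x \<bullet> u x)" for x
      by (simp add: v_def Y_def inner_complex_def dot_square_norm[symmetric])
    moreover have "(of_real (x \<bullet> e) * u x) \<bullet> u x = (x \<bullet> e) * (u x \<bullet> u x)" for x
      by (simp add: inner_complex_def algebra_simps)
    ultimately have "v x \<bullet> Y x = (of_real (x \<bullet> e) * u x) \<bullet> u x" for x by simp
    then show ?thesis
      unfolding coord_mult_cls[OF squ] inner_cls[OF sqx squ] using sphere_area_pos[where 'a='a] by simp
  qed
  finally show ?thesis using sphere_area_pos[where 'a='a]
    by (simp only: mult.left_commute[of "real DIM('a) - 1"] mult_le_cancel_left_pos)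
qed

lemma mean_direction_bound:
  fixes f :: "'a::euclidean_space \<Rightarrow> complex"
  assumes G: "has_sphere_gradient f G" and e: "norm e = 1" and s: "s > 0"
  shows "(real DIM('a) - 1) * (coord_mult e (cls f) \<bullet> cls f)
     \<le> s * ((norm (cls f))\<^sup>2 - (norm (coord_mult e (cls f)))\<^sup>2) + (1 / s) * (\<Sum>b\<in>Basis. (norm (cls (\<lambda>x. G x b)))\<^sup>2)"
proof -
  obtain u where u: "\<And>k. u k \<in> sphere_C1" "(\<lambda>k. cls (u k)) \<longlonglongrightarrow> cls f"
    "\<And>b. b \<in> Basis \<Longrightarrow> (\<lambda>k. grad b (u k)) \<longlonglongrightarrow> cls (\<lambda>x. G x b)"
    by (rule has_sphere_gradient_limit[OF G]) blast
  have X: "(\<lambda>k. coord_mult e (cls (u k))) \<longlonglongrightarrow> coord_mult e (cls f)"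
    by (rule bounded_linear.tendsto[OF bounded_linear_coord_mult u(2)])
  show ?thesis
  proof (rule LIMSEQ_le)
    show "(\<lambda>k. (real DIM('a) - 1) * (coord_mult e (cls (u k)) \<bullet> cls (u k))) \<longlonglongrightarrow> (real DIM('a) - 1) * (coord_mult e (cls f) \<bullet> cls f)"
      by (intro tendsto_intros X u)
    show "(\<lambda>k. s * ((norm (cls (u k)))\<^sup>2 - (norm (coord_mult e (cls (u k))))\<^sup>2) + (1 / s) * (\<Sum>b\<in>Basis. (norm (grad b (u k)))\<^sup>2))
       \<longlonglongrightarrow> s * ((norm (cls f))\<^sup>2 - (norm (coord_mult e (cls f)))\<^sup>2) + (1 / s) * (\<Sum>b\<in>Basis. (norm (cls (\<lambda>x. G x b)))\<^sup>2)"
      by (intro tendsto_intros X u)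
  qed (use mean_direction_bound_C1[OF u(1) e s] in blast)
qed

text \<open>
  Optimizing over \<open>s\<close> turns the last hypothesis into \<open>m\<^sup>2 * A\<^sup>2 \<le> 4 * (1 - A\<^sup>2) * D\<close>.  It is used for large
  \<open>A\<close>, and \<open>m \<le> D\<close> for small \<open>A\<close>.
\<close>

lemma uncertainty_constant_bound:
  fixes m A D :: real
  assumes m: "m > 0" and A: "A \<le> 1" and D: "D \<ge> m"
    and s: "\<And>s. s > 0 \<Longrightarrow> m * A \<le> s * (1 - A\<^sup>2) + (1 / s) * D"
  shows "m * (1 - 2 / sqrt (m + 4)) \<le> (1 - A) * D"
proof -
  \<comment> \<open>At \<open>A = a\<close> the two lower bounds \<open>(1 - A) * m\<close> and \<open>m\<^sup>2 * A\<^sup>2 / (4 * (1 + A))\<close> agree.\<close>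
  define a where "a = 2 / sqrt (m + 4)"
  have a0: "a > 0" using m by (simp add: a_def)
  have a2: "a\<^sup>2 * (m + 4) = 4" using m by (simp add: a_def power_divide field_simps)
  have a1: "a \<le> 1"
  proof -
    have "2 \<le> sqrt (m + 4)" using m by (intro real_le_rsqrt) simp
    then show ?thesis using m by (simp add: a_def divide_le_eq)
  qed
  have "m * (1 - a) \<le> (1 - A) * D"
  proof (cases "A \<le> a")
    case True
    have "(1 - a) * m \<le> (1 - A) * D" using True a1 D m by (intro mult_mono) auto
    then show ?thesis by (simp add: mult.commute)
  next
    case False
    then have Aa: "A > a" by simp
    have A0: "A > 0" using Aa a0 by linarith
    have "A \<noteq> 1"
    proof
      assume A1: "A = 1"
      have sp: "2 * D / m + 1 > 0" using D m by (simp add: add_nonneg_pos)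
      have "m \<le> (1 / (2 * D / m + 1)) * D" using s[OF sp] A1 by simp
      then have "m * (2 * D / m + 1) \<le> D" using sp by (simp add: pos_le_divide_eq)
      then have "2 * D + m \<le> D" using m by (simp add: distrib_left)
      then show False using D m by linarith
    qed
    then have lt: "A < 1" using A by simp
    then have q: "1 - A\<^sup>2 > 0" using A0 power_strict_mono[of A 1 2] by simp
    define t where "t = m * A / (2 * (1 - A\<^sup>2))"
    have t: "t > 0" using m A0 q by (simp add: t_def)
    have "m * A / (2 * Q) * Q = m * A / 2" if "Q > 0" for Q using that by simp
    from this[OF q] have "t * (1 - A\<^sup>2) = m * A / 2" unfolding t_def .
    then have "m * A \<le> m * A / 2 + (1 / t) * D" using s[OF t] by (simp only:)
    moreover have "2 * D / t = 2 * ((1 / t) * D)" by simp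
    ultimately have "m * A \<le> 2 * D / t" by linarith
    then have "m * A * t \<le> 2 * D" using t by (simp add: pos_le_divide_eq)
    then have "m * A * (m * A) / (2 * (1 - A\<^sup>2)) \<le> 2 * D" by (simp only: t_def times_divide_eq_right)
    then have "m * A * (m * A) \<le> 2 * D * (2 * (1 - A\<^sup>2))" using q by (simp only: pos_divide_le_eq[of "2 * (1 - A\<^sup>2)"] mult_pos_pos zero_less_numeral)
    then have main: "m\<^sup>2 * A\<^sup>2 \<le> 4 * ((1 - A) * D) * (1 + A)" by (simp add: power2_eq_square algebra_simps)
    have "0 \<le> (A\<^sup>2 - a\<^sup>2) + A * a * (A - a)" using Aa a0 A0 power_mono[of a A 2] by (intro add_nonneg_nonneg) auto
    then have inc: "a\<^sup>2 * (1 + A) \<le> A\<^sup>2 * (1 + a)" by (simp add: power2_eq_square algebra_simps)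
    have am: "m * a\<^sup>2 = 4 * (1 - a\<^sup>2)" using a2 by (simp add: algebra_simps)
    have "4 * (m * (1 - a)) * (1 + A) * (1 + a) = m * (4 * (1 - a\<^sup>2)) * (1 + A)"
      by (simp add: power2_eq_square algebra_simps)
    also have "\<dots> = m\<^sup>2 * (a\<^sup>2 * (1 + A))" unfolding am[symmetric] by (simp add: power2_eq_square)
    also have "\<dots> \<le> m\<^sup>2 * (A\<^sup>2 * (1 + a))" by (intro mult_left_mono inc) simp
    also have "\<dots> \<le> 4 * ((1 - A) * D) * (1 + A) * (1 + a)"
      using mult_right_mono[OF main, of "1 + a"] a0 by (simp add: mult.assoc)
    finally have "(m * (1 - a)) * (4 * ((1 + A) * (1 + a))) \<le> ((1 - A) * D) * (4 * ((1 + A) * (1 + a)))" by (simp only: mult_ac)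
    moreover have "0 < 4 * ((1 + A) * (1 + a))" using A0 a0 by simp
    ultimately show ?thesis by (simp only: mult_le_cancel_right_pos)
  qed
  then show ?thesis by (simp add: a_def)
qed

text \<open>
  A function of mean zero has components of degree at least \<open>1\<close> only, and all their eigenvalues are at least
  \<open>d - 1\<close>.
\<close>

lemma Poincare_inequality:
  fixes f :: "'a::euclidean_space \<Rightarrow> complex"
  assumes d: "2 \<le> DIM('a)" and f: "f \<in> sphere_W21" and mean: "(\<integral>y. f y \<partial>sphere_measure) = 0"
  shows "(real DIM('a) - 1) * (norm (cls f))\<^sup>2 \<le> (sphere_gradient_norm f)\<^sup>2"
proof -
  note fL = sphere_W21_gradient(1)[OF d f] and fG = sphere_W21_gradient(2)[OF d f]
  define y where "y = (\<lambda>n. (norm (cls (sphere_proj n f)))\<^sup>2)"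
  have y: "y sums (norm (cls f))\<^sup>2" using harmonic_expansion(2)[OF d fL] by (simp add: y_def)
  have y0: "y 0 = 0" using zero_mean_iff[OF fL] mean by (simp add: y_def)
  have bd: "(\<Sum>n<N. (real DIM('a) - 1) * y n) \<le> (sphere_gradient_norm f)\<^sup>2" for N
  proof -
    have "(\<Sum>n<N. (real DIM('a) - 1) * y n) \<le> (\<Sum>n<N. eigenvalue TYPE('a) n * y n)"
    proof (rule sum_mono)
      fix n
      show "(real DIM('a) - 1) * y n \<le> eigenvalue TYPE('a) n * y n"
        using eigenvalue_ge[OF d, of n] y0 by (cases "n = 0") (auto simp: y_def intro!: mult_right_mono)
    qed
    also have "\<dots> \<le> (sphere_gradient_norm f)\<^sup>2"
      unfolding sphere_gradient_norm_eq[OF fG] y_def by (rule gradient_Bessel[OF d fG])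
    finally show ?thesis .
  qed
  have "(\<lambda>N. \<Sum>n<N. (real DIM('a) - 1) * y n) \<longlonglongrightarrow> (real DIM('a) - 1) * (norm (cls f))\<^sup>2"
    using sums_mult[OF y, of "real DIM('a) - 1"] by (simp add: sums_def)
  then show ?thesis by (rule LIMSEQ_le_const2) (use bd in blast)
qed

theorem uncertainty_explicit_constant:
  fixes f :: "'a::euclidean_space \<Rightarrow> complex"
  assumes d: "2 \<le> DIM('a)" and f: "f \<in> sphere_W21_zero_mean" and n1: "sphere_norm f = 1"
  shows "uncertainty_inequality f ((real DIM('a) - 1) * (1 - 2 / sqrt (real DIM('a) + 3)))"
proof -
  have fW: "f \<in> sphere_W21" and fm: "(\<integral>y. f y \<partial>sphere_measure) = 0"
    using f by (auto simp: sphere_W21_zero_mean_def)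
  note fL = sphere_W21_gradient(1)[OF d fW] and fG = sphere_W21_gradient(2)[OF d fW]
  have sqf: "square_integrable f" using fL by (simp add: sphere_L2_iff)
  have nf: "norm (cls f) = 1" using n1 by (simp add: norm_cls[OF sqf])
  show ?thesis
  proof (rule uncertainty_inequalityI[OF sqf nf])
    fix e :: 'a assume e: "norm e = 1"
    define A where "A = coord_mult e (cls f) \<bullet> cls f"
    define D where "D = (sphere_gradient_norm f)\<^sup>2"
    have A1: "A \<le> 1" using coord_mult_inner_le[OF e, of "cls f"] nf by (simp add: A_def)
    have D1: "real DIM('a) - 1 \<le> D" using Poincare_inequality[OF d fW fm] nf by (simp add: D_def)
    have A2: "A\<^sup>2 \<le> (norm (coord_mult e (cls f)))\<^sup>2"
    proof -
      have "\<bar>A\<bar> \<le> norm (coord_mult e (cls f))"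
        using Cauchy_Schwarz_ineq2[of "coord_mult e (cls f)" "cls f"] nf by (simp add: A_def)
      then show ?thesis by (simp add: abs_le_square_iff[symmetric])
    qed
    have "(real DIM('a) - 1) * (1 - 2 / sqrt ((real DIM('a) - 1) + 4)) \<le> (1 - A) * D"
    proof (rule uncertainty_constant_bound[OF _ A1 D1])
      show "real DIM('a) - 1 > 0" using d by simp
      fix s :: real assume s: "s > 0"
      have "(real DIM('a) - 1) * A \<le> s * (1 - (norm (coord_mult e (cls f)))\<^sup>2) + (1 / s) * D"
        using mean_direction_bound[OF fG e s] nf by (simp add: A_def D_def sphere_gradient_norm_eq[OF fG])
      also have "\<dots> \<le> s * (1 - A\<^sup>2) + (1 / s) * D" using A2 s by (intro add_right_mono mult_left_mono) auto
      finally show "(real DIM('a) - 1) * A \<le> s * (1 - A\<^sup>2) + (1 / s) * D" .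
    qed
    then show "(real DIM('a) - 1) * (1 - 2 / sqrt (real DIM('a) + 3)) \<le> (1 - coord_mult e (cls f) \<bullet> cls f) * (sphere_gradient_norm f)\<^sup>2"
      by (simp add: A_def D_def add.commute)
  qed
qed

section \<open>The circle\<close>

subsection \<open>The discrete Hardy inequality\<close>

text \<open>
  The concavity of the square root, with the exact rate that the Hardy weight \<open>1 / (4 * k\<^sup>2)\<close> requires.
\<close>

lemma sqrt_second_difference:
  assumes "k \<ge> 1"
  shows "sqrt ((k - 1) / k) + sqrt ((k + 1) / k) \<le> 2 - 1 / (4 * k\<^sup>2)"
proof -
  define x where "x = 1 / k"
  have x: "0 < x" "x \<le> 1" using assms by (auto simp: x_def)
  have e: "(k - 1) / k = 1 - x" "(k + 1) / k = 1 + x" "1 / (4 * k\<^sup>2) = x\<^sup>2 / 4"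
    using assms by (auto simp: x_def field_simps power2_eq_square)
  have x2: "x\<^sup>2 \<le> 1" using x by (simp add: power_le_one)
  have prod: "sqrt (1 - x) * sqrt (1 + x) \<le> 1 - x\<^sup>2 / 2"
  proof -
    have "sqrt (1 - x) * sqrt (1 + x) = sqrt (1 - x\<^sup>2)"
      by (simp add: real_sqrt_mult[symmetric] power2_eq_square algebra_simps)
    also have "\<dots> \<le> 1 - x\<^sup>2 / 2"
    proof (rule real_le_lsqrt)
      show "1 - x\<^sup>2 \<le> (1 - x\<^sup>2 / 2)\<^sup>2" using x by (simp add: power2_eq_square algebra_simps)
    qed (use x2 in auto)
    finally show ?thesis .
  qed
  have "sqrt (1 - x) + sqrt (1 + x) \<le> 2 - x\<^sup>2 / 4"
  proof (rule power2_le_imp_le)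
    have "(sqrt (1 - x) + sqrt (1 + x))\<^sup>2 = (sqrt (1 - x))\<^sup>2 + (sqrt (1 + x))\<^sup>2 + 2 * (sqrt (1 - x) * sqrt (1 + x))"
      by (simp only: power2_sum mult.assoc)
    also have "\<dots> = (1 - x) + (1 + x) + 2 * (sqrt (1 - x) * sqrt (1 + x))" using x by simp
    also have "\<dots> \<le> (2 - x\<^sup>2 / 4)\<^sup>2" using prod zero_le_power2[of "x\<^sup>2"] by (simp add: power2_eq_square algebra_simps)
    finally show "(sqrt (1 - x) + sqrt (1 + x))\<^sup>2 \<le> (2 - x\<^sup>2 / 4)\<^sup>2" .
  qed (use x2 in simp)
  then show ?thesis unfolding e .
qed

text \<open>
  The sequence \<open>sqrt k\<close> is a positive supersolution: by \<open>2ab \<le> ta\<^sup>2 + b\<^sup>2/t\<close> with \<open>t\<close> the ratio of its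
  consecutive terms, each squared difference dominates a diagonal form.  The boundary term left over
  at \<open>N\<close> makes the induction go through.
\<close>

lemma discrete_Hardy_aux:
  fixes a :: "nat \<Rightarrow> real"
  assumes "a 0 = 0"
  shows "(\<Sum>k=1..Suc N. (a k)\<^sup>2 / (4 * (real k)\<^sup>2)) + (a (Suc N))\<^sup>2 * (sqrt (real (N + 2) / real (N + 1)) - 1)
     \<le> (\<Sum>k=1..Suc N. (a k - a (k - 1))\<^sup>2)"
proof (induction N)
  case 0
  have "sqrt 2 \<le> 7 / 4" by (rule real_le_lsqrt) (auto simp: power2_eq_square)
  then have "(a 1)\<^sup>2 * sqrt 2 \<le> (a 1)\<^sup>2 * (7 / 4)" by (rule mult_left_mono) simp
  then show ?case using assms by (simp add: algebra_simps)
next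
  case (Suc N)
  let ?k = "real (N + 2)"
  define r where "r = sqrt (real (N + 2) / real (N + 1))"
  have r0: "r > 0" by (simp add: r_def)
  have ri: "sqrt ((?k - 1) / ?k) = 1 / r" by (simp add: r_def real_sqrt_divide)
  define p where "p = a (Suc (Suc N))"
  define q where "q = a (Suc N)"
  have young: "p\<^sup>2 * (1 - 1 / r) + q\<^sup>2 * (1 - r) \<le> (p - q)\<^sup>2"
  proof -
    have "0 \<le> (p - r * q)\<^sup>2 / r" using r0 by simp
    also have "\<dots> = p\<^sup>2 * (1 / r) + q\<^sup>2 * r - 2 * p * q" using r0 by (simp add: power2_eq_square field_simps)
    finally show ?thesis by (simp add: power2_eq_square algebra_simps)
  qed
  have "1 / r + sqrt ((?k + 1) / ?k) \<le> 2 - 1 / (4 * ?k\<^sup>2)"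
    using sqrt_second_difference[of ?k] unfolding ri by simp
  then have "p\<^sup>2 * (1 / (4 * ?k\<^sup>2) + (sqrt ((?k + 1) / ?k) - 1)) \<le> p\<^sup>2 * (1 - 1 / r)"
    by (intro mult_left_mono) auto
  then have step: "p\<^sup>2 / (4 * ?k\<^sup>2) + p\<^sup>2 * (sqrt ((?k + 1) / ?k) - 1) \<le> p\<^sup>2 * (1 - 1 / r)"
    by (simp add: distrib_left)
  have IH: "(\<Sum>k=1..Suc N. (a k)\<^sup>2 / (4 * (real k)\<^sup>2)) + q\<^sup>2 * (r - 1) \<le> (\<Sum>k=1..Suc N. (a k - a (k - 1))\<^sup>2)"
    using Suc by (simp only: q_def r_def)
  have "q\<^sup>2 * (r - 1) + q\<^sup>2 * (1 - r) = 0" by (simp add: algebra_simps)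
  then have "(\<Sum>k=1..Suc N. (a k)\<^sup>2 / (4 * (real k)\<^sup>2)) + (p\<^sup>2 / (4 * ?k\<^sup>2) + p\<^sup>2 * (sqrt ((?k + 1) / ?k) - 1))
     \<le> (\<Sum>k=1..Suc N. (a k - a (k - 1))\<^sup>2) + (p - q)\<^sup>2"
    using IH young step by linarith
  moreover have "(\<Sum>k=1..Suc (Suc N). (a k)\<^sup>2 / (4 * (real k)\<^sup>2)) = (\<Sum>k=1..Suc N. (a k)\<^sup>2 / (4 * (real k)\<^sup>2)) + p\<^sup>2 / (4 * ?k\<^sup>2)"
    by (subst sum.nat_ivl_Suc') (simp_all add: p_def add.commute)
  moreover have "(\<Sum>k=1..Suc (Suc N). (a k - a (k - 1))\<^sup>2) = (\<Sum>k=1..Suc N. (a k - a (k - 1))\<^sup>2) + (p - q)\<^sup>2"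
    by (subst sum.nat_ivl_Suc') (simp_all add: p_def q_def add.commute)
  moreover have "sqrt (real (Suc N + 2) / real (Suc N + 1)) = sqrt ((?k + 1) / ?k)" by (simp add: add_ac)
  ultimately show ?case by (simp only: p_def[symmetric])
qed

lemma discrete_Hardy:
  fixes a :: "nat \<Rightarrow> real"
  assumes "a 0 = 0"
  shows "(\<Sum>k=1..N. (a k)\<^sup>2 / (real k)\<^sup>2) \<le> 4 * (\<Sum>k=1..N. (a k - a (k - 1))\<^sup>2)"
proof (cases N)
  case (Suc M)
  have "1 \<le> sqrt (real (M + 2) / real (M + 1))" by (rule real_le_rsqrt) simp
  then have "0 \<le> (a (Suc M))\<^sup>2 * (sqrt (real (M + 2) / real (M + 1)) - 1)" by simp
  then have "(\<Sum>k=1..Suc M. (a k)\<^sup>2 / (4 * (real k)\<^sup>2)) \<le> (\<Sum>k=1..Suc M. (a k - a (k - 1))\<^sup>2)"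
    using discrete_Hardy_aux[of a M] assms by linarith
  moreover have "(\<Sum>k=1..Suc M. (a k)\<^sup>2 / (real k)\<^sup>2) = 4 * (\<Sum>k=1..Suc M. (a k)\<^sup>2 / (4 * (real k)\<^sup>2))"
    unfolding sum_distrib_left by (rule sum.cong) auto
  ultimately show ?thesis unfolding Suc by linarith
qed simp

text \<open>
  Nearly extremal sequences for the Hardy inequality: \<open>sqrt n\<close> up to \<open>M\<close>, then a linear descent to
  \<open>0\<close> that costs only a bounded amount.
\<close>

definition hardy_seq :: "nat \<Rightarrow> nat \<Rightarrow> real" where
  "hardy_seq M n = (if n \<le> M then sqrt (real n) else if n \<le> 2 * M then (2 * real M - real n) / sqrt (real M) else 0)"

lemma hardy_seq_weighted_ge:
  "harm M \<le> (\<Sum>n=1..2 * M. (hardy_seq M n)\<^sup>2 / (real n)\<^sup>2)"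
proof -
  have "(harm M :: real) = (\<Sum>n=1..M. (hardy_seq M n)\<^sup>2 / (real n)\<^sup>2)"
    unfolding harm_def by (rule sum.cong) (auto simp: hardy_seq_def power2_eq_square divide_inverse)
  also have "\<dots> \<le> (\<Sum>n=1..2 * M. (hardy_seq M n)\<^sup>2 / (real n)\<^sup>2)"
    by (rule sum_mono2) auto
  finally show ?thesis .
qed

lemma sqrt_difference_square:
  assumes "m \<ge> (1::nat)"
  shows "(sqrt (real (Suc m)) - sqrt (real m))\<^sup>2 \<le> inverse (real m) / 4"
proof -
  have m: "sqrt (real m) > 0" using assms by simp
  define d where "d = sqrt (real (Suc m)) - sqrt (real m)"
  have d0: "d \<ge> 0" by (simp add: d_def)
  have "d * (sqrt (real (Suc m)) + sqrt (real m)) = 1"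
    by (simp add: d_def algebra_simps)
  moreover have "d * (2 * sqrt (real m)) \<le> d * (sqrt (real (Suc m)) + sqrt (real m))"
    by (intro mult_left_mono d0) simp
  ultimately have "d * (2 * sqrt (real m)) \<le> 1" by simp
  then have "(d * (2 * sqrt (real m)))\<^sup>2 \<le> 1" using d0 by (intro power_le_one) auto
  then have "d\<^sup>2 * (4 * real m) \<le> 1" by (simp add: power_mult_distrib)
  then show ?thesis unfolding d_def[symmetric] using assms by (simp add: field_simps)
qed

lemma hardy_seq_energy_le:
  assumes M: "M \<ge> 1"
  shows "(\<Sum>n=1..2 * M. (hardy_seq M n - hardy_seq M (n - 1))\<^sup>2) \<le> 2 + harm M / 4"
proof -
  have ramp: "(\<Sum>n=1..Suc k. (sqrt (real n) - sqrt (real (n - 1)))\<^sup>2) \<le> 1 + harm k / 4" for k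
  proof (induction k)
    case 0 show ?case by (simp add: harm_def)
  next
    case (Suc k)
    have "(\<Sum>n=1..Suc (Suc k). (sqrt (real n) - sqrt (real (n - 1)))\<^sup>2) =
       (\<Sum>n=1..Suc k. (sqrt (real n) - sqrt (real (n - 1)))\<^sup>2) + (sqrt (real (Suc (Suc k))) - sqrt (real (Suc k)))\<^sup>2"
      by (subst sum.nat_ivl_Suc') (simp_all add: add.commute)
    also have "\<dots> \<le> (1 + harm k / 4) + inverse (real (Suc k)) / 4"
      by (intro add_mono Suc.IH sqrt_difference_square) simp
    also have "\<dots> = 1 + harm (Suc k) / 4" by (simp add: harm_Suc)
    finally show ?case .
  qed
  have up: "(\<Sum>n=1..M. (hardy_seq M n - hardy_seq M (n - 1))\<^sup>2) \<le> 1 + harm M / 4"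
  proof -
    have "(\<Sum>n=1..M. (hardy_seq M n - hardy_seq M (n - 1))\<^sup>2) = (\<Sum>n=1..M. (sqrt (real n) - sqrt (real (n - 1)))\<^sup>2)"
      by (rule sum.cong) (auto simp: hardy_seq_def)
    also have "\<dots> \<le> (\<Sum>n=1..Suc M. (sqrt (real n) - sqrt (real (n - 1)))\<^sup>2)" by (rule sum_mono2) auto
    also have "\<dots> \<le> 1 + harm M / 4" by (rule ramp)
    finally show ?thesis .
  qed
  have "hardy_seq M n - hardy_seq M (n - 1) = - (1 / sqrt (real M))" if "n \<in> {M + 1..2 * M}" for n
  proof -
    have s: "hardy_seq M j = (2 * real M - real j) / sqrt (real M)" if "M \<le> j" "j \<le> 2 * M" for j
    proof (cases "j = M")
      case True
      then show ?thesis using M by (simp add: hardy_seq_def real_div_sqrt)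
    qed (use that in \<open>simp add: hardy_seq_def\<close>)
    have "real (n - 1) = real n - 1" using that by simp
    then show ?thesis using that by (subst s, simp, simp, subst s) (auto simp: diff_divide_distrib[symmetric])
  qed
  then have "(\<Sum>n\<in>{M + 1..2 * M}. (hardy_seq M n - hardy_seq M (n - 1))\<^sup>2) = (\<Sum>n\<in>{M + 1..2 * M}. 1 / real M)"
    by (intro sum.cong refl) (simp add: power_divide)
  then have down: "(\<Sum>n\<in>{M + 1..2 * M}. (hardy_seq M n - hardy_seq M (n - 1))\<^sup>2) = 1" using M by simp
  have "{1..2 * M} = {1..M} \<union> {M + 1..2 * M}" using M by auto
  then have "(\<Sum>n=1..2 * M. (hardy_seq M n - hardy_seq M (n - 1))\<^sup>2) =
     (\<Sum>n=1..M. (hardy_seq M n - hardy_seq M (n - 1))\<^sup>2) + (\<Sum>n\<in>{M + 1..2 * M}. (hardy_seq M n - hardy_seq M (n - 1))\<^sup>2)"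
    by (simp add: sum.union_disjoint)
  then show ?thesis using up down by linarith
qed

lemma hardy_seq_beyond: "M \<ge> 1 \<Longrightarrow> 2 * M \<le> n \<Longrightarrow> hardy_seq M n = 0"
  by (auto simp: hardy_seq_def)

subsection \<open>Trigonometric functions on the circle\<close>

text \<open>
  For \<open>d = 2\<close> the two basis vectors identify the space with the complex plane.
\<close>

locale circle =
  fixes b1 b2 :: "'a::euclidean_space"
  assumes Basis_eq: "Basis = {b1, b2}" and b_neq: "b1 \<noteq> b2"
begin

lemma DIM2: "DIM('a) = 2" by (simp add: Basis_eq b_neq)

lemma d2: "2 \<le> DIM('a)" by (simp add: DIM2)

definition z :: "'a \<Rightarrow> complex" where "z x = Complex (x \<bullet> b1) (x \<bullet> b2)"

lemma z_eq: "z x = of_real (x \<bullet> b1) + \<i> * of_real (x \<bullet> b2)"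
  by (simp add: z_def complex_eq_iff)

lemma inner_eq_Re: "x \<bullet> e = Re (z x * cnj (z e))"
  by (subst euclidean_inner) (simp add: Basis_eq b_neq z_def)

lemma norm_z: "norm (z x) = norm x"
proof -
  have "(norm (z x))\<^sup>2 = (x \<bullet> b1)\<^sup>2 + (x \<bullet> b2)\<^sup>2"
    by (simp only: z_def cmod_power2 complex.sel)
  also have "\<dots> = x \<bullet> x"
    by (subst euclidean_inner) (simp add: Basis_eq b_neq power2_eq_square)
  finally show ?thesis by (simp add: dot_square_norm power2_eq_iff_nonneg)
qed

lemma z_cnj: "norm x = 1 \<Longrightarrow> z x * cnj (z x) = 1"
  by (simp add: complex_norm_square[symmetric] norm_z)

lemma z_b1: "z b1 = 1"
proof -
  have "b1 \<in> Basis" "b2 \<in> Basis" by (auto simp: Basis_eq)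
  then show ?thesis using b_neq by (simp add: z_def complex_eq_iff inner_Basis)
qed

lemma z_polynomial: "polynomial_function z"
  unfolding z_eq [abs_def] by (intro polynomial_function_add polynomial_function_complex_mult polynomial_function_coord polynomial_function_const)

lemma z_power_polynomial: "polynomial_function (\<lambda>x. z x ^ n)"
  by (induction n) (auto intro: polynomial_function_complex_mult z_polynomial)

lemma z_power_partial_deriv:
  "partial_deriv b (\<lambda>x. c * z x ^ n) x = c * (of_nat n * z b * z x ^ (n - 1))"
proof -
  have "(z has_derivative z) (at x)"
    unfolding z_eq [abs_def] by (auto intro!: derivative_eq_intros)
  then have "((\<lambda>x. c * z x ^ n) has_derivative (\<lambda>v. c * (of_nat n * z v * z x ^ (n - 1)))) (at x)"
    by (intro has_derivative_mult_right has_derivative_power)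
  then show ?thesis by (rule partial_deriv_eq)
qed

lemma z_power_harmonic: "homogeneous_harmonic n (\<lambda>x. z x ^ n)"
proof -
  have B: "b1 \<in> Basis" "b2 \<in> Basis" by (auto simp: Basis_eq)
  have zb: "z b1 = 1" "z b2 = \<i>"
    using b_neq B by (simp_all add: z_def complex_eq_iff inner_Basis)
  have 1: "partial_deriv b (\<lambda>x. z x ^ n) = (\<lambda>x. (of_nat n * z b) * z x ^ (n - 1))" for b
    using z_power_partial_deriv[of b 1 n] by auto
  have "laplacian (\<lambda>x. z x ^ n) x = 0" for x
  proof -
    have "partial_deriv b (\<lambda>x. (of_nat n * z b) * z x ^ (n - 1)) x
        = (of_nat n * of_nat (n - 1) * z x ^ (n - 1 - 1)) * (z b * z b)" for b
      unfolding z_power_partial_deriv by (simp only: mult_ac)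
    then have "laplacian (\<lambda>x. z x ^ n) x = (of_nat n * of_nat (n - 1) * z x ^ (n - 1 - 1)) * (z b1 * z b1 + z b2 * z b2)"
      unfolding laplacian_def 1 by (simp add: Basis_eq b_neq distrib_left)
    then show ?thesis by (simp add: zb)
  qed
  moreover have "z (t *\<^sub>R x) = t *\<^sub>R z x" for t x by (simp add: z_def complex_eq_iff)
  ultimately show ?thesis by (simp add: homogeneous_harmonic_def z_power_polynomial scaleR_conv_of_real power_mult_distrib)
qed

lemma sphere_valued_2: "sphere_valued (f :: 'a \<Rightarrow> complex)"
  by (simp add: sphere_valued_def DIM2)

text \<open>On the circle this is \<open>z\<^sup>k\<close>; the formula extends it to a polynomial also for negative \<open>k\<close>.\<close>

definition E :: "int \<Rightarrow> 'a \<Rightarrow> complex" where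
  "E k x = (if 0 \<le> k then z x ^ nat k else cnj (z x) ^ nat (- k))"

lemma E_harmonic: "(\<lambda>x. c * E k x) \<in> spherical_harmonics (nat \<bar>k\<bar>)"
proof (cases "0 \<le> k")
  case True
  have "homogeneous_harmonic (nat \<bar>k\<bar>) (\<lambda>x. c * z x ^ nat \<bar>k\<bar>)"
    by (rule homogeneous_harmonic_cmult[OF z_power_harmonic])
  then show ?thesis using True by (auto simp: spherical_harmonics_eq sphere_valued_2 E_def)
next
  case False
  have "homogeneous_harmonic (nat \<bar>k\<bar>) (\<lambda>x. c * cnj (z x ^ nat \<bar>k\<bar>))"
    by (rule homogeneous_harmonic_cmult[OF homogeneous_harmonic_cnj[OF z_power_harmonic]])
  then show ?thesis using False by (auto simp: spherical_harmonics_eq sphere_valued_2 E_def)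
qed

lemma sq_E: "square_integrable (\<lambda>x. c * E k x)"
  by (rule spherical_harmonics_square_integrable[OF E_harmonic])

lemma norm_E: "norm x = 1 \<Longrightarrow> norm (E k x) = 1"
  by (simp add: E_def norm_power norm_z)

lemma z_E: "norm x = 1 \<Longrightarrow> z x * E k x = E (k + 1) x"
proof -
  assume x: "norm x = 1"
  consider "0 \<le> k" | "k = -1" | "k < -1" by linarith
  then show ?thesis
  proof cases
    case 1
    then have "nat (k + 1) = Suc (nat k)" by simp
    then show ?thesis using 1 by (simp add: E_def)
  next
    case 2
    then show ?thesis using z_cnj[OF x] by (simp add: E_def)
  next
    case 3
    then have "nat (- k) = Suc (nat (- (k + 1)))" by simp
    then show ?thesis using 3 z_cnj[OF x] by (simp add: E_def mult.assoc[symmetric])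
  qed
qed

lemma cnj_z_E: "norm x = 1 \<Longrightarrow> cnj (z x) * E k x = E (k - 1) x"
  using z_E[of x "k - 1"] z_cnj[of x] by (metis add.commute diff_add_cancel mult.commute mult.left_commute mult_1)

lemma inner_E_self: "cls (\<lambda>x. c * E k x) \<bullet> cls (\<lambda>x. c' * E k x) = Re (c * cnj c')"
proof -
  have "(\<integral>x. (c * E k x) \<bullet> (c' * E k x) \<partial>sphere_measure) = (\<integral>x. Re (c * cnj c') \<partial>(sphere_measure :: 'a measure))"
  proof (rule Bochner_Integration.integral_cong[OF refl])
    fix x :: 'a assume "x \<in> space sphere_measure"
    then have "norm (E k x) = 1" by (intro norm_E) simp
    then have 1: "E k x * cnj (E k x) = 1" by (simp add: complex_norm_square[symmetric])
    have "(c * E k x) \<bullet> (c' * E k x) = Re ((c * cnj c') * (E k x * cnj (E k x)))"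
      by (simp add: inner_complex_def algebra_simps)
    then show "(c * E k x) \<bullet> (c' * E k x) = Re (c * cnj c')" unfolding 1 by simp
  qed
  then show ?thesis
    unfolding inner_cls[OF sq_E sq_E] using sphere_area_pos[where 'a='a] by (simp add: measure_sphere_measure)
qed

lemma norm_E_cls: "norm (cls (\<lambda>x. c * E k x)) = norm c"
proof -
  have "(norm (cls (\<lambda>x. c * E k x)))\<^sup>2 = (norm c)\<^sup>2"
    unfolding power2_norm_eq_inner[of "cls (\<lambda>x. c * E k x)"] inner_E_self complex_norm_square[symmetric] by simp
  then show ?thesis by (simp add: power2_eq_iff_nonneg)
qed

lemma inner_E_orth:
  assumes "j \<noteq> k" shows "cls (\<lambda>x. c * E j x) \<bullet> cls (\<lambda>x. c' * E k x) = 0"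
proof (cases "nat \<bar>j\<bar> = nat \<bar>k\<bar>")
  case False
  then show ?thesis by (rule spherical_harmonics_orthogonal[OF d2 E_harmonic E_harmonic])
next
  case True
  \<comment> \<open>Opposite frequencies: their product is a nonconstant power of \<open>z\<close>, orthogonal to the constants.\<close>
  then have kj: "k = - j" "j \<noteq> 0" using assms by auto
  have key: "cls (\<lambda>x. c * E (int n) x) \<bullet> cls (\<lambda>x. c' * E (- int n) x) = 0" if n: "n \<noteq> 0" for n c c'
  proof -
    have "(c * E (int n) x) \<bullet> (c' * E (- int n) x) = ((c * cnj c') * E (int (2 * n)) x) \<bullet> (1 * E 0 x)" for x
    proof -
      have "E (- int n) x = cnj (E (int n) x)" using n by (simp add: E_def)
      moreover have "E (int (2 * n)) x = E (int n) x * E (int n) x"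
        by (simp only: E_def of_nat_0_le_iff if_True nat_int mult_2 power_add)
      moreover have "E 0 x = 1" by (simp add: E_def)
      moreover have "(c * w) \<bullet> (c' * cnj w) = ((c * cnj c') * (w * w)) \<bullet> (1 * 1)" for w :: complex
        by (simp add: inner_complex_def algebra_simps)
      ultimately show ?thesis by (simp only:)
    qed
    then have "cls (\<lambda>x. c * E (int n) x) \<bullet> cls (\<lambda>x. c' * E (- int n) x) = cls (\<lambda>x. (c * cnj c') * E (int (2 * n)) x) \<bullet> cls (\<lambda>x. 1 * E 0 x)"
      unfolding inner_cls[OF sq_E sq_E] by simp
    also have "\<dots> = 0"
      by (rule spherical_harmonics_orthogonal[OF d2 E_harmonic E_harmonic]) (use n in simp)
    finally show ?thesis .
  qed
  show ?thesis
  proof (cases "0 < j")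
    case True
    then show ?thesis using key[of "nat j" c c'] kj by simp
  next
    case False
    then show ?thesis using key[of "nat (- j)" c' c] kj by (simp add: inner_commute)
  qed
qed

text \<open>The Fourier coefficient, put together from two real inner products.\<close>

definition coef :: "int \<Rightarrow> 'a sphere_l2 \<Rightarrow> complex" where
  "coef k F = Complex (F \<bullet> cls (\<lambda>x. 1 * E k x)) (F \<bullet> cls (\<lambda>x. \<i> * E k x))"

lemma inner_coef: "F \<bullet> cls (\<lambda>x. c * E k x) = Re (coef k F * cnj c)"
proof -
  have c: "c * E k x = Re c *\<^sub>R (1 * E k x) + Im c *\<^sub>R (\<i> * E k x)" for x
    by (simp add: complex_eq_iff algebra_simps)
  have "cls (\<lambda>x. c * E k x) = Re c *\<^sub>R cls (\<lambda>x. 1 * E k x) + Im c *\<^sub>R cls (\<lambda>x. \<i> * E k x)"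
    by (subst c) (simp only: cls_add square_integrable_scaleR sq_E cls_scaleR)
  then show ?thesis by (simp only: inner_add_right inner_scaleR_right) (simp add: coef_def mult.commute)
qed

lemma coef_eqI:
  assumes "\<And>c. F \<bullet> cls (\<lambda>x. c * E k x) = Re (a * cnj c)" shows "coef k F = a"
  using assms[of 1] assms[of \<i>] by (simp only: coef_def) (simp add: complex_eq_iff)

lemma coef_Bessel:
  assumes "finite K" shows "(\<Sum>k\<in>K. (norm (coef k F))\<^sup>2) \<le> (norm F)\<^sup>2"
proof -
  let ?Y = "\<lambda>k. cls (\<lambda>x. coef k F * E k x)"
  have "(\<Sum>k\<in>K. (norm (?Y k))\<^sup>2) \<le> (norm F)\<^sup>2"
  proof (rule Bessel_inequality[OF _ _ assms])
    show "?Y j \<bullet> ?Y k = 0" if "j \<noteq> k" for j k using that by (rule inner_E_orth)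
    show "F \<bullet> ?Y k = (norm (?Y k))\<^sup>2" for k
      unfolding norm_E_cls inner_coef complex_norm_square[symmetric] by simp
  qed
  then show ?thesis by (simp add: norm_E_cls)
qed

text \<open>
  Euler's identity writes \<open>n * p\<close> through the partial derivatives, which have lower degree; on the
  circle this leaves \<open>z\<^sup>n\<close>, \<open>cnj z\<^sup>n\<close> and, for \<open>n \<ge> 2\<close>, a harmonic of degree \<open>n - 2\<close>,
  which must vanish by orthogonality.
\<close>

lemma spherical_harmonics_circle:
  assumes "Y \<in> spherical_harmonics n"
  shows "\<exists>\<alpha> \<beta>. \<forall>x. norm x = 1 \<longrightarrow> Y x = \<alpha> * E (int n) x + \<beta> * E (- int n) x"
  using assms
proof (induction n arbitrary: Y)
  case 0
  then obtain p where p: "homogeneous_harmonic 0 p" "\<forall>x\<in>sphere 0 1. Y x = p x" by (auto simp: spherical_harmonics_eq)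
  then show ?case using homogeneous_harmonic_0[OF p(1)]
    by (intro exI[of _ "p 0"] exI[of _ 0]) (auto simp: E_def)
next
  case (Suc n)
  then obtain p where p: "homogeneous_harmonic (Suc n) p" "\<forall>x\<in>sphere 0 1. Y x = p x" by (auto simp: spherical_harmonics_eq)
  note P = homogeneous_harmonicD[OF p(1)]
  have "partial_deriv b p \<in> spherical_harmonics n" for b
    using homogeneous_harmonic_partial_deriv[OF p(1)] by (auto simp: spherical_harmonics_eq sphere_valued_2)
  from Suc.IH[OF this] obtain \<alpha> \<beta> where
    ab: "\<And>b x. norm x = 1 \<Longrightarrow> partial_deriv b p x = \<alpha> b * E (int n) x + \<beta> b * E (- int n) x" by metis
  define A where "A = (\<alpha> b1 - \<i> * \<alpha> b2) / (2 * of_nat (Suc n))"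
  define B where "B = (\<beta> b1 + \<i> * \<beta> b2) / (2 * of_nat (Suc n))"
  define C where "C = (\<alpha> b1 + \<i> * \<alpha> b2) / (2 * of_nat (Suc n))"
  define D where "D = (\<beta> b1 - \<i> * \<beta> b2) / (2 * of_nat (Suc n))"
  have n0: "(of_nat (Suc n) :: complex) \<noteq> 0" by (rule of_nat_neq_0)
  have Yx: "Y x = A * E (int (Suc n)) x + B * E (- int (Suc n)) x + (C * E (int n - 1) x + D * E (- int n + 1) x)"
    if x: "norm x = 1" for x
  proof -
    have x1: "of_real (x \<bullet> b1) = (z x + cnj (z x)) / 2" and x2: "of_real (x \<bullet> b2) = - \<i> * (z x - cnj (z x)) / 2"
      by (simp_all add: z_def complex_eq_iff)
    have "of_nat (Suc n) * p x = (\<Sum>b\<in>Basis. of_real (x \<bullet> b) * partial_deriv b p x)"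
      by (rule Euler_homogeneous[OF P(1,2), symmetric])
    also have "\<dots> = of_real (x \<bullet> b1) * partial_deriv b1 p x + of_real (x \<bullet> b2) * partial_deriv b2 p x"
      by (simp add: Basis_eq b_neq)
    also have "\<dots> = (\<alpha> b1 - \<i> * \<alpha> b2) / 2 * (z x * E (int n) x) + (\<beta> b1 + \<i> * \<beta> b2) / 2 * (cnj (z x) * E (- int n) x)
       + ((\<alpha> b1 + \<i> * \<alpha> b2) / 2 * (cnj (z x) * E (int n) x) + (\<beta> b1 - \<i> * \<beta> b2) / 2 * (z x * E (- int n) x))"
      unfolding ab[OF x] x1 x2 by (simp add: field_simps)
    also have "\<dots> = of_nat (Suc n) * (A * E (int (Suc n)) x + B * E (- int (Suc n)) x + (C * E (int n - 1) x + D * E (- int n + 1) x))"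
    proof -
      have "(\<alpha> b1 - \<i> * \<alpha> b2) / 2 = of_nat (Suc n) * A" "(\<beta> b1 + \<i> * \<beta> b2) / 2 = of_nat (Suc n) * B"
        "(\<alpha> b1 + \<i> * \<alpha> b2) / 2 = of_nat (Suc n) * C" "(\<beta> b1 - \<i> * \<beta> b2) / 2 = of_nat (Suc n) * D"
        unfolding A_def B_def C_def D_def using n0 by (simp_all del: of_nat_Suc)
      moreover have "int n + 1 = int (Suc n)" "- int n - 1 = - int (Suc n)" by simp_all
      ultimately show ?thesis
        unfolding z_E[OF x] cnj_z_E[OF x] by (simp only: distrib_left mult.assoc)
    qed
    finally have "p x = A * E (int (Suc n)) x + B * E (- int (Suc n)) x + (C * E (int n - 1) x + D * E (- int n + 1) x)"
      using n0 by (simp only: mult_cancel_left) simp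
    then show ?thesis using p(2) x by simp
  qed
  show ?case
  proof (cases "n = 0")
    case True
    then have e: "int n - 1 = - int (Suc n)" "- int n + 1 = int (Suc n)" by auto
    have "Y x = (A + D) * E (int (Suc n)) x + (B + C) * E (- int (Suc n)) x" if "norm x = 1" for x
      using Yx[OF that] unfolding e by (simp only: distrib_right add_ac)
    then show ?thesis by blast
  next
    case False
    let ?q = "\<lambda>x. C * E (int n - 1) x + D * E (- int n + 1) x"
    let ?r = "\<lambda>x. Y x + (- A * E (int (Suc n)) x + - B * E (- int (Suc n)) x)"
    have nn: "nat \<bar>int n - 1\<bar> = n - 1" "nat \<bar>- int n + 1\<bar> = n - 1" "nat \<bar>int (Suc n)\<bar> = Suc n" "nat \<bar>- int (Suc n)\<bar> = Suc n"
      using False by auto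
    have q: "?q \<in> spherical_harmonics (n - 1)"
      by (rule spherical_harmonics_add) (use E_harmonic[of C "int n - 1"] E_harmonic[of D "- int n + 1"] nn in simp_all)
    have r: "?r \<in> spherical_harmonics (Suc n)"
      by (intro spherical_harmonics_add Suc.prems)
         (use E_harmonic[of "- A" "int (Suc n)"] E_harmonic[of "- B" "- int (Suc n)"] nn in simp_all)
    have "cls ?q = cls ?r"
      by (rule cls_cong[OF spherical_harmonics_square_integrable[OF q] spherical_harmonics_square_integrable[OF r]])
         (use Yx in simp)
    moreover have "cls ?q \<bullet> cls ?r = 0"
      by (rule spherical_harmonics_orthogonal[OF d2 q r]) simp
    ultimately have "cls ?q = 0" by simp
    then have "?q x = 0" if "norm x = 1" for x
      by (rule continuous_cls_eq_0[OF spherical_harmonics_continuous[OF q] _ that])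
    then have "Y x = A * E (int (Suc n)) x + B * E (- int (Suc n)) x" if "norm x = 1" for x
      using Yx[OF that] that by simp
    then show ?thesis by blast
  qed
qed

lemma norm_sphere_proj_circle:
  assumes h: "h \<in> sphere_L2" and n: "1 \<le> n"
  shows "(norm (cls (sphere_proj n h)))\<^sup>2 = (norm (coef (int n) (cls h)))\<^sup>2 + (norm (coef (- int n) (cls h)))\<^sup>2"
proof -
  note Y = sphere_proj_in[OF h, of n]
  obtain \<alpha> \<beta> where ab: "\<And>x. norm x = 1 \<Longrightarrow> sphere_proj n h x = \<alpha> * E (int n) x + \<beta> * E (- int n) x"
    using spherical_harmonics_circle[OF Y] by blast
  have ne: "int n \<noteq> - int n" "- int n \<noteq> int n" using n by auto
  have c: "cls (sphere_proj n h) = cls (\<lambda>x. \<alpha> * E (int n) x) + cls (\<lambda>x. \<beta> * E (- int n) x)"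
    unfolding cls_add[OF sq_E sq_E, symmetric]
    by (rule cls_cong[OF spherical_harmonics_square_integrable[OF Y] square_integrable_add[OF sq_E sq_E] ab])
  have "coef (int n) (cls h) = \<alpha>"
  proof (rule coef_eqI)
    fix c'
    have "(\<lambda>x. c' * E (int n) x) \<in> spherical_harmonics n" using E_harmonic[of c' "int n"] by simp
    from sphere_proj_inner[OF h this] show "cls h \<bullet> cls (\<lambda>x. c' * E (int n) x) = Re (\<alpha> * cnj c')"
      unfolding c inner_add_left inner_E_self inner_E_orth[OF ne(2)] by simp
  qed
  moreover have "coef (- int n) (cls h) = \<beta>"
  proof (rule coef_eqI)
    fix c'
    have "(\<lambda>x. c' * E (- int n) x) \<in> spherical_harmonics n" using E_harmonic[of c' "- int n"] by simp
    from sphere_proj_inner[OF h this] show "cls h \<bullet> cls (\<lambda>x. c' * E (- int n) x) = Re (\<beta> * cnj c')"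
      unfolding c inner_add_left inner_E_self inner_E_orth[OF ne(1)] by simp
  qed
  moreover have "(norm (cls (sphere_proj n h)))\<^sup>2 = (norm \<alpha>)\<^sup>2 + (norm \<beta>)\<^sup>2"
    unfolding c power2_norm_eq_inner[of "cls _ + cls _"] inner_add_left inner_add_right inner_E_self
      inner_E_orth[OF ne(1)] inner_E_orth[OF ne(2)] complex_norm_square[symmetric] by simp
  ultimately show ?thesis by simp
qed

subsection \<open>The weight as a squared difference\<close>

lemma sq_shift: "square_integrable f \<Longrightarrow> square_integrable (\<lambda>x. c * z x * f x)"
proof (rule square_integrable_dom[of f _ "norm c"])
  assume f: "square_integrable f"
  have "(\<lambda>x. c * z x) \<in> borel_measurable sphere_measure"
    by (intro continuous_on_sphere_measurable continuous_intros continuous_on_polymonial_function[OF z_polynomial])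
  then show "(\<lambda>x. c * z x * f x) \<in> borel_measurable sphere_measure" using square_integrableD[OF f] by measurable
qed (auto simp: norm_mult norm_z)

text \<open>For \<open>norm x = norm e = 1\<close> one has \<open>2 * (1 - x \<bullet> e) = (norm (1 - cnj (z e) * z x))\<^sup>2\<close>.\<close>

lemma weight_eq_shift:
  assumes f: "square_integrable f" and e: "norm e = 1"
  shows "(norm (cls (\<lambda>x. f x - cnj (z e) * z x * f x)))\<^sup>2 = 2 * ((norm (cls f))\<^sup>2 - coord_mult e (cls f) \<bullet> cls f)"
proof -
  have sq: "square_integrable (\<lambda>x. f x - cnj (z e) * z x * f x)" by (intro square_integrable_diff f sq_shift)
  have "(\<integral>x. (norm (f x - cnj (z e) * z x * f x))\<^sup>2 \<partial>sphere_measure) = (\<integral>x. 2 * ((1 - x \<bullet> e) * (norm (f x))\<^sup>2) \<partial>sphere_measure)"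
  proof (rule Bochner_Integration.integral_cong[OF refl])
    fix x :: 'a assume "x \<in> space sphere_measure"
    then have x: "norm x = 1" by simp
    define v where "v = z x * cnj (z e)"
    have "norm v = 1" using x e by (simp add: v_def norm_mult norm_z)
    then have v: "v * cnj v = 1" unfolding complex_norm_square[symmetric] by simp
    have "complex_of_real ((norm (1 - v))\<^sup>2) = (1 - v) * cnj (1 - v)" by (rule complex_norm_square)
    also have "\<dots> = 2 - (v + cnj v)" using v by (simp add: algebra_simps)
    also have "\<dots> = complex_of_real (2 - 2 * Re v)" by (simp add: complex_eq_iff)
    finally have "(norm (1 - v))\<^sup>2 = 2 * (1 - x \<bullet> e)" unfolding inner_eq_Re v_def by (simp only: of_real_eq_iff) simp
    moreover have "f x - cnj (z e) * z x * f x = (1 - v) * f x" by (simp add: v_def algebra_simps)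
    ultimately show "(norm (f x - cnj (z e) * z x * f x))\<^sup>2 = 2 * ((1 - x \<bullet> e) * (norm (f x))\<^sup>2)"
      by (simp add: norm_mult power_mult_distrib)
  qed
  also have "\<dots> = 2 * (\<integral>x. (1 - x \<bullet> e) * (norm (f x))\<^sup>2 \<partial>sphere_measure)" by simp
  finally show ?thesis
    unfolding norm_cls_eq_integral[OF sq] weighted_integral[OF f] using sphere_area_pos[where 'a='a] by simp
qed

lemma coef_shift:
  assumes f: "square_integrable f"
  shows "coef k (cls (\<lambda>x. f x - cnj w * z x * f x)) = coef k (cls f) - cnj w * coef (k - 1) (cls f)"
proof (rule coef_eqI)
  fix c
  note sq = sq_shift[OF f, of "cnj w"]
  have "cls (\<lambda>x. cnj w * z x * f x) \<bullet> cls (\<lambda>x. c * E k x) = cls f \<bullet> cls (\<lambda>x. (w * c) * E (k - 1) x)"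
    unfolding inner_cls[OF sq sq_E] inner_cls[OF f sq_E]
  proof (rule arg_cong[of _ _ "\<lambda>t. t / _"], rule Bochner_Integration.integral_cong[OF refl])
    fix x :: 'a assume "x \<in> space sphere_measure"
    then have "E (k - 1) x = cnj (z x) * E k x" by (simp add: cnj_z_E)
    then show "(cnj w * z x * f x) \<bullet> (c * E k x) = f x \<bullet> ((w * c) * E (k - 1) x)"
      by (simp add: inner_complex_def algebra_simps)
  qed
  also have "\<dots> = Re (cnj w * coef (k - 1) (cls f) * cnj c)"
    unfolding inner_coef by (simp add: algebra_simps)
  finally have eq: "cls (\<lambda>x. cnj w * z x * f x) \<bullet> cls (\<lambda>x. c * E k x) = Re (cnj w * coef (k - 1) (cls f) * cnj c)" .
  show "cls (\<lambda>x. f x - cnj w * z x * f x) \<bullet> cls (\<lambda>x. c * E k x)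
     = Re ((coef k (cls f) - cnj w * coef (k - 1) (cls f)) * cnj c)"
    unfolding cls_diff[OF f sq] inner_diff_left eq inner_coef[of "cls f" c k] left_diff_distrib by simp
qed

end

subsection \<open>The sharp Hardy--Rellich constant\<close>

context circle
begin

lemma eigenvalue_circle: "eigenvalue TYPE('a) n = (real n)\<^sup>2"
  by (simp add: eigenvalue_def DIM2 power2_eq_square)

lemma eigenvalue_circle_sqrt: "eigenvalue TYPE('a) n powr (1/2) = real n"
proof -
  have "(real n)\<^sup>2 powr (1/2) = sqrt ((real n)\<^sup>2)" by (rule powr_half_sqrt) simp
  then show ?thesis by (simp add: eigenvalue_circle)
qed

lemma sum_coef_differences_le:
  fixes F :: "'a sphere_l2"
  shows "(\<Sum>j=1..N. (norm (coef (int j) F))\<^sup>2) + (\<Sum>j=1..N. (norm (coef (1 - int j) F))\<^sup>2) \<le> (norm F)\<^sup>2"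
proof -
  have 1: "(\<Sum>j=1..N. (norm (coef (int j) F))\<^sup>2) = (\<Sum>k\<in>int ` {1..N}. (norm (coef k F))\<^sup>2)"
    by (subst sum.reindex) (auto simp: inj_on_def)
  have 2: "(\<Sum>j=1..N. (norm (coef (1 - int j) F))\<^sup>2) = (\<Sum>k\<in>(\<lambda>j. 1 - int j) ` {1..N}. (norm (coef k F))\<^sup>2)"
    by (subst sum.reindex) (auto simp: inj_on_def)
  have "(\<Sum>j=1..N. (norm (coef (int j) F))\<^sup>2) + (\<Sum>j=1..N. (norm (coef (1 - int j) F))\<^sup>2)
     = (\<Sum>k\<in>int ` {1..N} \<union> (\<lambda>j. 1 - int j) ` {1..N}. (norm (coef k F))\<^sup>2)"
    unfolding 1 2 by (rule sum.union_disjoint[symmetric]) auto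
  also have "\<dots> \<le> (norm F)\<^sup>2" by (rule coef_Bessel) simp
  finally show ?thesis .
qed

text \<open>
  Let \<open>h\<close> be the square root of minus the Laplace--Beltrami operator applied to \<open>g\<close>, and \<open>a\<^sub>k\<close> its Fourier
  coefficients.  Then \<open>norm g\<close> squared is the sum of \<open>(norm a\<^sub>k / k)\<^sup>2\<close>, and twice the weighted integral of \<open>h\<close>
  is the squared norm of \<open>h - cnj (z e) * z * h\<close>, whose coefficients are \<open>a\<^sub>k - cnj (z e) * a\<^sub>k\<^sub>-\<^sub>1\<close>.  As
  \<open>a\<^sub>0 = 0\<close>, the discrete Hardy inequality applies to the positive and to the negative frequencies.
\<close>

theorem Hardy_Rellich_circle: "hardy_rellich_constant TYPE('a) 8"
  unfolding hardy_rellich_constant_def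
proof
  fix g :: "'a \<Rightarrow> complex" assume g: "g \<in> sphere_W21_zero_mean"
  have gL: "g \<in> sphere_L2" and gm: "(\<integral>y. g y \<partial>sphere_measure) = 0"
    using g by (auto simp: sphere_W21_zero_mean_def sphere_W21_def)
  have ex: "\<exists>h. is_neg_laplace_beltrami_power (1/2) g h"
    using g by (auto simp: sphere_W21_zero_mean_def sphere_W21_def)
  define h where "h = neg_laplace_beltrami_power (1/2) g"
  have nlb: "is_neg_laplace_beltrami_power (1/2) g h"
    unfolding h_def neg_laplace_beltrami_power_def by (rule someI_ex[OF ex])
  note H = is_neg_laplace_beltrami_powerD[OF gL nlb]
  have sqg: "square_integrable g" and sqh: "square_integrable h" using gL H(1) by (simp_all add: sphere_L2_iff)
  have g0: "cls (sphere_proj 0 g) = 0" using zero_mean_iff[OF gL] gm by simp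
  obtain e where e: "norm e = 1"
    and min: "sphere_min (\<lambda>e. 1 * (\<integral>x. (1 - x \<bullet> e) * (norm (h x))\<^sup>2 \<partial>sphere_measure)) =
       1 * sphere_area TYPE('a) * ((norm (cls h))\<^sup>2 - coord_mult e (cls h) \<bullet> cls h)"
    by (rule weighted_min[OF sqh, of 1]) simp
  define w where "w = z e"
  have w1: "norm w = 1" using e by (simp add: w_def norm_z)
  define F where "F = cls (\<lambda>x. h x - cnj w * z x * h x)"
  define R where "R = (norm (cls h))\<^sup>2 - coord_mult e (cls h) \<bullet> cls h"
  have F2: "(norm F)\<^sup>2 = 2 * R" unfolding F_def w_def R_def by (rule weight_eq_shift[OF sqh e])
  define a where "a = (\<lambda>k. coef k (cls h))"
  have aF: "coef k F = a k - cnj w * a (k - 1)" for k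
    unfolding F_def a_def by (rule coef_shift[OF sqh])
  have a0: "a 0 = 0"
    unfolding a_def
  proof (rule coef_eqI)
    fix c
    have E0: "(\<lambda>x. c * E 0 x) \<in> spherical_harmonics 0" using E_harmonic[of c 0] by simp
    show "cls h \<bullet> cls (\<lambda>x. c * E 0 x) = Re (0 * cnj c)"
      unfolding sphere_proj_inner[OF H(1) E0] H(2) by simp
  qed
  define p where "p = (\<lambda>j. norm (a (int j)))"
  define q where "q = (\<lambda>j. norm (a (- int j)))"
  have p0: "p 0 = 0" and q0: "q 0 = 0" using a0 by (simp_all add: p_def q_def)
  have rev: "\<bar>norm v - norm u\<bar> \<le> norm (v - cnj w * u)" for u v
  proof -
    have "norm (cnj w * u) = norm u" using w1 by (simp add: norm_mult)
    then show ?thesis using norm_triangle_ineq3[of v "cnj w * u"] by simp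
  qed
  have diffs: "(\<Sum>j=1..N. (p j - p (j - 1))\<^sup>2) + (\<Sum>j=1..N. (q j - q (j - 1))\<^sup>2) \<le> 2 * R" for N
  proof -
    have "(\<Sum>j=1..N. (p j - p (j - 1))\<^sup>2) \<le> (\<Sum>j=1..N. (norm (coef (int j) F))\<^sup>2)"
    proof (rule sum_mono)
      fix j assume j: "j \<in> {1..N}"
      then have "int (j - 1) = int j - 1" by (simp add: of_nat_diff)
      then have "\<bar>p j - p (j - 1)\<bar> \<le> norm (coef (int j) F)"
        using rev[of "a (int j)" "a (int j - 1)"] by (simp add: p_def aF)
      then show "(p j - p (j - 1))\<^sup>2 \<le> (norm (coef (int j) F))\<^sup>2" by (simp add: abs_le_square_iff[symmetric])
    qed
    moreover have "(\<Sum>j=1..N. (q j - q (j - 1))\<^sup>2) \<le> (\<Sum>j=1..N. (norm (coef (1 - int j) F))\<^sup>2)"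
    proof (rule sum_mono)
      fix j assume j: "j \<in> {1..N}"
      then have jj: "- int (j - 1) = 1 - int j" by (simp add: of_nat_diff)
      have "\<bar>q (j - 1) - q j\<bar> \<le> norm (coef (1 - int j) F)"
        using rev[of "a (1 - int j)" "a (- int j)"] unfolding q_def jj aF by simp
      then have "\<bar>q j - q (j - 1)\<bar> \<le> norm (coef (1 - int j) F)" by (simp add: abs_minus_commute)
      then show "(q j - q (j - 1))\<^sup>2 \<le> (norm (coef (1 - int j) F))\<^sup>2" by (simp add: abs_le_square_iff[symmetric])
    qed
    ultimately show ?thesis using sum_coef_differences_le[of F N] F2 by linarith
  qed
  have gn: "(norm (cls (sphere_proj n g)))\<^sup>2 = (p n)\<^sup>2 / (real n)\<^sup>2 + (q n)\<^sup>2 / (real n)\<^sup>2" if n: "1 \<le> n" for n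
  proof -
    have "(norm (cls (sphere_proj n h)))\<^sup>2 = (real n)\<^sup>2 * (norm (cls (sphere_proj n g)))\<^sup>2"
      unfolding H(3)[OF n] eigenvalue_circle_sqrt by (simp add: power_mult_distrib)
    moreover have "(norm (cls (sphere_proj n h)))\<^sup>2 = (p n)\<^sup>2 + (q n)\<^sup>2"
      unfolding norm_sphere_proj_circle[OF H(1) n] p_def q_def a_def ..
    ultimately show ?thesis using n by (simp add: add_divide_distrib[symmetric])
  qed
  have bd: "(\<Sum>n<N. (norm (cls (sphere_proj n g)))\<^sup>2) \<le> 8 * R" for N
  proof -
    have "(\<Sum>n<N. (norm (cls (sphere_proj n g)))\<^sup>2) \<le> (\<Sum>n\<in>{0..N}. (norm (cls (sphere_proj n g)))\<^sup>2)"
      by (rule sum_mono2) auto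
    also have "\<dots> = (\<Sum>n=1..N. (norm (cls (sphere_proj n g)))\<^sup>2)"
      by (subst sum.atLeast_Suc_atMost) (simp_all add: g0)
    also have "\<dots> = (\<Sum>n=1..N. (p n)\<^sup>2 / (real n)\<^sup>2) + (\<Sum>n=1..N. (q n)\<^sup>2 / (real n)\<^sup>2)"
      unfolding sum.distrib[symmetric] by (rule sum.cong[OF refl]) (simp add: gn)
    also have "\<dots> \<le> 4 * (2 * R)"
      using discrete_Hardy[of p N, OF p0] discrete_Hardy[of q N, OF q0] diffs[of N] by linarith
    finally show ?thesis by simp
  qed
  have "(\<lambda>N. \<Sum>n<N. (norm (cls (sphere_proj n g)))\<^sup>2) \<longlonglongrightarrow> (norm (cls g))\<^sup>2"
    using Parseval[OF d2 gL] by (simp add: sums_def)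
  then have "(norm (cls g))\<^sup>2 \<le> 8 * R" by (rule LIMSEQ_le_const2) (use bd in blast)
  then have "sphere_area TYPE('a) * (norm (cls g))\<^sup>2 \<le> sphere_area TYPE('a) * (8 * R)"
    using sphere_area_pos[where 'a='a] by (intro mult_left_mono) auto
  moreover have "(\<integral>x. (norm (g x))\<^sup>2 \<partial>sphere_measure) = sphere_area TYPE('a) * (norm (cls g))\<^sup>2"
    using norm_cls_eq_integral[OF sqg] sphere_area_pos[where 'a='a] by simp
  moreover have "sphere_min (\<lambda>e. \<integral>x. (1 - x \<bullet> e) * (norm (h x))\<^sup>2 \<partial>sphere_measure) = sphere_area TYPE('a) * R"
    using min by (simp add: R_def)
  ultimately show "(\<integral>x. (norm (g x))\<^sup>2 \<partial>sphere_measure)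
    \<le> 8 * sphere_min (\<lambda>e. \<integral>x. (1 - x \<bullet> e) * (norm (neg_laplace_beltrami_power (1/2) g x))\<^sup>2 \<partial>sphere_measure)"
    by (simp add: h_def mult.left_commute)
qed

text \<open>
  Testing the Hardy--Rellich inequality with \<open>\<Sum>n. (b n / n) * z\<^sup>n\<close> and \<open>e = b1\<close>, where \<open>z b1 = 1\<close>, gives back
  a discrete Hardy inequality for \<open>b\<close>.
\<close>

lemma Hardy_Rellich_circle_test:
  assumes C: "hardy_rellich_constant TYPE('a) C" "C > 0" and b0: "b 0 = 0" and bN: "\<And>n. N \<le> n \<Longrightarrow> b n = 0"
  shows "(\<Sum>n=1..N. (b n)\<^sup>2 / (real n)\<^sup>2) \<le> C / 2 * (\<Sum>n=1..N. (b n - b (n - 1))\<^sup>2)"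
proof -
  define Z where "Z = (\<lambda>c n x. complex_of_real (c n) * E (int n) x)"
  have Z: "Z c n \<in> spherical_harmonics n" for c n
    unfolding Z_def using E_harmonic[of "complex_of_real (c n)" "int n"] by simp
  have nZ: "norm (cls (Z c n)) = \<bar>c n\<bar>" for c n unfolding Z_def norm_E_cls by simp
  have Z0: "cls (Z c n) = 0" if "c n = 0" for c n using nZ[of c n] that by simp
  define b' where "b' = (\<lambda>n. b n / real n)"
  have b'0: "b' n = 0" if "N \<le> n" for n using bN[OF that] by (simp add: b'_def)
  have fin: "summable (\<lambda>n. (norm (cls (Z c n)))\<^sup>2)" if "\<And>n. N \<le> n \<Longrightarrow> c n = 0" for c
    by (rule summable_finite[of "{..<N}"]) (auto simp: nZ that not_less)
  obtain g where g: "g \<in> sphere_L2" "(\<lambda>n. cls (Z b' n)) sums cls g" "\<And>n. cls (sphere_proj n g) = cls (Z b' n)"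
    using harmonic_series_limit[where Y="Z b'", OF d2 Z fin[of b', OF b'0]] by blast
  obtain h where h: "h \<in> sphere_L2" "(\<lambda>n. cls (Z b n)) sums cls h" "\<And>n. cls (sphere_proj n h) = cls (Z b n)"
    using harmonic_series_limit[where Y="Z b", OF d2 Z fin[of b, OF bN]] by blast
  have sqg: "square_integrable g" and sqh: "square_integrable h" using g(1) h(1) by (simp_all add: sphere_L2_iff)
  have sqZ: "square_integrable (Z c n)" for c n by (rule spherical_harmonics_square_integrable[OF Z])
  have nlb: "is_neg_laplace_beltrami_power (1/2) g h"
  proof (rule is_neg_laplace_beltrami_powerI[OF g(1) h(1)])
    show "cls (sphere_proj 0 h) = 0" unfolding h(3) by (rule Z0[of b 0, OF b0])
    fix n :: nat assume n: "1 \<le> n"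
    have "real n *\<^sub>R cls (Z b' n) = cls (\<lambda>x. real n *\<^sub>R Z b' n x)" by (rule cls_scaleR[OF sqZ, symmetric])
    also have "(\<lambda>x. real n *\<^sub>R Z b' n x) = Z b n"
      using n by (simp add: fun_eq_iff Z_def b'_def scaleR_conv_of_real)
    finally show "cls (sphere_proj n h) = (eigenvalue TYPE('a) n powr (1/2)) *\<^sub>R cls (sphere_proj n g)"
      unfolding eigenvalue_circle_sqrt g(3) h(3) by simp
  qed
  have g0: "cls (sphere_proj 0 g) = 0" unfolding g(3) by (rule Z0) (simp add: b'_def)
  have gW: "g \<in> sphere_W21_zero_mean"
    using g(1) nlb g0 zero_mean_iff[OF g(1)] by (auto simp: sphere_W21_zero_mean_def sphere_W21_def)
  define k where "k = neg_laplace_beltrami_power (1/2) g"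
  have k: "k \<in> sphere_L2" "cls k = cls h"
    unfolding k_def by (rule neg_laplace_beltrami_power_eq[OF d2 g(1) nlb])+
  have sqk: "square_integrable k" using k(1) by (simp add: sphere_L2_iff)
  define f where "f = (\<lambda>x. \<Sum>n\<in>{..N}. Z b n x)"
  have sqf: "square_integrable f" unfolding f_def by (rule square_integrable_sum) (rule sqZ)
  have "cls f = (\<Sum>n\<in>{..N}. cls (Z b n))" unfolding f_def by (rule cls_sum) (rule sqZ)
  moreover have "(\<lambda>n. cls (Z b n)) sums (\<Sum>n\<in>{..N}. cls (Z b n))"
    by (rule sums_finite) (auto intro!: Z0 bN)
  ultimately have fh: "cls f = cls h" using h(2) sums_unique2 by metis
  define \<delta> where "\<delta> = (\<lambda>n. b n - b (n - 1))"
  have b1: "norm b1 = 1" by (rule norm_Basis) (simp add: Basis_eq)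
  have shift: "f x - cnj (z b1) * z x * f x = (\<Sum>n\<in>{..Suc N}. Z \<delta> n x)" if x: "norm x = 1" for x
  proof -
    have "z x * f x = (\<Sum>n\<in>{..N}. complex_of_real (b n) * E (int (Suc n)) x)"
      unfolding f_def sum_distrib_left
      by (rule sum.cong[OF refl]) (simp add: Z_def mult.left_commute z_E[OF x] add.commute)
    also have "\<dots> = (\<Sum>n\<in>{..Suc N}. complex_of_real (b (n - 1)) * E (int n) x)"
      unfolding sum.atMost_Suc_shift by (simp add: b0)
    finally have 1: "z x * f x = (\<Sum>n\<in>{..Suc N}. complex_of_real (b (n - 1)) * E (int n) x)" .
    have 2: "f x = (\<Sum>n\<in>{..Suc N}. complex_of_real (b n) * E (int n) x)"
      using bN[of "Suc N"] by (simp add: f_def Z_def)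
    have "f x - z x * f x = (\<Sum>n\<in>{..Suc N}. complex_of_real (b n) * E (int n) x - complex_of_real (b (n - 1)) * E (int n) x)"
      unfolding 1 by (subst 2) (rule sum_subtractf[symmetric])
    also have "\<dots> = (\<Sum>n\<in>{..Suc N}. Z \<delta> n x)"
      by (rule sum.cong[OF refl]) (simp add: Z_def \<delta>_def left_diff_distrib)
    finally show ?thesis by (simp add: z_b1)
  qed
  have "(norm (cls (\<lambda>x. f x - cnj (z b1) * z x * f x)))\<^sup>2 = (\<Sum>n\<in>{..Suc N}. (\<delta> n)\<^sup>2)"
  proof -
    have "cls (\<lambda>x. f x - cnj (z b1) * z x * f x) = cls (\<lambda>x. \<Sum>n\<in>{..Suc N}. Z \<delta> n x)"
      by (rule cls_cong[OF square_integrable_diff[OF sqf sq_shift[OF sqf]] square_integrable_sum[OF sqZ] shift])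
    also have "\<dots> = (\<Sum>n\<in>{..Suc N}. cls (Z \<delta> n))" by (rule cls_sum) (rule sqZ)
    finally show ?thesis
      using norm_sum_orthogonal[of "\<lambda>n. cls (Z \<delta> n)" "{..Suc N}"] spherical_harmonics_orthogonal[OF d2 Z Z]
      by (simp add: nZ del: sum.atMost_Suc)
  qed
  also have "(\<Sum>n\<in>{..Suc N}. (\<delta> n)\<^sup>2) = (\<Sum>n=1..N. (\<delta> n)\<^sup>2)"
  proof (rule sum.mono_neutral_right)
    show "\<forall>n\<in>{..Suc N} - {1..N}. (\<delta> n)\<^sup>2 = 0"
    proof
      fix n assume "n \<in> {..Suc N} - {1..N}"
      then have "n = 0 \<or> n = Suc N" by auto
      then show "(\<delta> n)\<^sup>2 = 0" using bN[of N] bN[of "Suc N"] by (auto simp: \<delta>_def)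
    qed
  qed auto
  finally have R: "2 * ((norm (cls h))\<^sup>2 - coord_mult b1 (cls h) \<bullet> cls h) = (\<Sum>n=1..N. (\<delta> n)\<^sup>2)"
    unfolding weight_eq_shift[OF sqf b1] fh .
  obtain e0 where
    min: "sphere_min (\<lambda>e. 1 * (\<integral>x. (1 - x \<bullet> e) * (norm (k x))\<^sup>2 \<partial>sphere_measure)) =
       1 * sphere_area TYPE('a) * ((norm (cls k))\<^sup>2 - coord_mult e0 (cls k) \<bullet> cls k)"
    and le: "\<And>e'. norm e' = 1 \<Longrightarrow> 1 * sphere_area TYPE('a) * ((norm (cls k))\<^sup>2 - coord_mult e0 (cls k) \<bullet> cls k)
        \<le> 1 * sphere_area TYPE('a) * ((norm (cls k))\<^sup>2 - coord_mult e' (cls k) \<bullet> cls k)"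
    by (rule weighted_min[OF sqk, of 1], simp) (rule that; assumption)
  have ap: "sphere_area TYPE('a) > 0" by (rule sphere_area_pos)
  have "sphere_area TYPE('a) * (norm (cls g))\<^sup>2 = (\<integral>x. (norm (g x))\<^sup>2 \<partial>sphere_measure)"
    using norm_cls_eq_integral[OF sqg] ap by simp
  also have "\<dots> \<le> C * sphere_min (\<lambda>e. \<integral>x. (1 - x \<bullet> e) * (norm (k x))\<^sup>2 \<partial>sphere_measure)"
    using C(1) gW unfolding hardy_rellich_constant_def k_def by blast
  also have "\<dots> \<le> C * (sphere_area TYPE('a) * ((norm (cls h))\<^sup>2 - coord_mult b1 (cls h) \<bullet> cls h))"
    using min le[OF b1] C(2) by (intro mult_left_mono) (auto simp: k(2))
  also have "\<dots> = sphere_area TYPE('a) * (C / 2 * (\<Sum>n=1..N. (\<delta> n)\<^sup>2))" unfolding R[symmetric] by simp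
  finally have main: "(norm (cls g))\<^sup>2 \<le> C / 2 * (\<Sum>n=1..N. (\<delta> n)\<^sup>2)" using ap by (simp only: mult_le_cancel_left_pos)
  have "(\<Sum>n=1..N. (b n)\<^sup>2 / (real n)\<^sup>2) = (\<Sum>n=1..N. (norm (cls (sphere_proj n g)))\<^sup>2)"
    unfolding g(3) nZ by (simp add: b'_def power_divide)
  also have "\<dots> \<le> (norm (cls g))\<^sup>2"
    by (rule Bessel_inequality[OF sphere_proj_orthogonal[OF d2 g(1) g(1)] sphere_proj_inner_self[OF g(1)]]) auto
  also note main
  finally show ?thesis by (simp add: \<delta>_def)
qed

text \<open>
  For the sequences \<open>hardy_seq M\<close> the two sides of the Hardy inequality grow like \<open>harm M\<close> and
  \<open>harm M / 4\<close>, up to bounded terms, and \<open>harm M\<close> is unbounded.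
\<close>

theorem Hardy_Rellich_circle_sharp:
  assumes C: "hardy_rellich_constant TYPE('a) C" shows "inverse C \<le> 1 / 8"
proof (rule ccontr)
  assume "\<not> inverse C \<le> 1 / 8"
  then have i: "inverse C > 1 / 8" by simp
  then have C0: "C > 0" by (metis inverse_positive_iff_positive less_trans zero_less_divide_1_iff zero_less_numeral)
  have C8: "C < 8" using i C0 by (simp add: field_simps)
  have le: "harm M \<le> C / (1 - C / 8)" if M: "M \<ge> 1" for M
  proof -
    have "harm M \<le> (\<Sum>n=1..2 * M. (hardy_seq M n)\<^sup>2 / (real n)\<^sup>2)" by (rule hardy_seq_weighted_ge)
    also have "\<dots> \<le> C / 2 * (\<Sum>n=1..2 * M. (hardy_seq M n - hardy_seq M (n - 1))\<^sup>2)"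
      by (rule Hardy_Rellich_circle_test[OF C C0]) (use hardy_seq_beyond[OF M] in \<open>auto simp: hardy_seq_def\<close>)
    also have "\<dots> \<le> C / 2 * (2 + harm M / 4)"
      using C0 by (intro mult_left_mono hardy_seq_energy_le[OF M]) simp
    finally have "harm M * (1 - C / 8) \<le> C" by (simp add: algebra_simps)
    then show ?thesis using C8 by (simp add: pos_le_divide_eq)
  qed
  have "eventually (\<lambda>M. C / (1 - C / 8) < harm M) sequentially"
    using harm_at_top by (simp add: filterlim_at_top_dense)
  then have "eventually (\<lambda>M. False) sequentially"
    using eventually_ge_at_top[of "1::nat"]
  proof eventually_elim
    case (elim M)
    then show ?case using le[of M] by linarith
  qed
  then show False by simp
qed

end

section \<open>The uncertainty inequality\<close>

lemma circle_basis:
  assumes "DIM('a::euclidean_space) = 2"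
  obtains b1 b2 :: "'a::euclidean_space" where "circle b1 b2"
proof -
  obtain b1 b2 :: 'a where "Basis = {b1, b2}" "b1 \<noteq> b2" using assms unfolding card_2_iff by blast
  then show ?thesis using that by (simp add: circle_def)
qed

theorem theorem4p1:
  assumes "2 \<le> DIM('a::euclidean_space)"
  shows "(\<forall>f \<in> (sphere_W21_zero_mean :: ('a \<Rightarrow> complex) set). sphere_norm f = 1 \<longrightarrow>
            (3 \<le> DIM('a) \<longrightarrow>
               uncertainty_inequality f
                 ((real DIM('a) - 1) * (1 - 2 / sqrt (real DIM('a) + 3)))) \<and>
            (DIM('a) \<noteq> 3 \<longrightarrow>
               (\<forall>C. hardy_rellich_constant TYPE('a) C \<longrightarrow> uncertainty_inequality f (inverse C))) \<and>
            (DIM('a) = 2 \<longrightarrow> uncertainty_inequality f (1 / 8))) \<and>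
         (DIM('a) = 2 \<longrightarrow>
            hardy_rellich_constant TYPE('a) 8 \<and>
            (\<forall>C. hardy_rellich_constant TYPE('a) C \<longrightarrow> inverse C \<le> 1 / 8))"
proof -
  have two: "hardy_rellich_constant TYPE('a) 8" "\<And>C. hardy_rellich_constant TYPE('a) C \<Longrightarrow> inverse C \<le> 1 / 8"
    if 2: "DIM('a) = 2"
  proof -
    obtain b1 b2 :: 'a where c: "circle b1 b2" by (rule circle_basis[OF 2])
    show "hardy_rellich_constant TYPE('a) 8" by (rule circle.Hardy_Rellich_circle[OF c])
    show "inverse C \<le> 1 / 8" if "hardy_rellich_constant TYPE('a) C" for C
      by (rule circle.Hardy_Rellich_circle_sharp[OF c that])
  qed
  have eighth: "uncertainty_inequality f (1 / 8)"
    if "f \<in> sphere_W21_zero_mean" "sphere_norm f = 1" "DIM('a) = 2" for f :: "'a \<Rightarrow> complex"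
    using Hardy_Rellich_imp_uncertainty[OF assms that(1,2) two(1)[OF that(3)]] by (simp add: inverse_eq_divide)
  show ?thesis
    using uncertainty_explicit_constant[OF assms] Hardy_Rellich_imp_uncertainty[OF assms] eighth two by blast
qed

end
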